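(* For each $n\ge1$, let $\boldsymbol\rho_n$ and $\boldsymbol\pi_n$ be independent uniformly distributed elements of $\mathrm{NC}(n)$. As $n$ tends to infinity, the quantity $\frac1n d_{\mathcal H_n}(\boldsymbol\rho_n,\boldsymbol\pi_n)$ converges in probability to $1-\kappa$.
   Context: Non-crossing partitions: $\mathrm{NC}(n)$ is the set of partitions of $\{1,\dots,n\}$ into non-empty disjoint blocks such that there are no two distinct blocks $V\ne W$ and $a<b<c<d$ with $a,c\in V$ and $b,d\in W$. It is ordered by refinement: $\pi\le\rho$ if every block of $\pi$ is contained in a block of $\rho$. We say $\rho$ covers $\pi$ if $\pi<\rho$ and there is no $\theta\in \mathrm{NC}(n)$ with $\pi<\theta<\rho$. $\mathcal H_n$ is the undirected graph with vertex set $\mathrm{NC}(n)$ in which $\pi,\rho$ are adjacent when one covers the other (the Hasse diagram), and $d_{\mathcal H_n}$ is its graph distance. The constant $\kappa$: let $(a_i)_{i\in\mathbb Z}$ and $(b_i)_{i\in\mathbb Z}$ be two independent sequences of i.i.d. uniform random variables in $\{L,R\}$. Almost surely there is a unique non-crossing partition of $\mathbb Z$ into pairs (no two pairs $\{i,k\},\{j,\ell\}$ with $i<j<k<\ell$) such that, for all $i$, $i$ is the smaller element of its pair if and only if $a_i=L$; similarly for $(b_i)$. The infinite noodle $\boldsymbol M_\infty$ is the (multi-)graph on $\mathbb Z$ whose edges are the pairs of both pair-partitions. Let $|C_0(\boldsymbol M_\infty)|\in\mathbb N\cup\{\infty\}$ be the number of points in the connected component of $0$. Then $\kappa=\mathbb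 E\big[2/|C_0(\boldsymbol M_\infty)|\big]$, with the convention $2/\infty=0$. (This $\kappa$ is also the limit in probability of $\mathrm{cc}(\boldsymbol M_n)/n$, where $\boldsymbol M_n$ is a uniformly random ordered pair of non-crossing perfect matchings of $\{0,\dots,2n-1\}$ and $\mathrm{cc}(\boldsymbol M_n)$ is the number of connected components of the multigraph formed by the pairs of both matchings.) *)

theory Defs
  imports "HOL-Probability.Probability" "HOL-Library.Disjoint_Sets"
begin

definition noncrossing :: "'a::linorder set set \<Rightarrow> bool" where
  "noncrossing P \<longleftrightarrow>
     \<not> (\<exists>V\<in>P. \<exists>W\<in>P. V \<noteq> W \<and>
          (\<exists>a b c d. a < b \<and> b < c \<and> c < d \<and> a \<in> V \<and> c \<in> V \<and> b \<in> W \<and> d \<in> W))"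

definition NC :: "nat \<Rightarrow> nat set set set" where
  "NC n = {P. partition_on {1..n} P \<and> noncrossing P}"

definition NC_less :: "nat \<Rightarrow> nat set set \<Rightarrow> nat set set \<Rightarrow> bool" where
  "NC_less n P Q \<longleftrightarrow> refines {1..n} P Q \<and> P \<noteq> Q"

definition NC_covers :: "nat \<Rightarrow> nat set set \<Rightarrow> nat set set \<Rightarrow> bool" where
  "NC_covers n Q P \<longleftrightarrow>
     P \<in> NC n \<and> Q \<in> NC n \<and> NC_less n P Q \<and>
     \<not> (\<exists>T\<in>NC n. NC_less n P T \<and> NC_less n T Q)"

definition hasse :: "nat \<Rightarrow> (nat set set \<times> nat set set) set" where
  "hasse n = {(P, Q). NC_covers n P Q \<or> NC_covers n Q P}"

text \<open>
  Distance in the graph with edge relation \<open>E\<close>: the least number of edges of a walk.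
  It is meaningful only for vertices joined by a walk; \<open>hasse_connected\<close> below shows that
  this is the case for any two vertices of the Hasse diagram.
\<close>

definition graph_dist :: "('a \<times> 'a) set \<Rightarrow> 'a \<Rightarrow> 'a \<Rightarrow> nat" where
  "graph_dist E x y = (LEAST k. (x, y) \<in> E ^^ k)"

lemma finite_NC: "finite (NC n)"
  by (rule finite_subset[of _ "Pow (Pow {1..n})"])
     (auto simp: NC_def partition_on_def)

lemma hasse_refines_path:
  assumes "P \<in> NC n" "Q \<in> NC n" "refines {1..n} P Q"
  shows "(P, Q) \<in> (hasse n)\<^sup>*"
  using assms
proof (induction "card {T \<in> NC n. refines {1..n} P T \<and> refines {1..n} T Q}"
    arbitrary: P Q rule: less_induct)
  case less
  let ?I = "\<lambda>P Q. {T \<in> NC n. refines {1..n} P T \<and> refines {1..n} T Q}"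
  have fin: "finite (?I P Q)"
    using finite_NC[of n] by auto
  consider "P = Q" | "NC_covers n Q P"
    | T where "T \<in> NC n" "NC_less n P T" "NC_less n T Q"
    using less.prems by (auto simp: NC_covers_def NC_less_def)
  then show ?case
  proof cases
    case 1
    then show ?thesis by simp
  next
    case 2
    then show ?thesis by (auto simp: hasse_def)
  next
    case 3
    then have T: "refines {1..n} P T" "refines {1..n} T Q" "P \<noteq> T" "T \<noteq> Q"
      by (auto simp: NC_less_def)
    have refl: "refines {1..n} P P" "refines {1..n} Q Q"
      using less.prems by (auto simp: refines_def)
    have "?I P T \<subset> ?I P Q"
      using T refl less.prems refines_trans refines_asym by blast
    moreover have "?I T Q \<subset> ?I P Q"
      using T refl less.prems refines_trans refines_asym by blast
    ultimately have "(P, T) \<in> (hasse n)\<^sup>*" "(T, Q) \<in> (hasse n)\<^sup>*"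
      using less.hyps less.prems 3(1) T fin by (auto simp: psubset_card_mono)
    then show ?thesis by (rule rtrancl_trans)
  qed
qed

lemma hasse_connected:
  assumes "P \<in> NC n" "Q \<in> NC n"
  shows "\<exists>k. (P, Q) \<in> hasse n ^^ k"
proof (cases "n = 0")
  case True
  then have "P = Q" using assms by (auto simp: NC_def partition_on_def)
  then have "(P, Q) \<in> hasse n ^^ 0" by simp
  then show ?thesis ..
next
  case False
  define top where "top = {{1..n}}"
  have top: "top \<in> NC n"
    using False by (auto simp: top_def NC_def partition_on_def noncrossing_def)
  have ref: "refines {1..n} R top" if "R \<in> NC n" for R
    using that top by (auto simp: refines_def NC_def top_def partition_on_def)
  have "sym (hasse n)" by (auto simp: sym_def hasse_def)
  then have "sym ((hasse n)\<^sup>*)" by (rule sym_rtrancl)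
  moreover have "(P, top) \<in> (hasse n)\<^sup>*" "(Q, top) \<in> (hasse n)\<^sup>*"
    using hasse_refines_path ref assms top by blast+
  ultimately have "(P, Q) \<in> (hasse n)\<^sup>*"
    by (meson rtrancl_trans symD)
  then show ?thesis by (simp add: rtrancl_is_UN_relpow)
qed

datatype side = L | R

definition is_arc_system :: "(int \<Rightarrow> side) \<Rightarrow> int set set \<Rightarrow> bool" where
  "is_arc_system a P \<longleftrightarrow>
     partition_on UNIV P \<and> (\<forall>V\<in>P. card V = 2) \<and> noncrossing P \<and>
     (\<forall>V\<in>P. \<forall>i\<in>V. i = Min V \<longleftrightarrow> a i = L)"

text \<open>
  For almost all \<open>a\<close> there is exactly one arc system. The value \<open>{}\<close> on the exceptional null
  set only serves to make the integrand in \<open>kappa\<close> measurable.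
\<close>

definition arcs :: "(int \<Rightarrow> side) \<Rightarrow> int set set" where
  "arcs a = (if \<exists>!P. is_arc_system a P then THE P. is_arc_system a P else {})"

text \<open>Edge multiplicities do not affect connected components, so the edges form a relation.\<close>

definition noodle :: "(int \<Rightarrow> side) \<Rightarrow> (int \<Rightarrow> side) \<Rightarrow> (int \<times> int) set" where
  "noodle a b = {(i, j). i \<noteq> j \<and> {i, j} \<in> arcs a \<union> arcs b}"

definition noodle_component :: "(int \<Rightarrow> side) \<Rightarrow> (int \<Rightarrow> side) \<Rightarrow> int set" where
  "noodle_component a b = {j. (0, j) \<in> (noodle a b)\<^sup>*}"

definition side_sequences :: "(int \<Rightarrow> side) measure" where
  "side_sequences = (\<Pi>\<^sub>M i\<in>(UNIV :: int set). measure_pmf (pmf_of_set {L, R}))"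

definition kappa :: real where
  "kappa = (\<integral>(a, b). (if finite (noodle_component a b)
                     then 2 / real (card (noodle_component a b)) else 0)
              \<partial>(side_sequences \<Otimes>\<^sub>M side_sequences))"

end

theory Submission
  imports Defs "HOL-Real_Asymp.Real_Asymp"
begin

text \<open>
  A non-crossing partition of \<open>{1..n}\<close> is thickened to a non-crossing matching of \<open>2n\<close> points, the sides
  of the elements. A covering step in the Hasse diagram exchanges two arcs of the matching, so it changes
  the number \<open>cc\<close> of components of the union of two matchings by at most one; conversely some step towards
  \<open>\<rho>\<close> always creates a new component. Hence the distance is exactly \<open>n - cc\<close>.

  The number of components is the sum over all points of \<open>1 / |C|\<close>, \<open>C\<close> being the component of the point. Up to a small
  error this is a sum of functions of bounded windows of the two words describing the matchings. Under
  independent fair letters such sums are concentrated with exponentially small error probability. There are at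
  least \<open>4 ^ n / (4 n\<^sup>2)\<close> non-crossing partitions, so uniform pairs of them correspond to an event of only
  polynomially small probability for independent letters, and the concentration carries over. The limit is identified by letting
  the window grow, using that the simple random walk is recurrent.
\<close>

subsection \<open>Components of finite graphs\<close>

text \<open>A uniform non-crossing partition gives a word whose letters are not independent, and the
  event on which independent letters form such a word has probability tending to zero. A law of
  large numbers without a rate would therefore not carry over. An exponential rate beats the
  polynomial loss, and it is available for averages of functions of bounded windows, which is why
  everything has to be expressed through such functions.

  A component can escape a bounded window in two ways. If it has more than \<open>K\<close> points,
  each of its points has weight at most \<open>1 / (K + 1)\<close>, whatever the rest looks like. If
  it uses an arc longer than \<open>K\<close>, the arc is deleted at the price of one component; the
  deleted arcs are themselves counted by a function of a bounded window, so this count concentrates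
  too. Its mean is small for large \<open>K\<close> because almost every bi-infinite word has a
  partner for each letter, and this is where recurrence enters. The cutoff \<open>K\<close> is fixed
  by the accuracy before \<open>n\<close> grows. The factor \<open>2\<close> in \<open>kappa\<close>
  is the number of sides per element: \<open>2 * n\<close> points are summed over, but the result is
  divided by \<open>n\<close>.\<close>

definition ncomp :: "'a set \<Rightarrow> ('a \<times> 'a) set \<Rightarrow> nat" where
  "ncomp V E = card ((\<lambda>i. E\<^sup>* `` {i}) ` V)"

lemma rtrancl_Image_eq:
  assumes "sym E" "(i, j) \<in> E\<^sup>*"
  shows "E\<^sup>* `` {i} = E\<^sup>* `` {j}"
proof -
  have "(j, i) \<in> E\<^sup>*" using assms sym_rtrancl[OF assms(1)] by (auto dest: symD)
  then show ?thesis using assms(2) by (auto intro: rtrancl_trans)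
qed

lemma rtrancl_Image_eq_iff:
  assumes "sym E"
  shows "E\<^sup>* `` {i} = E\<^sup>* `` {j} \<longleftrightarrow> (i, j) \<in> E\<^sup>*"
  using rtrancl_Image_eq[OF assms] by blast

lemma rtrancl_Image_absorb:
  assumes "E \<subseteq> F\<^sup>*"
  shows "F\<^sup>* `` (E\<^sup>* `` {i}) = F\<^sup>* `` {i}"
proof -
  have "E\<^sup>* \<subseteq> F\<^sup>*" using rtrancl_mono[OF assms] by simp
  then show ?thesis by (auto intro: rtrancl_trans)
qed

lemma ncomp_mono:
  assumes "finite V" "E \<subseteq> F\<^sup>*"
  shows "ncomp V F \<le> ncomp V E"
proof -
  have "(\<lambda>i. F\<^sup>* `` {i}) ` V = (\<lambda>C. F\<^sup>* `` C) ` ((\<lambda>i. E\<^sup>* `` {i}) ` V)"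
    by (simp add: image_image rtrancl_Image_absorb[OF assms(2)])
  then show ?thesis unfolding ncomp_def using assms(1) by (simp add: card_image_le)
qed

lemma rtrancl_insert_edge:
  assumes "(i, j) \<in> (E \<union> {(x, y), (y, x)})\<^sup>*" "sym E"
  shows "(i, j) \<in> E\<^sup>* \<or> (((i, x) \<in> E\<^sup>* \<or> (i, y) \<in> E\<^sup>*) \<and> ((j, x) \<in> E\<^sup>* \<or> (j, y) \<in> E\<^sup>*))"
  using assms(1)
proof (induction rule: rtrancl_induct)
  case (step j k)
  have s: "(u, v) \<in> E\<^sup>* \<Longrightarrow> (v, u) \<in> E\<^sup>*" for u v using sym_rtrancl[OF assms(2)] by (auto dest: symD)
  from step.hyps(2) consider "(j, k) \<in> E" | "j = x" "k = y" | "j = y" "k = x" by auto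
  then show ?case
  proof cases
    case 1
    then have jk: "(j, k) \<in> E\<^sup>*" "(k, j) \<in> E\<^sup>*" using s by auto
    show ?thesis using step.IH jk by (meson rtrancl_trans)
  qed (use step.IH in auto)
qed simp

text \<open>Only the classes of \<open>x\<close> and \<open>y\<close> can be fused by the new edge,
  so sending a class of \<open>E\<close> to the class containing it in the larger graph is injective
  once the class of \<open>y\<close> is left out.\<close>

lemma ncomp_insert_edge:
  assumes "finite V" "sym E"
  shows "ncomp V E \<le> Suc (ncomp V (E \<union> {(x, y), (y, x)}))"
proof -
  define F where "F = E \<union> {(x, y), (y, x)}"
  have symF: "sym F" using assms(2) by (auto simp: F_def sym_def)
  have EF: "E \<subseteq> F\<^sup>*" by (auto simp: F_def)
  let ?C = "(\<lambda>i. E\<^sup>* `` {i}) ` V"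
  have s: "(u, v) \<in> E\<^sup>* \<Longrightarrow> (v, u) \<in> E\<^sup>*" for u v using sym_rtrancl[OF assms(2)] by (auto dest: symD)
  have inj: "inj_on (\<lambda>C. F\<^sup>* `` C) (?C - {E\<^sup>* `` {y}})"
  proof (rule inj_onI)
    fix C D
    assume C: "C \<in> ?C - {E\<^sup>* `` {y}}" and D: "D \<in> ?C - {E\<^sup>* `` {y}}"
      and eq: "F\<^sup>* `` C = F\<^sup>* `` D"
    obtain i where i: "C = E\<^sup>* `` {i}" "(i, y) \<notin> E\<^sup>*" using C rtrancl_Image_eq[OF assms(2)] by blast
    obtain j where j: "D = E\<^sup>* `` {j}" "(j, y) \<notin> E\<^sup>*" using D rtrancl_Image_eq[OF assms(2)] by blast
    have "F\<^sup>* `` {i} = F\<^sup>* `` {j}" using eq i j rtrancl_Image_absorb[OF EF] by simp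
    then have "(i, j) \<in> F\<^sup>*" using rtrancl_Image_eq_iff[OF symF] by blast
    then have "(i, j) \<in> E\<^sup>*" using rtrancl_insert_edge[OF _ assms(2)] i(2) j(2) s unfolding F_def
      by (smt (verit) rtrancl_trans)
    then show "C = D" using i j rtrancl_Image_eq[OF assms(2)] by simp
  qed
  have "card ?C - 1 \<le> card (?C - {E\<^sup>* `` {y}})"
    using diff_card_le_card_Diff[of "{E\<^sup>* `` {y}}" ?C] by simp
  also have "\<dots> = card ((\<lambda>C. F\<^sup>* `` C) ` (?C - {E\<^sup>* `` {y}}))" using inj by (simp add: card_image)
  also have "\<dots> \<le> card ((\<lambda>i. F\<^sup>* `` {i}) ` V)"
    by (rule card_mono) (use assms(1) rtrancl_Image_absorb[OF EF] in auto)
  finally show ?thesis by (simp add: ncomp_def F_def)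
qed

lemma ncomp_union_edges:
  assumes "finite V" "sym E" "finite D"
  shows "ncomp V E \<le> ncomp V (E \<union> D \<union> D\<inverse>) + card D"
  using assms(3)
proof (induction D rule: finite_induct)
  case (insert d D)
  obtain x y where d: "d = (x, y)" by force
  have "sym (E \<union> D \<union> D\<inverse>)" using assms(2) by (auto simp: sym_def)
  then have "ncomp V (E \<union> D \<union> D\<inverse>) \<le> Suc (ncomp V ((E \<union> D \<union> D\<inverse>) \<union> {(x, y), (y, x)}))"
    by (rule ncomp_insert_edge[OF assms(1)])
  moreover have "(E \<union> D \<union> D\<inverse>) \<union> {(x, y), (y, x)} = E \<union> insert d D \<union> (insert d D)\<inverse>" by (auto simp: d)
  ultimately show ?case using insert by simp
qed simp

text \<open>Adding just the edge between \<open>i\<close> and \<open>j\<close> to \<open>E\<close>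
  costs at most one component. In that graph \<open>j'\<close>, \<open>j\<close>, \<open>i\<close>,
  \<open>i'\<close> is a path, so the other new edge is already spanned. Hence exchanging two edges
  costs one component and not two.\<close>

lemma ncomp_swap:
  fixes i i' j j' :: 'a
  assumes "finite V" "sym E" "sym F"
    and "E \<subseteq> F \<union> {(i, i'), (i', i), (j', j), (j, j')}"
    and "F \<subseteq> E \<union> {(i, j), (j, i), (j', i'), (i', j')}"
    and "(i, i') \<in> E" "(j', j) \<in> E"
  shows "ncomp V E \<le> Suc (ncomp V F)"
proof -
  define G where "G = E \<union> {(i, j), (j, i)}"
  have "(j', j) \<in> G" "(j, i) \<in> G" "(i, i') \<in> G" "(j, j') \<in> G" "(i, j) \<in> G" "(i', i) \<in> G"
    using assms(2,6,7) by (auto simp: G_def sym_def)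
  then have "(j', i') \<in> G O G O G" "(i', j') \<in> G O G O G" by blast+
  moreover have "G O G O G \<subseteq> G\<^sup>*" by (auto intro: rtrancl_into_rtrancl)
  ultimately have "(j', i') \<in> G\<^sup>*" "(i', j') \<in> G\<^sup>*" by blast+
  then have "F \<subseteq> G\<^sup>*" using assms(5) by (auto simp: G_def)
  then have "ncomp V G \<le> ncomp V F" by (rule ncomp_mono[OF assms(1)])
  then show ?thesis using ncomp_insert_edge[OF assms(1,2), of i j] by (simp add: G_def)
qed

text \<open>Every class of \<open>E\<close> arises by enlarging a class of \<open>F\<close>, and the
  class of \<open>p\<close> can be spared, since that of \<open>q\<close> enlarges to the same
  set.\<close>

lemma ncomp_less:
  assumes "finite V" "sym E" "sym F" "F \<subseteq> E\<^sup>*"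
    and "p \<in> V" "q \<in> V" "(p, q) \<in> E\<^sup>*" "(p, q) \<notin> F\<^sup>*"
  shows "ncomp V E < ncomp V F"
proof -
  have abs: "E\<^sup>* `` (F\<^sup>* `` {i}) = E\<^sup>* `` {i}" for i by (rule rtrancl_Image_absorb[OF assms(4)])
  let ?C = "(\<lambda>i. F\<^sup>* `` {i}) ` V"
  have "(\<lambda>i. E\<^sup>* `` {i}) ` V \<subseteq> (\<lambda>C. E\<^sup>* `` C) ` (?C - {F\<^sup>* `` {p}})"
  proof
    fix X assume "X \<in> (\<lambda>i. E\<^sup>* `` {i}) ` V"
    then obtain i where i: "i \<in> V" "X = E\<^sup>* `` {i}" by auto
    show "X \<in> (\<lambda>C. E\<^sup>* `` C) ` (?C - {F\<^sup>* `` {p}})"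
    proof (cases "(i, p) \<in> F\<^sup>*")
      case True
      then have "(i, p) \<in> E\<^sup>*" using rtrancl_mono[OF assms(4)] by auto
      then have "(i, q) \<in> E\<^sup>*" using assms(7) by (rule rtrancl_trans)
      then have "X = E\<^sup>* `` (F\<^sup>* `` {q})" using i abs rtrancl_Image_eq[OF assms(2)] by auto
      moreover have "F\<^sup>* `` {q} \<in> ?C - {F\<^sup>* `` {p}}"
        using assms(6,8) rtrancl_Image_eq_iff[OF assms(3)] by blast
      ultimately show ?thesis by blast
    next
      case False
      then have "F\<^sup>* `` {i} \<in> ?C - {F\<^sup>* `` {p}}" using i(1) rtrancl_Image_eq_iff[OF assms(3)] by blast
      moreover have "X = E\<^sup>* `` (F\<^sup>* `` {i})" using i abs by simp
      ultimately show ?thesis by blast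
    qed
  qed
  then have "ncomp V E \<le> card ((\<lambda>C. E\<^sup>* `` C) ` (?C - {F\<^sup>* `` {p}}))"
    unfolding ncomp_def by (intro card_mono) (use assms(1) in auto)
  also have "\<dots> \<le> card (?C - {F\<^sup>* `` {p}})" by (rule card_image_le) (use assms(1) in auto)
  also have "\<dots> < card ?C" by (rule psubset_card_mono) (use assms(1,5) in auto)
  finally show ?thesis by (simp add: ncomp_def)
qed

text \<open>A component of size \<open>c\<close> contributes \<open>c\<close> terms equal to
  \<open>1 / c\<close>; closedness of \<open>V\<close> ensures that all its points are among the
  summands.\<close>

lemma sum_inverse_card_component:
  assumes "finite V" "sym E" "E `` V \<subseteq> V"
  shows "(\<Sum>i\<in>V. 1 / real (card (E\<^sup>* `` {i}))) = real (ncomp V E)"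
proof -
  let ?c = "\<lambda>i. E\<^sup>* `` {i}"
  have sub: "?c i \<subseteq> V" if "i \<in> V" for i
    using that Image_closed_trancl[OF assms(3)] Image_mono[of "E\<^sup>*" "E\<^sup>*" "{i}" V] by simp
  have fib: "{x \<in> V. ?c x = ?c i} = ?c i" if "i \<in> V" for i
  proof (intro set_eqI iffI)
    fix x assume "x \<in> ?c i"
    then show "x \<in> {x \<in> V. ?c x = ?c i}"
      using sub[OF that] rtrancl_Image_eq[OF assms(2), of i x] by auto
  qed blast
  have "(\<Sum>i\<in>V. 1 / real (card (?c i))) =
      (\<Sum>C\<in>?c ` V. \<Sum>i\<in>{x \<in> V. ?c x = C}. 1 / real (card (?c i)))" by (rule sum.image_gen[OF assms(1)])
  also have "\<dots> = (\<Sum>C\<in>?c ` V. 1)"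
  proof (rule sum.cong)
    fix C assume "C \<in> ?c ` V"
    then obtain i where i: "i \<in> V" "C = ?c i" by auto
    have "finite C" using sub[OF i(1)] assms(1) i(2) finite_subset by auto
    then have "card C > 0" using i(2) by (auto simp: card_gt_0_iff)
    have "(\<Sum>x\<in>{x \<in> V. ?c x = C}. 1 / real (card (?c x))) = (\<Sum>x\<in>{x \<in> V. ?c x = C}. 1 / real (card C))"
      by (rule sum.cong) auto
    also have "\<dots> = 1" using fib[OF i(1)] i(2) \<open>card C > 0\<close> by simp
    finally show "(\<Sum>x\<in>{x \<in> V. ?c x = C}. 1 / real (card (?c x))) = 1" .
  qed simp
  finally show ?thesis by (simp add: ncomp_def)
qed

section \<open>Balls of bounded radius in a graph\<close>

definition steps_ball :: "('a \<times> 'a) set \<Rightarrow> nat \<Rightarrow> 'a \<Rightarrow> 'a set" where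
  "steps_ball E m i = {j. \<exists>t\<le>m. (i, j) \<in> E ^^ t}"

lemma steps_ball_subset: "steps_ball E m i \<subseteq> E\<^sup>* `` {i}"
  by (auto simp: steps_ball_def relpow_imp_rtrancl)

lemma steps_ball_Suc: "steps_ball E (Suc m) i = steps_ball E m i \<union> E `` steps_ball E m i"
proof -
  have "(i, j) \<in> E ^^ t \<Longrightarrow> t \<le> Suc m \<Longrightarrow> j \<in> steps_ball E m i \<union> E `` steps_ball E m i" for j t
    by (cases t) (auto simp: steps_ball_def)
  moreover have "(i, k) \<in> E ^^ t \<Longrightarrow> t \<le> m \<Longrightarrow> (k, j) \<in> E \<Longrightarrow> j \<in> steps_ball E (Suc m) i" for j k t
    unfolding steps_ball_def by (auto intro!: exI[of _ "Suc t"])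
  ultimately show ?thesis by (auto simp: steps_ball_def intro: le_SucI)
qed

lemma steps_ball_0: "steps_ball E 0 i = {i}"
  by (auto simp: steps_ball_def)

lemma start_in_steps_ball: "i \<in> steps_ball E m i"
  unfolding steps_ball_def by (auto intro!: exI[of _ 0])

text \<open>A ball that stops growing is closed under edges and thus the whole component; until then
  each increase of the radius adds at least one point.\<close>

lemma component_eq_steps_ball_or_card:
  assumes "\<And>m. finite (steps_ball E m i)"
  shows "E\<^sup>* `` {i} = steps_ball E m i \<or> card (steps_ball E m i) \<ge> Suc m"
proof (induction m)
  case 0
  then show ?case by (simp add: steps_ball_0)
next
  case (Suc m)
  show ?case
  proof (cases "steps_ball E (Suc m) i = steps_ball E m i")
    case True
    then have "E `` steps_ball E m i \<subseteq> steps_ball E m i" by (auto simp: steps_ball_Suc)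
    then have "E\<^sup>* `` steps_ball E m i = steps_ball E m i" by (rule Image_closed_trancl)
    then have "E\<^sup>* `` {i} \<subseteq> steps_ball E m i"
      using start_in_steps_ball[of i E m] Image_mono[of "E\<^sup>*" "E\<^sup>*" "{i}" "steps_ball E m i"] by simp
    then have "E\<^sup>* `` {i} = steps_ball E (Suc m) i" unfolding True by (intro antisym steps_ball_subset)
    then show ?thesis ..
  next
    case False
    then have "steps_ball E m i \<subset> steps_ball E (Suc m) i" by (auto simp: steps_ball_Suc)
    then have "card (steps_ball E m i) < card (steps_ball E (Suc m) i)"
      by (rule psubset_card_mono[OF assms])
    moreover have "card (steps_ball E m i) \<ge> Suc m"
      using Suc steps_ball_subset[of E "Suc m" i] \<open>steps_ball E m i \<subset> _\<close> by force
    ultimately show ?thesis by simp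
  qed
qed

subsection \<open>Cyclic successors in blocks\<close>

text \<open>Strict betweenness on the circle; for \<open>i = j\<close> it holds of every \<open>k \<noteq> i\<close>, so that a singleton
  block is its own cyclic successor.\<close>

definition btw :: "nat \<Rightarrow> nat \<Rightarrow> nat \<Rightarrow> bool" where
  "btw i k j \<longleftrightarrow> (if i < j then i < k \<and> k < j else i < k \<or> k < j)"

definition cyc_succ :: "nat set \<Rightarrow> nat \<Rightarrow> nat \<Rightarrow> bool" where
  "cyc_succ V i j \<longleftrightarrow> i \<in> V \<and> j \<in> V \<and> (\<forall>k\<in>V. \<not> btw i k j)"

lemma cyc_succ_exists:
  assumes "finite V" "i \<in> V"
  shows "\<exists>j. cyc_succ V i j"
proof (cases "\<exists>k\<in>V. i < k")
  case True
  let ?W = "{k \<in> V. i < k}"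
  have "finite ?W" "?W \<noteq> {}" using assms True by auto
  then obtain m where "m \<in> ?W" "\<forall>k\<in>?W. m \<le> k" using Min_in Min_le by metis
  then have "cyc_succ V i m" using assms(2) by (auto simp: cyc_succ_def btw_def)
  then show ?thesis ..
next
  case False
  obtain m where "m \<in> V" "\<forall>k\<in>V. m \<le> k" using assms Min_in Min_le by (metis empty_iff)
  then have "cyc_succ V i m" using assms(2) False by (fastforce simp: cyc_succ_def btw_def not_less)
  then show ?thesis ..
qed

lemma cyc_pred_exists:
  assumes "finite V" "j \<in> V"
  shows "\<exists>i. cyc_succ V i j"
proof (cases "\<exists>k\<in>V. k < j")
  case True
  let ?W = "{k \<in> V. k < j}"
  have "finite ?W" "?W \<noteq> {}" using assms True by auto
  then obtain m where "m \<in> ?W" "\<forall>k\<in>?W. k \<le> m" using Max_in Max_ge by metis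
  then have "cyc_succ V m j" using assms(2) by (fastforce simp: cyc_succ_def btw_def)
  then show ?thesis ..
next
  case False
  obtain m where "m \<in> V" "\<forall>k\<in>V. k \<le> m" using assms Max_in Max_ge by (metis empty_iff)
  then have "cyc_succ V m j" using assms(2) False by (fastforce simp: cyc_succ_def btw_def not_less)
  then show ?thesis ..
qed

lemma cyc_succ_unique: "cyc_succ V i j \<Longrightarrow> cyc_succ V i j' \<Longrightarrow> j = j'"
proof -
  assume "cyc_succ V i j" "cyc_succ V i j'"
  then have "\<not> btw i j' j" "\<not> btw i j j'" by (auto simp: cyc_succ_def)
  then show "j = j'" by (auto simp: btw_def split: if_splits)
qed

lemma cyc_pred_unique: "cyc_succ V i j \<Longrightarrow> cyc_succ V i' j \<Longrightarrow> i = i'"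
proof -
  assume "cyc_succ V i j" "cyc_succ V i' j"
  then have "\<not> btw i i' j" "\<not> btw i' i j" by (auto simp: cyc_succ_def)
  then show "i = i'" by (auto simp: btw_def split: if_splits)
qed

text \<open>Non-crossing as a rule of inference: enclosure by two points of \<open>W\<close> passes
  from one point of \<open>V\<close> to all the others. This avoids going through the possible
  orders of four crossing points each time.\<close>

definition same_gap :: "nat set \<Rightarrow> nat set \<Rightarrow> bool" where
  "same_gap V W \<longleftrightarrow> (\<forall>b\<in>W. \<forall>d\<in>W. \<forall>a\<in>V. \<forall>c\<in>V. b < a \<and> a < d \<longrightarrow> b < c \<and> c < d)"

lemma same_gapD: "same_gap V W \<Longrightarrow> b \<in> W \<Longrightarrow> d \<in> W \<Longrightarrow> a \<in> V \<Longrightarrow> c \<in> V \<Longrightarrow> b < a \<Longrightarrow> a < d \<Longrightarrow> b < c \<and> c < d"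
  unfolding same_gap_def by blast

lemma noncrossing_same_gap:
  assumes "disjoint P"
  shows "noncrossing P \<longleftrightarrow> (\<forall>V\<in>P. \<forall>W\<in>P. V \<noteq> W \<longrightarrow> same_gap V W)"
proof (intro iffI ballI impI)
  fix V W assume nc: "noncrossing P" and VW: "V \<in> P" "W \<in> P" "V \<noteq> W"
  have dis: "V \<inter> W = {}" using assms VW by (auto simp: disjoint_def)
  show "same_gap V W" unfolding same_gap_def
  proof (intro ballI impI)
    fix b d a c assume *: "b \<in> W" "d \<in> W" "a \<in> V" "c \<in> V" "b < a \<and> a < d"
    have no: "\<not> (X \<in> P \<and> Y \<in> P \<and> X \<noteq> Y \<and> x < y \<and> y < x' \<and> x' < y' \<and> x \<in> X \<and> x' \<in> X \<and> y \<in> Y \<and> y' \<in> Y)"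
      for X Y x y x' y' using nc unfolding noncrossing_def by blast
    have "\<not> (c < b)" "\<not> (d < c)" using no[of V W c b a d] no[of W V b a d c] VW * by auto
    moreover have "c \<noteq> b" "c \<noteq> d" using * dis by auto
    ultimately show "b < c \<and> c < d" by auto
  qed
next
  assume *: "\<forall>V\<in>P. \<forall>W\<in>P. V \<noteq> W \<longrightarrow> same_gap V W"
  have False if "V \<in> P" "W \<in> P" "V \<noteq> W" "a < b" "b < c" "c < d" "a \<in> V" "c \<in> V" "b \<in> W" "d \<in> W"
    for V W a b c d using same_gapD[of V W b d c a] that * by auto
  then show "noncrossing P" unfolding noncrossing_def by blast
qed

text \<open>The chord joining \<open>a\<close> and \<open>c\<close> separates \<open>b\<close> from
  \<open>d\<close> on the circle, so on the line exactly one of \<open>b\<close> and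
  \<open>d\<close> lies between \<open>a\<close> and \<open>c\<close>, whichever of these two is
  smaller.\<close>

lemma cyc_crossing:
  assumes "same_gap V W" "same_gap W V" "a \<in> V" "c \<in> V" "b \<in> W" "d \<in> W" "a \<noteq> c" "btw a b c" "btw c d a"
  shows False
proof -
  consider "a < c" "a < b" "b < c" "c < d \<or> d < a"
    | "c < a" "c < d" "d < a" "a < b \<or> b < c" using assms(7-9) by (auto simp: btw_def split: if_splits)
  then show False
  proof cases
    case 1
    then show False using same_gapD[OF assms(2,3,4,5,6)] by auto
  next
    case 2
    then show False using same_gapD[OF assms(2,4,3,6,5)] by auto
  qed
qed

text \<open>All of \<open>B2\<close> sits in the gap of \<open>B1\<close> between \<open>i\<close>
  and \<open>i'\<close>. The merged cycle follows \<open>B1\<close> up to \<open>i\<close>, runs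
  once through \<open>B2\<close> from \<open>j\<close> to \<open>j'\<close> and resumes at
  \<open>i'\<close>, so only two arcs are exchanged and all others survive.\<close>

lemma cyc_succ_merge:
  assumes disj: "B1 \<inter> B2 = {}" and gap: "same_gap B1 B2" "same_gap B2 B1"
    and i: "i \<in> B1" and j: "j \<in> B2" and ij: "cyc_succ (B1 \<union> B2) i j"
    and i': "cyc_succ B1 i i'" and j': "cyc_succ B2 j' j"
  shows "cyc_succ (B1 \<union> B2) j' i'"
    and "\<And>k l. cyc_succ B1 k l \<Longrightarrow> k \<noteq> i \<Longrightarrow> cyc_succ (B1 \<union> B2) k l"
    and "\<And>k l. cyc_succ B2 k l \<Longrightarrow> k \<noteq> j' \<Longrightarrow> cyc_succ (B1 \<union> B2) k l"
proof -
  have mem: "i' \<in> B1" "j' \<in> B2" and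
    n1: "\<And>k. k \<in> B1 \<Longrightarrow> \<not> btw i k i'" and n2: "\<And>k. k \<in> B2 \<Longrightarrow> \<not> btw j' k j"
    and n: "\<And>k. k \<in> B1 \<or> k \<in> B2 \<Longrightarrow> \<not> btw i k j"
    using i' j' ij by (auto simp: cyc_succ_def)
  have ne: "a \<noteq> b" if "a \<in> B1" "b \<in> B2" for a b using that disj by auto
  have ji: "btw i j i'"
    using n[of i'] mem ne[OF i j] ne[OF mem(1) j] by (auto simp: btw_def split: if_splits)
  \<comment> \<open>A point of \<open>B2\<close> outside the gap would, together with
    \<open>j\<close> inside it, cross the chord from \<open>i\<close> to \<open>i'\<close>.\<close>
  have B2: "btw i b i'" if "b \<in> B2" for b
  proof (rule ccontr)
    assume "\<not> btw i b i'"
    then have "btw i' b i" "i \<noteq> i'"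
      using ne[OF i that] ne[OF mem(1) that] by (auto simp: btw_def split: if_splits)
    then show False using cyc_crossing[OF gap i mem(1) j that _ ji] by auto
  qed
  show "cyc_succ (B1 \<union> B2) j' i'" unfolding cyc_succ_def
  proof (intro conjI ballI)
    fix k assume "k \<in> B1 \<union> B2"
    then show "\<not> btw j' k i'"
    proof
      assume k: "k \<in> B1"
      show ?thesis using n1[OF k] B2[OF mem(2)] ne[OF k mem(2)] ne[OF i mem(2)] ne[OF mem(1,2)]
        by (auto simp: btw_def split: if_splits)
    next
      assume k: "k \<in> B2"
      show ?thesis
        using n[of k] k n[of j'] mem n2[OF k] B2[OF mem(2)] B2[OF k] ji ne[OF i j] ne[OF i k] ne[OF i mem(2)]
          ne[OF mem(1) j] ne[OF mem(1) k] ne[OF mem(1,2)] by (auto simp: btw_def split: if_splits)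
    qed
  qed (use mem in auto)
  show "cyc_succ (B1 \<union> B2) k l" if kl: "cyc_succ B1 k l" and "k \<noteq> i" for k l unfolding cyc_succ_def
  proof (intro conjI ballI)
    have m: "k \<in> B1" "l \<in> B1" using kl by (auto simp: cyc_succ_def)
    show "k \<in> B1 \<union> B2" "l \<in> B1 \<union> B2" using m by auto
    fix b assume "b \<in> B1 \<union> B2"
    then show "\<not> btw k b l"
    proof
      assume "b \<in> B1" then show ?thesis using kl by (auto simp: cyc_succ_def)
    next
      assume b: "b \<in> B2"
      have "\<not> btw i k i'" "\<not> btw i l i'" using n1 m by auto
      moreover have "\<not> btw k i l" "\<not> btw k i' l" using kl i mem by (auto simp: cyc_succ_def)
      moreover have "btw i b i'" using B2 b by auto
      ultimately show ?thesis
        using \<open>k \<noteq> i\<close> ne[OF m(1) b] ne[OF m(2) b] by (auto simp: btw_def split: if_splits)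
    qed
  qed
  show "cyc_succ (B1 \<union> B2) k l" if kl: "cyc_succ B2 k l" and "k \<noteq> j'" for k l unfolding cyc_succ_def
  proof (intro conjI ballI)
    have m: "k \<in> B2" "l \<in> B2" using kl by (auto simp: cyc_succ_def)
    show "k \<in> B1 \<union> B2" "l \<in> B1 \<union> B2" using m by auto
    fix b assume "b \<in> B1 \<union> B2"
    then show "\<not> btw k b l"
    proof
      assume "b \<in> B2" then show ?thesis using kl by (auto simp: cyc_succ_def)
    next
      assume b: "b \<in> B1"
      have "btw i k j'"
        using n2[OF m(1)] n[of k] n[of j'] m(1) mem(2) \<open>k \<noteq> j'\<close> ne[OF i m(1)] ne[OF i j] ne[OF i mem(2)]
        by (auto simp: btw_def split: if_splits)
      moreover have "\<not> btw k j' l" using kl mem by (auto simp: cyc_succ_def)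
      ultimately have "btw i k l"
        using ne[OF i m(1)] ne[OF i m(2)] ne[OF i mem(2)] by (auto simp: btw_def split: if_splits)
      then have "btw i b l" if "btw k b l"
        using that ne[OF i m(1)] ne[OF i m(2)] by (auto simp: btw_def split: if_splits)
      then have "btw i b i'" if "btw k b l"
        using that B2[OF m(2)] ne[OF mem(1) m(2)] ne[OF i m(2)] by (auto simp: btw_def split: if_splits)
      then show ?thesis using n1[OF b] by auto
    qed
  qed
qed

lemma cyc_succ_merge_iff:
  assumes "finite B1" "finite B2" "B1 \<inter> B2 = {}" "same_gap B1 B2" "same_gap B2 B1"
    and "i \<in> B1" "j \<in> B2" "cyc_succ (B1 \<union> B2) i j" "cyc_succ B1 i i'" "cyc_succ B2 j' j"
  shows "cyc_succ (B1 \<union> B2) k l \<longleftrightarrow>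
    (k, l) = (i, j) \<or> (k, l) = (j', i') \<or> (cyc_succ B1 k l \<and> k \<noteq> i) \<or> (cyc_succ B2 k l \<and> k \<noteq> j')"
proof
  note m = cyc_succ_merge[OF assms(3-10)]
  assume kl: "cyc_succ (B1 \<union> B2) k l"
  then have "k \<in> B1 \<or> k \<in> B2" by (auto simp: cyc_succ_def)
  then obtain l' where "cyc_succ B1 k l' \<or> cyc_succ B2 k l'" using cyc_succ_exists assms(1,2) by metis
  then show "(k, l) = (i, j) \<or> (k, l) = (j', i') \<or> (cyc_succ B1 k l \<and> k \<noteq> i) \<or> (cyc_succ B2 k l \<and> k \<noteq> j')"
    using m cyc_succ_unique[OF kl] assms(8) by metis
next
  show "(k, l) = (i, j) \<or> (k, l) = (j', i') \<or> (cyc_succ B1 k l \<and> k \<noteq> i) \<or> (cyc_succ B2 k l \<and> k \<noteq> j')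
    \<Longrightarrow> cyc_succ (B1 \<union> B2) k l" using cyc_succ_merge[OF assms(3-10)] assms(8) by blast
qed

definition nxt :: "nat set set \<Rightarrow> (nat \<times> nat) set" where
  "nxt P = {(i, j). \<exists>V\<in>P. cyc_succ V i j}"

subsection \<open>Merging blocks of non-crossing partitions\<close>

lemma NC_blockD:
  assumes "P \<in> NC n" "V \<in> P"
  shows "finite V" "V \<subseteq> {1..n}" "V \<noteq> {}"
proof -
  show "V \<subseteq> {1..n}" "V \<noteq> {}" using assms by (auto simp: NC_def partition_on_def)
  then show "finite V" using finite_subset by blast
qed

lemma NC_disjoint: "P \<in> NC n \<Longrightarrow> disjoint P"
  by (auto simp: NC_def partition_on_def)

lemma NC_block_unique: "P \<in> NC n \<Longrightarrow> V \<in> P \<Longrightarrow> W \<in> P \<Longrightarrow> i \<in> V \<Longrightarrow> i \<in> W \<Longrightarrow> V = W"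
  using NC_disjoint[of P n] by (auto simp: disjoint_def)

lemma NC_block_exists: "P \<in> NC n \<Longrightarrow> i \<in> {1..n} \<Longrightarrow> \<exists>V\<in>P. i \<in> V"
  unfolding NC_def partition_on_def by blast

lemma NC_same_gap: "P \<in> NC n \<Longrightarrow> V \<in> P \<Longrightarrow> W \<in> P \<Longrightarrow> V \<noteq> W \<Longrightarrow> same_gap V W"
  using noncrossing_same_gap[OF NC_disjoint[of P n]] by (auto simp: NC_def)

lemma NC_I:
  assumes "partition_on {1..n} P" "\<And>V W. V \<in> P \<Longrightarrow> W \<in> P \<Longrightarrow> V \<noteq> W \<Longrightarrow> same_gap V W"
  shows "P \<in> NC n"
  using assms noncrossing_same_gap[of P] by (auto simp: NC_def partition_on_def)

lemma same_gap_sym: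
  assumes "same_gap V W" "V \<inter> W = {}"
  shows "same_gap W V"
  unfolding same_gap_def
proof (intro ballI impI)
  fix b d a c assume *: "b \<in> V" "d \<in> V" "a \<in> W" "c \<in> W" "b < a \<and> a < d"
  then have "c \<noteq> b" "c \<noteq> d" using assms(2) by auto
  moreover have "\<not> c < b" using same_gapD[OF assms(1), of c a b d] * by auto
  moreover have "\<not> d < c" using same_gapD[OF assms(1), of a c d b] * by auto
  ultimately show "b < c \<and> c < d" by auto
qed

lemma nxt_block: "P \<in> NC n \<Longrightarrow> (i, j) \<in> nxt P \<Longrightarrow> V \<in> P \<Longrightarrow> i \<in> V \<or> j \<in> V \<Longrightarrow> cyc_succ V i j"
  unfolding nxt_def cyc_succ_def using NC_block_unique by blast

lemma nxt_range: "P \<in> NC n \<Longrightarrow> (i, j) \<in> nxt P \<Longrightarrow> i \<in> {1..n} \<and> j \<in> {1..n}"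
  unfolding nxt_def cyc_succ_def using NC_blockD(2) by blast

lemma nxt_unique: "P \<in> NC n \<Longrightarrow> (i, j) \<in> nxt P \<Longrightarrow> (i, j') \<in> nxt P \<Longrightarrow> j = j'"
proof -
  assume P: "P \<in> NC n" and *: "(i, j) \<in> nxt P" "(i, j') \<in> nxt P"
  obtain V where "V \<in> P" "i \<in> V" using * by (auto simp: nxt_def cyc_succ_def)
  then show "j = j'" using nxt_block[OF P] * cyc_succ_unique by blast
qed

lemma nxt_pred_unique: "P \<in> NC n \<Longrightarrow> (i, j) \<in> nxt P \<Longrightarrow> (i', j) \<in> nxt P \<Longrightarrow> i = i'"
proof -
  assume P: "P \<in> NC n" and *: "(i, j) \<in> nxt P" "(i', j) \<in> nxt P"
  obtain V where "V \<in> P" "j \<in> V" using * by (auto simp: nxt_def cyc_succ_def)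
  then show "i = i'" using nxt_block[OF P] * cyc_pred_unique by blast
qed

lemma nxt_total:
  assumes "P \<in> NC n" "i \<in> {1..n}"
  shows "\<exists>j. (i, j) \<in> nxt P" "\<exists>j. (j, i) \<in> nxt P"
proof -
  obtain V where V: "V \<in> P" "i \<in> V" using NC_block_exists[OF assms] by blast
  then have "finite V" using NC_blockD(1)[OF assms(1)] by auto
  then show "\<exists>j. (i, j) \<in> nxt P" "\<exists>j. (j, i) \<in> nxt P"
    using cyc_succ_exists[of V i] cyc_pred_exists[of V i] V by (auto simp: nxt_def)
qed

text \<open>Going around the cycle from a point of \<open>U\<close>, the first point outside
  \<open>U\<close> would have its predecessor in \<open>U\<close>.\<close>

lemma cyc_succ_closed_imp_subset:
  assumes "finite V" "U \<inter> V \<noteq> {}" "\<And>k l. k \<in> U \<Longrightarrow> cyc_succ V k l \<Longrightarrow> l \<in> U"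
  shows "V \<subseteq> U"
proof (rule ccontr)
  assume "\<not> V \<subseteq> U"
  then obtain x where x: "x \<in> V" "x \<notin> U" by auto
  obtain u where u: "u \<in> U" "u \<in> V" using assms(2) by auto
  \<comment> \<open>The distance travelled upwards from \<open>u\<close>. The summand
    \<open>Suc (Max V)\<close> makes every point reached after wrapping around farther than all
    points reached before.\<close>
  define d where "d y = (if u \<le> y then y - u else y + Suc (Max V) - u)" for y
  have le: "y \<le> Max V" if "y \<in> V" for y using that assms(1) by auto
  define B where "B = {y \<in> V. y \<notin> U}"
  have "finite B" "B \<noteq> {}" using x assms(1) by (auto simp: B_def)
  define m where "m = arg_min_on d B"
  have m: "m \<in> B" "\<And>y. y \<in> B \<Longrightarrow> d m \<le> d y"
    using arg_min_if_finite[OF \<open>finite B\<close> \<open>B \<noteq> {}\<close>, of d] unfolding m_def by (auto simp: not_less)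
  have mV: "m \<in> V" "m \<notin> U" using m by (auto simp: B_def)
  obtain k where k: "cyc_succ V k m" using cyc_pred_exists[OF assms(1) mV(1)] by auto
  have kV: "k \<in> V" "\<not> btw k u m" using k u by (auto simp: cyc_succ_def)
  have "k \<notin> U" using assms(3)[OF _ k] mV by auto
  then have "d m \<le> d k" "k \<noteq> u" using m kV u by (auto simp: B_def)
  then have "k \<noteq> m \<Longrightarrow> False" using kV(2) le[OF kV(1)] le[OF mV(1)] le[OF u(2)] mV u \<open>k \<noteq> u\<close>
    by (auto simp: d_def btw_def split: if_splits)
  moreover have "u \<noteq> m" using mV u by auto
  then have "k = m \<Longrightarrow> btw k u m" by (auto simp: btw_def)
  ultimately show False using kV(2) by auto
qed

text \<open>The blocks are the orbits of the successor map, and inclusion between two maps defined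
  on all of \<open>{1..n}\<close> is already equality. Used in the contrapositive: distinct
  partitions yield an arc of the first that the second lacks.\<close>

lemma NC_eqI:
  assumes "P \<in> NC n" "Q \<in> NC n" "nxt P \<subseteq> nxt Q"
  shows "P = Q"
proof -
  have sub: "P \<subseteq> Q" if P: "P \<in> NC n" and Q: "Q \<in> NC n" and *: "nxt P = nxt Q" for P Q
  proof
    fix V assume V: "V \<in> P"
    then obtain i where i: "i \<in> V" "i \<in> {1..n}" using NC_blockD[OF P] by blast
    then obtain W where W: "W \<in> Q" "i \<in> W" using NC_block_exists[OF Q] by blast
    have "V \<subseteq> W"
    proof (rule cyc_succ_closed_imp_subset)
      fix k l assume "k \<in> W" "cyc_succ V k l"
      then have "(k, l) \<in> nxt P" using V by (auto simp: nxt_def)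
      then have "(k, l) \<in> nxt Q" using * by simp
      then show "l \<in> W" using nxt_block[OF Q _ W(1)] \<open>k \<in> W\<close> by (auto simp: cyc_succ_def)
    qed (use NC_blockD[OF P V] i W in auto)
    moreover have "W \<subseteq> V"
    proof (rule cyc_succ_closed_imp_subset)
      fix k l assume "k \<in> V" "cyc_succ W k l"
      then have "(k, l) \<in> nxt Q" using W by (auto simp: nxt_def)
      then have "(k, l) \<in> nxt P" using * by simp
      then show "l \<in> V" using nxt_block[OF P _ V(1)] \<open>k \<in> V\<close> by (auto simp: cyc_succ_def)
    qed (use NC_blockD[OF Q W(1)] i W in auto)
    ultimately show "V \<in> Q" using W by auto
  qed
  have "nxt Q \<subseteq> nxt P"
  proof safe
    fix i j assume ij: "(i, j) \<in> nxt Q"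
    then obtain j' where "(i, j') \<in> nxt P" using nxt_range[OF assms(2)] nxt_total[OF assms(1)] by blast
    then show "(i, j) \<in> nxt P" using assms(3) nxt_unique[OF assms(2) ij] by auto
  qed
  then show ?thesis using sub assms by (metis subset_antisym)
qed

definition merge_blocks :: "'a set set \<Rightarrow> 'a set \<Rightarrow> 'a set \<Rightarrow> 'a set set" where
  "merge_blocks P B1 B2 = insert (B1 \<union> B2) (P - {B1, B2})"

lemma partition_on_merge:
  assumes "partition_on A P" "B1 \<in> P" "B2 \<in> P"
  shows "partition_on A (merge_blocks P B1 B2)"
proof (rule partition_onI)
  show "\<Union> (merge_blocks P B1 B2) = A" using assms by (auto simp: partition_on_def merge_blocks_def)
  show "{} \<notin> merge_blocks P B1 B2" using assms by (auto simp: partition_on_def merge_blocks_def)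
  have d: "X = Y" if "X \<in> P" "Y \<in> P" "x \<in> X" "x \<in> Y" for X Y x
    using that assms(1) by (auto simp: partition_on_def disjoint_def)
  fix p q assume "p \<in> merge_blocks P B1 B2" "q \<in> merge_blocks P B1 B2" "p \<noteq> q"
  then show "disjnt p q" using d assms(2,3) unfolding merge_blocks_def disjnt_iff by blast
qed

lemma nxt_merge:
  assumes P: "P \<in> NC n" and B: "B1 \<in> P" "B2 \<in> P" "B1 \<noteq> B2"
    and ij: "i \<in> B1" "j \<in> B2" "cyc_succ (B1 \<union> B2) i j" "cyc_succ B1 i i'" "cyc_succ B2 j' j"
  shows "nxt (merge_blocks P B1 B2) = (nxt P - {(i, i'), (j', j)}) \<union> {(i, j), (j', i')}"
proof -
  have fin: "finite B1" "finite B2" using NC_blockD[OF P] B by auto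
  have dis: "B1 \<inter> B2 = {}" using NC_disjoint[OF P] B by (auto simp: disjoint_def)
  note gap = NC_same_gap[OF P B(1,2,3)] NC_same_gap[OF P B(2,1) B(3)[symmetric]]
  note iff = cyc_succ_merge_iff[OF fin dis gap ij]
  have 1: "cyc_succ B1 k l \<and> k \<noteq> i \<longleftrightarrow> cyc_succ B1 k l \<and> (k, l) \<noteq> (i, i')" for k l
    using cyc_succ_unique ij(4) by blast
  have 2: "cyc_succ B2 k l \<and> k \<noteq> j' \<longleftrightarrow> cyc_succ B2 k l \<and> (k, l) \<noteq> (j', j)" for k l
    using cyc_succ_unique ij(5) by blast
  have o: "(\<exists>V\<in>P - {B1, B2}. cyc_succ V k l) \<Longrightarrow> (k, l) \<noteq> (i, i') \<and> (k, l) \<noteq> (j', j)" for k l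
    using NC_block_unique[OF P] ij B unfolding cyc_succ_def by blast
  have d12: "cyc_succ B1 k l \<Longrightarrow> (k, l) \<noteq> (j', j)" "cyc_succ B2 k l \<Longrightarrow> (k, l) \<noteq> (i, i')" for k l
    using dis ij unfolding cyc_succ_def by blast+
  have "(k, l) \<in> nxt (merge_blocks P B1 B2) \<longleftrightarrow> (k, l) \<in> (nxt P - {(i, i'), (j', j)}) \<union> {(i, j), (j', i')}" for k l
  proof -
    have "(k, l) \<in> nxt (merge_blocks P B1 B2) \<longleftrightarrow> cyc_succ (B1 \<union> B2) k l \<or> (\<exists>V\<in>P - {B1, B2}. cyc_succ V k l)"
      by (auto simp: nxt_def merge_blocks_def)
    also have "\<dots> \<longleftrightarrow> (k, l) = (i, j) \<or> (k, l) = (j', i') \<or> (cyc_succ B1 k l \<and> (k, l) \<noteq> (i, i')) \<or>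
        (cyc_succ B2 k l \<and> (k, l) \<noteq> (j', j)) \<or> (\<exists>V\<in>P - {B1, B2}. cyc_succ V k l)"
      unfolding iff 1 2 by blast
    also have "\<dots> \<longleftrightarrow> (k, l) = (i, j) \<or> (k, l) = (j', i') \<or>
       ((cyc_succ B1 k l \<or> cyc_succ B2 k l \<or> (\<exists>V\<in>P - {B1, B2}. cyc_succ V k l)) \<and> (k, l) \<noteq> (i, i') \<and> (k, l) \<noteq> (j', j))"
      using o[of k l] d12[of k l] by blast
    also have "(cyc_succ B1 k l \<or> cyc_succ B2 k l \<or> (\<exists>V\<in>P - {B1, B2}. cyc_succ V k l)) \<longleftrightarrow> (k, l) \<in> nxt P"
      unfolding nxt_def using B by blast
    finally show ?thesis by blast
  qed
  then show ?thesis by (intro set_eqI) (simp only: split_paired_all)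
qed

text \<open>Two points of another block that avoids the interval enclose both of \<open>i\<close>
  and \<open>j\<close> or neither, so enclosure passes from \<open>B1\<close> to \<open>B2\<close>
  through these two points. Between two points of a block inside the interval there is nothing of
  \<open>B1\<close> or \<open>B2\<close>.\<close>

lemma merge_in_NC:
  assumes P: "P \<in> NC n" and B: "B1 \<in> P" "B2 \<in> P" "B1 \<noteq> B2"
    and ij: "i \<in> B1" "j \<in> B2" "i < j"
    and no: "\<And>k. k \<in> B1 \<union> B2 \<Longrightarrow> \<not> (i < k \<and> k < j)"
    and W: "\<And>W. W \<in> P \<Longrightarrow> W \<noteq> B1 \<Longrightarrow> W \<noteq> B2 \<Longrightarrow> W \<inter> {i<..<j} = {} \<or> W \<subseteq> {i<..<j}"
  shows "merge_blocks P B1 B2 \<in> NC n"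
proof (rule NC_I)
  show "partition_on {1..n} (merge_blocks P B1 B2)"
    using P B by (intro partition_on_merge) (auto simp: NC_def)
  have key: "same_gap (B1 \<union> B2) X" if X: "X \<in> P" "X \<noteq> B1" "X \<noteq> B2" for X unfolding same_gap_def
  proof (intro ballI impI)
    fix b d a c
    assume bd: "b \<in> X" "d \<in> X" and a: "a \<in> B1 \<union> B2" and c: "c \<in> B1 \<union> B2" and ord: "b < a \<and> a < d"
    have ne: "b \<noteq> i" "b \<noteq> j" "d \<noteq> i" "d \<noteq> j" using NC_block_unique[OF P] X B ij bd by blast+
    have "X \<inter> {i<..<j} = {}"
    proof (rule ccontr)
      assume "X \<inter> {i<..<j} \<noteq> {}"
      then have "X \<subseteq> {i<..<j}" using W[OF X] by blast
      then have "b \<in> {i<..<j}" "d \<in> {i<..<j}" using bd by blast+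
      then have "i < a \<and> a < j" using ord by auto
      then show False using no[OF a] by blast
    qed
    then have bo: "b < i \<or> j < b" "d < i \<or> j < d" using bd ne by fastforce+
    have 1: "b < y \<and> y < d" if "x \<in> B1" "y \<in> B1" "b < x \<and> x < d" for x y
      using same_gapD[OF NC_same_gap[OF P B(1) X(1) X(2)[symmetric]] bd] that by blast
    have 2: "b < y \<and> y < d" if "x \<in> B2" "y \<in> B2" "b < x \<and> x < d" for x y
      using same_gapD[OF NC_same_gap[OF P B(2) X(1) X(3)[symmetric]] bd] that by blast
    have "b < i \<and> i < d \<longleftrightarrow> b < j \<and> j < d" using bo ij(3) by auto
    moreover have "(b < i \<and> i < d) \<or> (b < j \<and> j < d)" using a 1[of a i] 2[of a j] ord ij by blast
    ultimately show "b < c \<and> c < d" using c 1[of i c] 2[of j c] ij by blast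
  qed
  fix V Y assume *: "V \<in> merge_blocks P B1 B2" "Y \<in> merge_blocks P B1 B2" "V \<noteq> Y"
  have dj: "X \<inter> (B1 \<union> B2) = {}" if "X \<in> P" "X \<noteq> B1" "X \<noteq> B2" for X
    using that NC_block_unique[OF P] B by blast
  consider "V \<in> P" "Y \<in> P" | "V = B1 \<union> B2" "Y \<in> P" "Y \<noteq> B1" "Y \<noteq> B2" | "Y = B1 \<union> B2" "V \<in> P" "V \<noteq> B1" "V \<noteq> B2"
    using * by (auto simp: merge_blocks_def)
  then show "same_gap V Y"
  proof cases
    case 1 then show ?thesis using NC_same_gap[OF P] * by blast
  next
    case 2 then show ?thesis using key by blast
  next
    case 3 then show ?thesis using same_gap_sym[OF key] dj by blast
  qed
qed

lemma refines_merge: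
  assumes "P \<in> NC n" "merge_blocks P B1 B2 \<in> NC n" "B1 \<in> P" "B2 \<in> P"
  shows "refines {1..n} P (merge_blocks P B1 B2)"
  using assms unfolding refines_def NC_def merge_blocks_def by blast

lemma merge_neq:
  assumes "P \<in> NC n" "B1 \<in> P" "B2 \<in> P" "B1 \<noteq> B2"
  shows "merge_blocks P B1 B2 \<noteq> P"
proof
  assume "merge_blocks P B1 B2 = P"
  then have "B1 \<union> B2 \<in> P" by (auto simp: merge_blocks_def)
  moreover obtain x y where "x \<in> B1" "y \<in> B2" using NC_blockD(3)[OF assms(1)] assms by blast
  ultimately show False using NC_block_unique[OF assms(1)] assms by blast
qed

text \<open>A partition in between must keep all blocks other than \<open>B1\<close> and
  \<open>B2\<close>, and its blocks containing these two lie inside \<open>B1 \<union> B2\<close>.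
  They either coincide, which gives the merge, or are disjoint, which gives
  \<open>P\<close>.\<close>

lemma merge_covers:
  assumes P: "P \<in> NC n" and B: "B1 \<in> P" "B2 \<in> P" "B1 \<noteq> B2" and Q: "merge_blocks P B1 B2 \<in> NC n"
  shows "NC_covers n (merge_blocks P B1 B2) P"
proof -
  have False if T: "T \<in> NC n" "NC_less n P T" "NC_less n T (merge_blocks P B1 B2)" for T
  proof -
    have PT: "refines {1..n} P T" and TQ: "refines {1..n} T (merge_blocks P B1 B2)"
      and ne: "P \<noteq> T" "T \<noteq> merge_blocks P B1 B2"
      using T by (auto simp: NC_less_def)
    have up: "\<exists>Y\<in>T. X \<subseteq> Y" if "X \<in> P" for X using PT that by (auto simp: refines_def)
    have up2: "\<exists>Y\<in>merge_blocks P B1 B2. X \<subseteq> Y" if "X \<in> T" for X using TQ that by (auto simp: refines_def)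
    have neP: "X \<noteq> {}" if "X \<in> P" for X using NC_blockD(3)[OF P that] .
    have big: "Y \<subseteq> Z" if "Y \<in> T" "X \<subseteq> Y" "X \<noteq> {}" "X \<subseteq> Z" "Z \<in> merge_blocks P B1 B2" for X Y Z
      using up2[OF that(1)] NC_block_unique[OF Q _ that(5)] that by blast
    have other: "X \<in> T" if X: "X \<in> P" "X \<noteq> B1" "X \<noteq> B2" for X
    proof -
      obtain Y where Y: "Y \<in> T" "X \<subseteq> Y" using up[OF X(1)] by blast
      have "Y \<subseteq> X" using big[OF Y neP[OF X(1)], of X] X by (auto simp: merge_blocks_def)
      then show ?thesis using Y by auto
    qed
    obtain Y1 where Y1: "Y1 \<in> T" "B1 \<subseteq> Y1" using up[OF B(1)] by blast
    obtain Y2 where Y2: "Y2 \<in> T" "B2 \<subseteq> Y2" using up[OF B(2)] by blast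
    have sub: "Y1 \<subseteq> B1 \<union> B2" "Y2 \<subseteq> B1 \<union> B2"
      using big[OF Y1 neP[OF B(1)], of "B1 \<union> B2"] big[OF Y2 neP[OF B(2)], of "B1 \<union> B2"]
      by (auto simp: merge_blocks_def)
    have eqI: "S = T" if ST: "S \<subseteq> T" "S \<in> NC n" for S
    proof
      show "T \<subseteq> S"
      proof
        fix X assume X: "X \<in> T"
        then obtain x where x: "x \<in> X" "x \<in> {1..n}" using NC_blockD[OF T(1)] by blast
        then obtain Y where "Y \<in> S" "x \<in> Y" using NC_block_exists[OF ST(2)] by blast
        then show "X \<in> S" using NC_block_unique[OF T(1) X _ x(1), of Y] ST(1) by auto
      qed
    qed (rule ST(1))
    show False
    proof (cases "Y1 = Y2")
      case True
      then have "Y1 = B1 \<union> B2" using sub Y1 Y2 by blast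
      then have "merge_blocks P B1 B2 \<subseteq> T" using other Y1 by (auto simp: merge_blocks_def)
      then show False using eqI[OF _ Q] ne by auto
    next
      case False
      then have "Y1 \<inter> Y2 = {}" using NC_block_unique[OF T(1)] Y1 Y2 by blast
      then have "Y1 = B1" "Y2 = B2" using sub Y1 Y2 by blast+
      then have "P \<subseteq> T" using other Y1 Y2 by blast
      then show False using eqI[OF _ P] ne by auto
    qed
  qed
  then show ?thesis unfolding NC_covers_def NC_less_def
    using P Q refines_merge[OF P Q B(1,2)] merge_neq[OF P B] by (auto simp: NC_less_def)
qed

text \<open>It suffices to find one merge of two blocks of \<open>P\<close> that is non-crossing and
  still refines \<open>Q\<close>, since a cover leaves no room in between. The adjacent points
  \<open>i\<close> and \<open>j\<close> are recorded because they determine the exchange of arcs in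
  \<open>nxt_merge\<close>.\<close>

lemma cover_is_merge:
  assumes "NC_covers n Q P"
  obtains B1 B2 i j where "B1 \<in> P" "B2 \<in> P" "B1 \<noteq> B2" "i \<in> B1" "j \<in> B2"
    "cyc_succ (B1 \<union> B2) i j" "Q = merge_blocks P B1 B2"
proof -
  have P: "P \<in> NC n" and Q: "Q \<in> NC n" and ref: "refines {1..n} P Q" and "P \<noteq> Q"
    and no: "\<And>T. T \<in> NC n \<Longrightarrow> NC_less n P T \<Longrightarrow> \<not> NC_less n T Q"
    using assms by (auto simp: NC_covers_def NC_less_def)
  have up: "\<exists>Y\<in>Q. X \<subseteq> Y" if "X \<in> P" for X using ref that by (auto simp: refines_def)
  have upS: "X \<subseteq> Y" if "X \<in> P" "Y \<in> Q" "x \<in> X" "x \<in> Y" for X Y x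
    using up[OF that(1)] NC_block_unique[OF Q _ that(2)] that by blast
  have "\<exists>V\<in>Q. V \<notin> P"
  proof (rule ccontr)
    assume "\<not> ?thesis"
    then have "refines {1..n} Q P" using P Q by (auto simp: refines_def NC_def)
    then show False using refines_asym[OF ref] \<open>P \<noteq> Q\<close> by auto
  qed
  then obtain V where V: "V \<in> Q" "V \<notin> P" by blast
  note VQ = NC_blockD[OF Q V(1)]
  define m where "m = Min V"
  have m: "m \<in> V" "\<And>k. k \<in> V \<Longrightarrow> m \<le> k" using VQ by (auto simp: m_def)
  obtain B0 where B0: "B0 \<in> P" "m \<in> B0" using NC_block_exists[OF P] m VQ by blast
  have "B0 \<subseteq> V" using upS B0 V m by blast
  moreover have "B0 \<noteq> V" using B0 V by auto
  ultimately obtain y where y: "y \<in> V" "y \<notin> B0" by auto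
  \<comment> \<open>The first point of \<open>V\<close> outside the block of \<open>Min V\<close>;
    its predecessor \<open>i\<close> in \<open>V\<close> then belongs to that block. As
    \<open>V\<close> has no points between \<open>i\<close> and \<open>j\<close>, merging their
    blocks creates no crossing.\<close>
  define j where "j = (LEAST y. y \<in> V \<and> y \<notin> B0)"
  have "j \<in> V \<and> j \<notin> B0" unfolding j_def by (rule LeastI[of _ y]) (use y in auto)
  then have j: "j \<in> V" "j \<notin> B0" by auto
  have jle: "k \<in> B0" if "k \<in> V" "k < j" for k
    using not_less_Least[of k "\<lambda>y. y \<in> V \<and> y \<notin> B0"] that by (simp add: j_def)
  have "m < j" using m j B0 by (metis le_neq_implies_less)
  define i where "i = Max {k \<in> V. k < j}"
  have fin: "finite {k \<in> V. k < j}" "{k \<in> V. k < j} \<noteq> {}" using VQ m \<open>m < j\<close> by auto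
  have i: "i \<in> V" "i < j" using Max_in[OF fin] by (auto simp: i_def)
  have imax: "k \<le> i" if "k \<in> V" "k < j" for k using Max_ge[OF fin(1)] that by (auto simp: i_def)
  have iB: "i \<in> B0" using jle i by auto
  obtain B2 where B2: "B2 \<in> P" "j \<in> B2" using NC_block_exists[OF P] j VQ by blast
  have "B2 \<subseteq> V" using upS B2 V j by blast
  have ne: "B0 \<noteq> B2" using j B2 by auto
  have gap: "\<not> (i < k \<and> k < j)" if "k \<in> V" for k using imax that by fastforce
  have cyc: "cyc_succ (B0 \<union> B2) i j"
    using iB B2 gap \<open>B0 \<subseteq> V\<close> \<open>B2 \<subseteq> V\<close> i by (auto simp: cyc_succ_def btw_def)
  have "merge_blocks P B0 B2 \<in> NC n"
  proof (rule merge_in_NC[OF P B0(1) B2(1) ne iB B2(2) i(2)])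
    show "\<not> (i < k \<and> k < j)" if "k \<in> B0 \<union> B2" for k using that gap \<open>B0 \<subseteq> V\<close> \<open>B2 \<subseteq> V\<close> by blast
    fix W assume W: "W \<in> P" "W \<noteq> B0" "W \<noteq> B2"
    show "W \<inter> {i<..<j} = {} \<or> W \<subseteq> {i<..<j}"
    proof (cases "W \<subseteq> V")
      case True
      then have "W \<inter> {i<..<j} = {}" using gap by force
      then show ?thesis ..
    next
      case False
      obtain W' where W': "W' \<in> Q" "W \<subseteq> W'" using up[OF W(1)] by blast
      then have "W' \<noteq> V" using False by auto
      then have g: "same_gap W' V" using NC_same_gap[OF Q W'(1) V(1)] by auto
      show ?thesis
      proof (rule disjCI)
        assume "\<not> W \<subseteq> {i<..<j}"
        then obtain x where x: "x \<in> W" "\<not> (i < x \<and> x < j)"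
          unfolding subset_iff greaterThanLessThan_iff by blast
        have "\<not> (i < k \<and> k < j)" if "k \<in> W" for k
          using same_gapD[OF g i(1) j(1), of k x] subsetD[OF W'(2)] that x by blast
        then show "W \<inter> {i<..<j} = {}" by force
      qed
    qed
  qed
  moreover have "NC_less n P (merge_blocks P B0 B2)"
    using refines_merge[OF P _ B0(1) B2(1)] merge_neq[OF P B0(1) B2(1) ne] calculation by (auto simp: NC_less_def)
  ultimately have "\<not> NC_less n (merge_blocks P B0 B2) Q" using no by blast
  moreover have "refines {1..n} (merge_blocks P B0 B2) Q"
    using \<open>merge_blocks P B0 B2 \<in> NC n\<close> Q up \<open>B0 \<subseteq> V\<close> \<open>B2 \<subseteq> V\<close> V(1) unfolding refines_def NC_def merge_blocks_def by blast
  ultimately have "Q = merge_blocks P B0 B2" by (auto simp: NC_less_def)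
  then show thesis using that[OF B0(1) B2(1) ne iB B2(2) cyc] by blast
qed

subsection \<open>Distance in the Hasse diagram\<close>

lemma relcomp3_subset_rtrancl: "E O E O E \<subseteq> E\<^sup>*"
  by (auto intro: rtrancl_into_rtrancl)

lemma nxt_up_block_inside:
  assumes P: "P \<in> NC n" and ij: "(i, j) \<in> nxt P" "i < j" and k: "i < k" "k < j" and W: "W \<in> P" "k \<in> W"
  shows "W \<subseteq> {i<..<j}"
proof
  obtain V where V: "V \<in> P" "cyc_succ V i j" using ij by (auto simp: nxt_def)
  then have "k \<notin> V" using k by (auto simp: cyc_succ_def btw_def)
  then have g: "same_gap W V" using NC_same_gap[OF P W(1) V(1)] W by auto
  fix x assume "x \<in> W"
  then show "x \<in> {i<..<j}" using same_gapD[OF g, of i j k x] W k V(2) by (auto simp: cyc_succ_def)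
qed

text \<open>An arc with \<open>j \<le> i\<close> closes the cycle of its block, so \<open>j\<close>
  and \<open>i\<close> are the least and the greatest element of that block. In contrast to an
  upward arc, the block itself is enclosed as well.\<close>

lemma nxt_down_block_inside:
  assumes P: "P \<in> NC n" and ij: "(i, j) \<in> nxt P" "j \<le> i" and k: "j \<le> k" "k \<le> i" and W: "W \<in> P" "k \<in> W"
  shows "W \<subseteq> {j..i}"
proof
  obtain V where V: "V \<in> P" "cyc_succ V i j" using ij by (auto simp: nxt_def)
  fix x assume x: "x \<in> W"
  show "x \<in> {j..i}"
  proof (cases "W = V")
    case True
    then have "\<not> btw i x j" using V x by (auto simp: cyc_succ_def)
    then show ?thesis using ij(2) by (auto simp: btw_def split: if_splits)
  next
    case False
    have "i \<in> V" "j \<in> V" using V by (auto simp: cyc_succ_def)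
    then have "k \<noteq> i" "k \<noteq> j" using NC_block_unique[OF P V(1) W(1)] W False by auto
    then show ?thesis
      using same_gapD[OF NC_same_gap[OF P W(1) V(1) False], of j i k x] W k x \<open>i \<in> V\<close> \<open>j \<in> V\<close> by auto
  qed
qed

text \<open>The two sides of the element \<open>i\<close> are the points \<open>2i - 1\<close> and \<open>2i\<close>; each pair of successive
  elements of a block contributes the arc from the right side of the first to the left side of the second.\<close>

definition NC_arcs :: "nat set set \<Rightarrow> (int \<times> int) set" where
  "NC_arcs P = (\<lambda>(i, j). (2 * int i, 2 * int j - 1)) ` nxt P \<union> (\<lambda>(i, j). (2 * int j - 1, 2 * int i)) ` nxt P"

lemma NC_arcs_simps:
  "(2 * int i, 2 * int j - 1) \<in> NC_arcs P \<longleftrightarrow> (i, j) \<in> nxt P"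
  "(2 * int j - 1, 2 * int i) \<in> NC_arcs P \<longleftrightarrow> (i, j) \<in> nxt P"
proof -
  have "2 * int a \<noteq> 2 * int b - 1" "2 * int b - 1 \<noteq> 2 * int a" for a b by presburger+
  then show "(2 * int i, 2 * int j - 1) \<in> NC_arcs P \<longleftrightarrow> (i, j) \<in> nxt P"
    "(2 * int j - 1, 2 * int i) \<in> NC_arcs P \<longleftrightarrow> (i, j) \<in> nxt P" by (auto simp: NC_arcs_def)
qed

lemma NC_arcsE:
  assumes "(p, q) \<in> NC_arcs P"
  obtains i j where "(i, j) \<in> nxt P" "p = 2 * int i" "q = 2 * int j - 1"
    | i j where "(i, j) \<in> nxt P" "q = 2 * int i" "p = 2 * int j - 1"
  using assms by (auto simp: NC_arcs_def)

lemma sym_NC_arcs: "sym (NC_arcs P)"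
  by (auto simp: NC_arcs_def sym_def)

lemma NC_arcs_single_valued:
  assumes P: "P \<in> NC n" and "(p, q) \<in> NC_arcs P" "(p, q') \<in> NC_arcs P"
  shows "q = q'"
proof -
  have ne: "2 * int a \<noteq> 2 * int b - 1" for a b by presburger
  show ?thesis using assms(2,3)
  proof (elim NC_arcsE)
    fix i j i' j' assume "(i, j) \<in> nxt P" "p = 2 * int i" "q = 2 * int j - 1" "(i', j') \<in> nxt P" "p = 2 * int i'" "q' = 2 * int j' - 1"
    then show "q = q'" using nxt_unique[OF P] by auto
  next
    fix i j i' j' assume "(i, j) \<in> nxt P" "q = 2 * int i" "p = 2 * int j - 1" "(i', j') \<in> nxt P" "q' = 2 * int i'" "p = 2 * int j' - 1"
    then show "q = q'" using nxt_pred_unique[OF P] by auto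
  qed (use ne in \<open>metis+\<close>)
qed

section \<open>Components of two superposed matchings\<close>

definition ncc :: "nat \<Rightarrow> nat set set \<Rightarrow> nat set set \<Rightarrow> nat" where
  "ncc n P Q = ncomp {1..2 * int n} (NC_arcs P \<union> NC_arcs Q)"

lemma sym_two_arcs: "sym (NC_arcs P \<union> NC_arcs Q)"
  using sym_NC_arcs by (auto simp: sym_def)

lemma NC_arcs_subset:
  assumes "nxt P \<subseteq> nxt Q \<union> {(i, j), (k, l)}"
  shows "NC_arcs P \<subseteq> NC_arcs Q \<union> {(2 * int i, 2 * int j - 1), (2 * int j - 1, 2 * int i),
    (2 * int k, 2 * int l - 1), (2 * int l - 1, 2 * int k)}"
proof (rule subrelI)
  fix p q assume "(p, q) \<in> NC_arcs P"
  then show "(p, q) \<in> NC_arcs Q \<union> {(2 * int i, 2 * int j - 1), (2 * int j - 1, 2 * int i),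
    (2 * int k, 2 * int l - 1), (2 * int l - 1, 2 * int k)}"
  proof (cases rule: NC_arcsE)
    case (1 a b) then show ?thesis using subsetD[OF assms 1(1)] by (auto simp: NC_arcs_simps)
  next
    case (2 a b) then show ?thesis using subsetD[OF assms 2(1)] by (auto simp: NC_arcs_simps)
  qed
qed

lemma ncc_swap:
  assumes "nxt P \<subseteq> nxt Q \<union> {(i, i'), (j', j)}" "nxt Q \<subseteq> nxt P \<union> {(i, j), (j', i')}"
    "(i, i') \<in> nxt P" "(j', j) \<in> nxt P"
  shows "ncc n X P \<le> Suc (ncc n X Q)"
  unfolding ncc_def
proof (rule ncomp_swap[where i = "2 * int i" and j = "2 * int j - 1" and j' = "2 * int j'" and i' = "2 * int i' - 1"])
  show "(2 * int i, 2 * int i' - 1) \<in> NC_arcs X \<union> NC_arcs P" "(2 * int j', 2 * int j - 1) \<in> NC_arcs X \<union> NC_arcs P"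
    using assms(3,4) by (auto simp: NC_arcs_simps)
qed (use NC_arcs_subset[OF assms(1)] NC_arcs_subset[OF assms(2)] in \<open>auto intro: sym_two_arcs\<close>)

text \<open>A cover merges two blocks and thereby exchanges two arcs. Undoing the merge is an
  exchange of the same form, with \<open>i'\<close> and \<open>j\<close> trading places.\<close>

lemma ncc_cover:
  assumes "NC_covers n Q P"
  shows "ncc n X P \<le> Suc (ncc n X Q)" "ncc n X Q \<le> Suc (ncc n X P)"
proof -
  obtain B1 B2 i j where B: "B1 \<in> P" "B2 \<in> P" "B1 \<noteq> B2" and ij: "i \<in> B1" "j \<in> B2"
    "cyc_succ (B1 \<union> B2) i j" and Q: "Q = merge_blocks P B1 B2" using cover_is_merge[OF assms] by metis
  have P: "P \<in> NC n" using assms by (auto simp: NC_covers_def)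
  obtain i' where i': "cyc_succ B1 i i'" using cyc_succ_exists NC_blockD(1)[OF P B(1)] ij by blast
  obtain j' where j': "cyc_succ B2 j' j" using cyc_pred_exists NC_blockD(1)[OF P B(2)] ij by blast
  have eq: "nxt Q = (nxt P - {(i, i'), (j', j)}) \<union> {(i, j), (j', i')}"
    unfolding Q by (rule nxt_merge[OF P B ij i' j'])
  have mem: "(i, i') \<in> nxt P" "(j', j) \<in> nxt P" using B i' j' by (auto simp: nxt_def)
  show "ncc n X P \<le> Suc (ncc n X Q)"
    by (rule ncc_swap[where i = i and i' = i' and j = j and j' = j']) (use eq mem in auto)
  show "ncc n X Q \<le> Suc (ncc n X P)"
    by (rule ncc_swap[where i = i and i' = j and j = i' and j' = j']) (use eq mem in auto)
qed

text \<open>The arc common to \<open>\<rho>\<close> and \<open>Q\<close> becomes a double edge and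
  so splits off as a component, while with \<open>P\<close> the component of \<open>p\<close> also
  contains the end point of the arc to \<open>x\<close>. Nothing is fused in return: the possible
  second new arc of \<open>Q\<close>, from \<open>y\<close> to \<open>x\<close>, is bridged in the
  old graph by the path through \<open>q\<close> and \<open>p\<close>.\<close>

lemma ncc_less:
  assumes \<rho>: "\<rho> \<in> NC n" and Q: "Q \<in> NC n" and pq: "(p, q) \<in> nxt \<rho>" "(p, q) \<in> nxt Q"
    and P: "(p, x) \<in> nxt P" "(y, q) \<in> nxt P" "x \<noteq> q" "P \<in> NC n"
    and sub: "nxt Q \<subseteq> nxt P \<union> {(p, q), (y, x)}"
  shows "ncc n \<rho> P < ncc n \<rho> Q"
proof -
  let ?E = "NC_arcs \<rho> \<union> NC_arcs P" and ?F = "NC_arcs \<rho> \<union> NC_arcs Q"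
  have r: "p \<in> {1..n}" "q \<in> {1..n}" "x \<in> {1..n}" using nxt_range[OF \<rho> pq(1)] nxt_range[OF P(4,1)] by auto
  have "?F `` {2 * int p, 2 * int q - 1} \<subseteq> {2 * int p, 2 * int q - 1}"
    using NC_arcs_single_valued[OF \<rho>] NC_arcs_single_valued[OF Q] pq NC_arcs_simps by blast
  then have "?F\<^sup>* `` {2 * int p, 2 * int q - 1} = {2 * int p, 2 * int q - 1}"
    by (rule Image_closed_trancl)
  then have "(2 * int p, 2 * int x - 1) \<in> ?F\<^sup>* \<Longrightarrow> 2 * int x - 1 \<in> {2 * int p, 2 * int q - 1}" by blast
  moreover have "2 * int x - 1 \<notin> {2 * int p, 2 * int q - 1}" using P(3) by (simp; presburger)
  ultimately have notF: "(2 * int p, 2 * int x - 1) \<notin> ?F\<^sup>*" by blast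
  have E: "(2 * int p, 2 * int x - 1) \<in> ?E" "(2 * int y, 2 * int q - 1) \<in> ?E" "(2 * int p, 2 * int q - 1) \<in> ?E"
     "(2 * int x - 1, 2 * int p) \<in> ?E" "(2 * int q - 1, 2 * int y) \<in> ?E" "(2 * int q - 1, 2 * int p) \<in> ?E"
    using P pq by (auto simp: NC_arcs_simps)
  have "(2 * int y, 2 * int x - 1) \<in> ?E O ?E O ?E" "(2 * int x - 1, 2 * int y) \<in> ?E O ?E O ?E"
    using E by blast+
  moreover have "?E O ?E O ?E \<subseteq> ?E\<^sup>*" by (rule relcomp3_subset_rtrancl)
  ultimately have yx: "(2 * int y, 2 * int x - 1) \<in> ?E\<^sup>*" "(2 * int x - 1, 2 * int y) \<in> ?E\<^sup>*" by blast+
  have FE: "?F \<subseteq> ?E\<^sup>*" using NC_arcs_subset[OF sub] E yx by (auto intro: r_into_rtrancl)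
  show ?thesis unfolding ncc_def by (rule ncomp_less[where p = "2 * int p" and q = "2 * int x - 1"])
      (use FE notF E(1) r in \<open>auto intro: sym_two_arcs\<close>)
qed

text \<open>The block of \<open>\<rho>\<close> with least element \<open>j\<close> and greatest
  element \<open>i\<close> is traversed from \<open>j\<close> to \<open>i\<close> by upward arcs.
  All of these are arcs of \<open>\<pi>\<close>, so the block of \<open>\<pi>\<close> is never
  left.\<close>

lemma block_chain:
  assumes \<rho>: "\<rho> \<in> NC n" and \<pi>: "\<pi> \<in> NC n" and ij: "(i, j) \<in> nxt \<rho>" "j \<le> i"
    and min: "\<And>k l. (k, l) \<in> nxt \<rho> \<Longrightarrow> j \<le> k \<Longrightarrow> k < l \<Longrightarrow> l \<le> i \<Longrightarrow> (k, l) \<in> nxt \<pi>"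
    and B: "B \<in> \<pi>" "j \<in> B"
  shows "i \<in> B"
proof -
  obtain V where V: "V \<in> \<rho>" "cyc_succ V i j" using ij by (auto simp: nxt_def)
  have iV: "i \<in> V" "j \<in> V" using V by (auto simp: cyc_succ_def)
  have Vij: "V \<subseteq> {j..i}" by (rule nxt_down_block_inside[OF \<rho> ij _ _ V(1) iV(1)]) (use ij in auto)
  have "v \<in> V \<Longrightarrow> v \<in> B" for v
  proof (induction v rule: less_induct)
    case (less v)
    show ?case
    proof (cases "v = j")
      case False
      obtain u where u: "cyc_succ V u v" using cyc_pred_exists[OF _ less.prems] NC_blockD(1)[OF \<rho> V(1)] by blast
      have uV: "u \<in> V" "\<not> btw u j v" using u iV by (auto simp: cyc_succ_def)
      have "j < v" using False less.prems Vij by (auto simp: order_less_le)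
      then have "u < v" using uV by (auto simp: btw_def split: if_splits)
      then have "u \<in> B" using less.IH uV by blast
      have "(u, v) \<in> nxt \<pi>"
        by (rule min) (use u V(1) uV(1) less.prems Vij \<open>u < v\<close> in \<open>auto simp: nxt_def\<close>)
      then show ?thesis using nxt_block[OF \<pi> _ B(1)] \<open>u \<in> B\<close> by (auto simp: cyc_succ_def)
    qed (use B in simp)
  qed
  then show ?thesis using iV by blast
qed

text \<open>The step towards \<open>\<rho>\<close>: take a shortest arc of \<open>\<rho>\<close> that is not an arc of \<open>\<pi>\<close>. By minimality everything
  enclosed by it is already joined as in \<open>\<rho>\<close>, so exchanging the two arcs of \<open>\<pi>\<close> at its end points keeps \<open>\<pi>\<close>
  non-crossing. If \<open>i < j\<close> this merges two blocks of \<open>\<pi>\<close>, otherwise it splits one; in both cases the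
  new arc becomes a component of its own.\<close>

lemma closer_neighbour:
  assumes \<rho>: "\<rho> \<in> NC n" and \<pi>: "\<pi> \<in> NC n" and "\<rho> \<noteq> \<pi>"
  shows "\<exists>Q\<in>NC n. (\<pi>, Q) \<in> hasse n \<and> ncc n \<rho> \<pi> < ncc n \<rho> Q"
proof -
  \<comment> \<open>Measured between the sides \<open>2i\<close> and \<open>2j - 1\<close>, so that
    an arc nested in another is strictly shorter, whichever directions the two have.\<close>
  let ?len = "\<lambda>e. nat \<bar>2 * int (fst e) - (2 * int (snd e) - 1)\<bar>"
  define D where "D = nxt \<rho> - nxt \<pi>"
  have "D \<noteq> {}" using NC_eqI[OF \<rho> \<pi>] assms(3) by (auto simp: D_def)
  then obtain e where e: "e \<in> D" "\<And>e'. e' \<in> D \<Longrightarrow> ?len e \<le> ?len e'"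
    using ex_has_least_nat[of "\<lambda>e. e \<in> D" _ ?len] by blast
  obtain i j where eij: "e = (i, j)" by force
  have ij: "(i, j) \<in> nxt \<rho>" "(i, j) \<notin> nxt \<pi>" using e(1) by (auto simp: D_def eij)
  have short: "(k, l) \<in> nxt \<pi>" if "(k, l) \<in> nxt \<rho>" "?len (k, l) < ?len (i, j)" for k l
    using e(2)[of "(k, l)"] that by (force simp: D_def eij)
  have r: "i \<in> {1..n}" "j \<in> {1..n}" using nxt_range[OF \<rho> ij(1)] by auto
  show ?thesis
  proof (cases "i < j")
    case True
    have closed: "l \<in> {i<..<j}" if k: "k \<in> {i<..<j}" and kl: "(k, l) \<in> nxt \<pi>" for k l
    proof -
      obtain W where W: "W \<in> \<rho>" "k \<in> W" using NC_block_exists[OF \<rho>, of k] k r by auto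
      obtain l' where l': "(k, l') \<in> nxt \<rho>" using nxt_total(1)[OF \<rho>, of k] k r by auto
      have "W \<subseteq> {i<..<j}" by (rule nxt_up_block_inside[OF \<rho> ij(1) True _ _ W]) (use k in auto)
      then have l'm: "l' \<in> {i<..<j}" using nxt_block[OF \<rho> l' W(1)] W(2) by (auto simp: cyc_succ_def)
      then have "(k, l') \<in> nxt \<pi>" using short[OF l'] k by auto
      then show ?thesis using l'm nxt_unique[OF \<pi> kl] by auto
    qed
    have inside: "W \<subseteq> {i<..<j}" if "W \<in> \<pi>" "W \<inter> {i<..<j} \<noteq> {}" for W
    proof (rule cyc_succ_closed_imp_subset)
      show "finite W" using NC_blockD[OF \<pi> that(1)] by auto
      show "{i<..<j} \<inter> W \<noteq> {}" using that by auto
      show "l \<in> {i<..<j}" if "k \<in> {i<..<j}" "cyc_succ W k l" for k l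
      proof -
        have "(k, l) \<in> nxt \<pi>" using that(2) \<open>W \<in> \<pi>\<close> unfolding nxt_def by blast
        then show ?thesis by (rule closed[OF that(1)])
      qed
    qed
    obtain B1 where B1: "B1 \<in> \<pi>" "i \<in> B1" using NC_block_exists[OF \<pi> r(1)] by blast
    obtain B2 where B2: "B2 \<in> \<pi>" "j \<in> B2" using NC_block_exists[OF \<pi> r(2)] by blast
    have n1: "B1 \<inter> {i<..<j} = {}" using inside[OF B1(1)] B1(2) by fastforce
    have n2: "B2 \<inter> {i<..<j} = {}" using inside[OF B2(1)] B2(2) by fastforce
    have no: "\<not> (i < k \<and> k < j)" if "k \<in> B1 \<union> B2" for k using that n1 n2 by auto
    have ne: "B1 \<noteq> B2"
    proof
      assume "B1 = B2"
      then have "cyc_succ B1 i j" using B1 B2 no True by (auto simp: cyc_succ_def btw_def)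
      then show False using ij(2) B1 by (auto simp: nxt_def)
    qed
    have cyc: "cyc_succ (B1 \<union> B2) i j" using B1 B2 no True by (auto simp: cyc_succ_def btw_def)
    obtain i' where i': "cyc_succ B1 i i'" using cyc_succ_exists NC_blockD(1)[OF \<pi> B1(1)] B1(2) by blast
    obtain j' where j': "cyc_succ B2 j' j" using cyc_pred_exists NC_blockD(1)[OF \<pi> B2(1)] B2(2) by blast
    have "W \<inter> {i<..<j} = {} \<or> W \<subseteq> {i<..<j}" if "W \<in> \<pi>" for W using inside[OF that] by blast
    then have Q: "merge_blocks \<pi> B1 B2 \<in> NC n"
      using merge_in_NC[OF \<pi> B1(1) B2(1) ne B1(2) B2(2) True no] by simp
    note eq = nxt_merge[OF \<pi> B1(1) B2(1) ne B1(2) B2(2) cyc i' j']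
    have "(i, i') \<in> nxt \<pi>" "(j', j) \<in> nxt \<pi>" using i' j' B1 B2 by (auto simp: nxt_def)
    then have "ncc n \<rho> \<pi> < ncc n \<rho> (merge_blocks \<pi> B1 B2)"
      using ij(2) eq by (intro ncc_less[OF \<rho> Q ij(1), of i' \<pi> j']) (auto simp: \<pi>)
    moreover have "(\<pi>, merge_blocks \<pi> B1 B2) \<in> hasse n"
      using merge_covers[OF \<pi> B1(1) B2(1) ne Q] by (auto simp: hasse_def)
    ultimately show ?thesis using Q by blast
  next
    case False
    then have ji: "j \<le> i" by simp
    obtain B where B: "B \<in> \<pi>" "j \<in> B" using NC_block_exists[OF \<pi> r(2)] by blast
    have iB: "i \<in> B" by (rule block_chain[OF \<rho> \<pi> ij(1) ji _ B]) (use short in auto)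
    define B1 where "B1 = B \<inter> {j..i}"
    define B2 where "B2 = B - {j..i}"
    have B12: "B = B1 \<union> B2" "B1 \<inter> B2 = {}" "i \<in> B1" "j \<in> B1" using B iB ji by (auto simp: B1_def B2_def)
    have c1: "cyc_succ B1 i j" using B12(3,4) ji by (auto simp: cyc_succ_def btw_def B1_def)
    have "B2 \<noteq> {}"
    proof
      assume "B2 = {}"
      then have "cyc_succ B i j" using c1 B12 by simp
      then show False using ij(2) B by (auto simp: nxt_def)
    qed
    have fin: "finite B" using NC_blockD[OF \<pi> B(1)] by auto
    obtain x where x: "cyc_succ B i x" using cyc_succ_exists[OF fin iB] by blast
    \<comment> \<open>A successor of \<open>i\<close> inside \<open>{j..i}\<close> would be reached
      only by wrapping around; then \<open>i\<close> would be the greatest element of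
      \<open>B\<close>, the successor its least, and nothing of \<open>B\<close> would be left for
      \<open>B2\<close>.\<close>
    have xB: "x \<in> B2"
    proof (rule ccontr)
      assume "x \<notin> B2"
      then have "x \<in> B" "x \<le> i" "j \<le> x" using x by (auto simp: cyc_succ_def B2_def)
      then have "B \<subseteq> {j..i}" using x by (fastforce simp: cyc_succ_def btw_def not_less)
      then show False using \<open>B2 \<noteq> {}\<close> by (auto simp: B2_def)
    qed
    obtain y where y: "cyc_succ B2 y x" using cyc_pred_exists[OF _ xB] fin by (auto simp: B2_def)
    \<comment> \<open>Splitting is treated as the inverse of merging: \<open>\<pi>\<close> is the
      merge of two blocks of \<open>Q\<close>, so the results on merges apply with \<open>Q\<close>
      as the finer partition.\<close>
    define Q where "Q = insert B1 (insert B2 (\<pi> - {B}))"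
    have ne: "B1 \<noteq> B2" using B12 by auto
    have notin: "B1 \<notin> \<pi> - {B}" "B2 \<notin> \<pi> - {B}"
      using NC_block_unique[OF \<pi> B(1), of B1 i] NC_block_unique[OF \<pi> B(1), of B2 x] B12 xB by auto
    have merge_blocks: "merge_blocks Q B1 B2 = \<pi>"
      using notin B(1) by (auto simp: merge_blocks_def Q_def B12(1)[symmetric])
    have Q: "Q \<in> NC n"
    proof (rule NC_I)
      show "partition_on {1..n} Q"
      proof (rule partition_onI)
        show "\<Union> Q = {1..n}" using \<pi> B B12(1) by (auto simp: Q_def NC_def partition_on_def)
        show "{} \<notin> Q" using \<pi> B12 \<open>B2 \<noteq> {}\<close> by (auto simp: Q_def NC_def partition_on_def)
        fix p q assume *: "p \<in> Q" "q \<in> Q" "p \<noteq> q"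
        have d: "X \<inter> B1 = {} \<and> X \<inter> B2 = {}" if "X \<in> \<pi> - {B}" for X
          using that NC_block_unique[OF \<pi> B(1)] B12(1) by blast
        have d': "X \<inter> Y = {}" if "X \<in> \<pi> - {B}" "Y \<in> \<pi> - {B}" "X \<noteq> Y" for X Y
          using that NC_block_unique[OF \<pi>] by blast
        consider "p \<in> \<pi> - {B}" "q \<in> \<pi> - {B}" | "p \<in> \<pi> - {B}" "q = B1 \<or> q = B2"
          | "q \<in> \<pi> - {B}" "p = B1 \<or> p = B2" | "p = B1" "q = B2" | "p = B2" "q = B1"
          using * by (auto simp: Q_def)
        then show "disjnt p q"
        proof cases
          case 1 then show ?thesis using d'[OF 1 *(3)] by (simp add: disjnt_def)
        next
          case 2 then show ?thesis using d[OF 2(1)] by (auto simp: disjnt_def)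
        next
          case 3 then show ?thesis using d[OF 3(1)] by (auto simp: disjnt_def)
        qed (use B12(2) in \<open>auto simp: disjnt_def\<close>)
      qed
      have s1: "same_gap X Y" if "Y \<subseteq> B" "X \<in> \<pi> - {B}" for X Y
        using NC_same_gap[OF \<pi> _ B(1), of X] that unfolding same_gap_def by blast
      have s2: "same_gap Y X" if "Y \<subseteq> B" "X \<in> \<pi> - {B}" for X Y
        using NC_same_gap[OF \<pi> B(1), of X] that unfolding same_gap_def by blast
      have s3: "same_gap B2 B1" by (auto simp: same_gap_def B1_def B2_def)
      have s4: "same_gap B1 B2" using same_gap_sym[OF s3] B12 by blast
      fix V W assume *: "V \<in> Q" "W \<in> Q" "V \<noteq> W"
      have sub: "B1 \<subseteq> B" "B2 \<subseteq> B" using B12 by auto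
      consider "V \<in> \<pi> - {B}" "W \<in> \<pi> - {B}" | "V \<in> \<pi> - {B}" "W \<subseteq> B" | "V \<subseteq> B" "W \<in> \<pi> - {B}"
        | "V = B1" "W = B2" | "V = B2" "W = B1" using * sub by (auto simp: Q_def)
      then show "same_gap V W"
      proof cases
        case 1 then show ?thesis using NC_same_gap[OF \<pi>] *(3) by auto
      next
        case 2 then show ?thesis by (intro s1)
      next
        case 3 then show ?thesis by (intro s2)
      qed (use s3 s4 in auto)
    qed
    have BQ: "B1 \<in> Q" "B2 \<in> Q" by (auto simp: Q_def)
    have "cyc_succ (B1 \<union> B2) i x" using x B12(1) by simp
    from nxt_merge[OF Q BQ ne B12(3) xB this c1 y]
    have eq: "nxt \<pi> = (nxt Q - {(i, j), (y, x)}) \<union> {(i, x), (y, j)}" unfolding merge_blocks .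
    have m: "(i, j) \<in> nxt Q" using c1 BQ by (auto simp: nxt_def)
    have "x \<noteq> j" using xB B12 by auto
    then have "ncc n \<rho> \<pi> < ncc n \<rho> Q"
      using eq m by (intro ncc_less[OF \<rho> Q ij(1) m, of x \<pi> y]) (auto simp: \<pi>)
    moreover have "NC_covers n \<pi> Q" using merge_covers[OF Q BQ ne] merge_blocks \<pi> by simp
    then have "(\<pi>, Q) \<in> hasse n" by (auto simp: hasse_def)
    ultimately show ?thesis using Q by blast
  qed
qed

text \<open>Superposing a matching with itself leaves single arcs as components, each with one even
  end point.\<close>

lemma ncc_self: 
  assumes P: "P \<in> NC n"
  shows "n \<le> ncc n P P"
proof -
  let ?E = "NC_arcs P"
  have s: "k = i" if i: "i \<in> {1..n}" and "(2 * int i, 2 * int k) \<in> ?E\<^sup>*" for i k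
  proof -
    obtain j where j: "(i, j) \<in> nxt P" using nxt_total(1)[OF P i] by blast
    have "?E `` {2 * int i, 2 * int j - 1} \<subseteq> {2 * int i, 2 * int j - 1}"
      using NC_arcs_single_valued[OF P] j NC_arcs_simps by blast
    then have "?E\<^sup>* `` {2 * int i, 2 * int j - 1} = {2 * int i, 2 * int j - 1}"
      by (rule Image_closed_trancl)
    then have "2 * int k \<in> {2 * int i, 2 * int j - 1}" using that(2) by blast
    moreover have "2 * int k \<noteq> 2 * int j - 1" by presburger
    ultimately show ?thesis by auto
  qed
  have "inj_on (\<lambda>i. ?E\<^sup>* `` {2 * int i}) {1..n}"
    by (rule inj_onI) (use s rtrancl_Image_eq_iff[OF sym_NC_arcs[of P]] in metis)
  then have "n = card ((\<lambda>i. ?E\<^sup>* `` {2 * int i}) ` {1..n})" by (simp add: card_image)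
  also have "\<dots> \<le> card ((\<lambda>i. ?E\<^sup>* `` {i}) ` {1..2 * int n})" by (rule card_mono) auto
  finally show ?thesis by (simp add: ncc_def ncomp_def)
qed

text \<open>Every arc joins an odd point to an even one, so each component contains one of the
  \<open>n\<close> even points.\<close>

lemma ncc_le:
  assumes "P \<in> NC n"
  shows "ncc n P Q \<le> n"
proof -
  let ?E = "NC_arcs P \<union> NC_arcs Q"
  have "(\<lambda>i. ?E\<^sup>* `` {i}) ` {1..2 * int n} \<subseteq> (\<lambda>i. ?E\<^sup>* `` {2 * int i}) ` {1..n}"
  proof (rule image_subsetI)
    fix p assume p: "p \<in> {1..2 * int n}"
    show "?E\<^sup>* `` {p} \<in> (\<lambda>i. ?E\<^sup>* `` {2 * int i}) ` {1..n}"
    proof (cases "even p")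
      case True
      then obtain i where "p = 2 * int i" using p by (auto elim!: evenE intro!: that[of "nat (p div 2)"])
      then show ?thesis using p by auto
    next
      case False
      then obtain m where "p = 2 * m + 1" by (rule oddE)
      define j where "j = nat (m + 1)"
      have j: "p = 2 * int j - 1" "j \<in> {1..n}" using p \<open>p = 2 * m + 1\<close> by (auto simp: j_def)
      obtain i where i: "(i, j) \<in> nxt P" using nxt_total(2)[OF assms j(2)] by blast
      then have "(p, 2 * int i) \<in> ?E\<^sup>*" using j by (auto simp: NC_arcs_simps)
      then have "?E\<^sup>* `` {p} = ?E\<^sup>* `` {2 * int i}" by (rule rtrancl_Image_eq[OF sym_two_arcs])
      then show ?thesis using nxt_range[OF assms i] by blast
    qed
  qed
  then have "ncc n P Q \<le> card ((\<lambda>i. ?E\<^sup>* `` {2 * int i}) ` {1..n})"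
    unfolding ncc_def ncomp_def by (intro card_mono) auto
  also have "\<dots> \<le> card {1..n}" by (rule card_image_le) simp
  finally show ?thesis by simp
qed

lemma hasse_walk_lower:
  assumes "(\<rho>, \<pi>) \<in> hasse n ^^ k" "\<rho> \<in> NC n"
  shows "n \<le> ncc n \<rho> \<pi> + k"
  using assms(1)
proof (induction k arbitrary: \<pi>)
  case 0
  then show ?case using ncc_self[OF assms(2)] by auto
next
  case (Suc k)
  obtain \<theta> where \<theta>: "(\<rho>, \<theta>) \<in> hasse n ^^ k" "(\<theta>, \<pi>) \<in> hasse n"
    using Suc.prems by (auto elim: relpow_Suc_E)
  have "ncc n \<rho> \<theta> \<le> Suc (ncc n \<rho> \<pi>)" using \<theta>(2) ncc_cover by (auto simp: hasse_def)
  then show ?case using Suc.IH[OF \<theta>(1)] by simp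
qed

lemma hasse_walk_upper:
  assumes "\<rho> \<in> NC n" "\<pi> \<in> NC n"
  shows "\<exists>k. k + ncc n \<rho> \<pi> \<le> n \<and> (\<pi>, \<rho>) \<in> hasse n ^^ k"
  using assms(2)
proof (induction "n - ncc n \<rho> \<pi>" arbitrary: \<pi> rule: less_induct)
  case less
  show ?case
  proof (cases "\<rho> = \<pi>")
    case True
    then show ?thesis using ncc_le[OF assms(1)] by (intro exI[of _ 0]) auto
  next
    case False
    then obtain Q where Q: "Q \<in> NC n" "(\<pi>, Q) \<in> hasse n" "ncc n \<rho> \<pi> < ncc n \<rho> Q"
      using closer_neighbour[OF assms(1) less.prems] by blast
    then have "n - ncc n \<rho> Q < n - ncc n \<rho> \<pi>" using ncc_le[OF assms(1), of Q] by linarith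
    then obtain k where k: "k + ncc n \<rho> Q \<le> n" "(Q, \<rho>) \<in> hasse n ^^ k" using less.hyps Q(1) by blast
    have "(\<pi>, \<rho>) \<in> hasse n ^^ Suc k" using Q(2) k(2) by (rule relpow_Suc_I2)
    then show ?thesis using k(1) Q(3) by (intro exI[of _ "Suc k"]) auto
  qed
qed

lemma graph_dist_hasse:
  assumes "\<rho> \<in> NC n" "\<pi> \<in> NC n"
  shows "graph_dist (hasse n) \<rho> \<pi> = n - ncc n \<rho> \<pi>"
proof -
  obtain k where k: "k + ncc n \<pi> \<rho> \<le> n" "(\<rho>, \<pi>) \<in> hasse n ^^ k"
    using hasse_walk_upper[OF assms(2,1)] by blast
  have eq: "ncc n \<pi> \<rho> = ncc n \<rho> \<pi>" by (simp add: ncc_def Un_commute)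
  have "(LEAST k. (\<rho>, \<pi>) \<in> hasse n ^^ k) \<le> k" using k(2) by (rule Least_le)
  moreover have "(\<rho>, \<pi>) \<in> hasse n ^^ (LEAST k. (\<rho>, \<pi>) \<in> hasse n ^^ k)" using k(2) by (rule LeastI)
  then have "n \<le> ncc n \<rho> \<pi> + (LEAST k. (\<rho>, \<pi>) \<in> hasse n ^^ k)" by (rule hasse_walk_lower[OF _ assms(1)])
  ultimately show ?thesis using k(1) eq by (simp add: graph_dist_def)
qed

subsection \<open>Words, heights and arcs\<close>

definition slope :: "side \<Rightarrow> int" where
  "slope x = (case x of L \<Rightarrow> 1 | R \<Rightarrow> -1)"

definition rise :: "(int \<Rightarrow> side) \<Rightarrow> int \<Rightarrow> int \<Rightarrow> int" where
  "rise a i j = (\<Sum>k\<in>{i..j}. slope (a k))"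

text \<open>Bracket matching: the arc from \<open>i\<close> ends where the height first returns to
  its value just before \<open>i\<close>.\<close>

definition opens :: "(int \<Rightarrow> side) \<Rightarrow> int \<Rightarrow> int \<Rightarrow> bool" where
  "opens a i j \<longleftrightarrow> i < j \<and> rise a i j = 0 \<and> (\<forall>t\<in>{i..<j}. rise a i t > 0)"

definition arc_rel :: "(int \<Rightarrow> side) \<Rightarrow> (int \<times> int) set" where
  "arc_rel a = {(i, j). opens a i j \<or> opens a j i}"

lemma slope_simps [simp]: "slope L = 1" "slope R = -1"
  by (simp_all add: slope_def)

lemma rise_split:
  assumes "i \<le> t + 1" "t \<le> j"
  shows "rise a i j = rise a i t + rise a (t + 1) j"
proof -
  have "{i..j} = {i..t} \<union> {t + 1..j}" "{i..t} \<inter> {t + 1..j} = {}" using assms by auto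
  then show ?thesis unfolding rise_def by (simp add: sum.union_disjoint)
qed

lemma rise_single [simp]: "rise a i i = slope (a i)"
  by (simp add: rise_def)

lemma rise_empty: "j < i \<Longrightarrow> rise a i j = 0"
  by (simp add: rise_def)

lemma rise_cong: "(\<And>k. i \<le> k \<Longrightarrow> k \<le> j \<Longrightarrow> a k = b k) \<Longrightarrow> rise a i j = rise b i j"
  by (auto simp: rise_def intro!: sum.cong)

lemma opens_cong:
  assumes "\<And>k. i \<le> k \<Longrightarrow> k \<le> j \<Longrightarrow> a k = b k"
  shows "opens a i j \<longleftrightarrow> opens b i j"
proof -
  have "rise a i t = rise b i t" if "t \<le> j" for t by (rule rise_cong) (use assms that in auto)
  then show ?thesis by (auto simp: opens_def)
qed

lemma opens_less: "opens a i j \<Longrightarrow> i < j"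
  by (simp add: opens_def)

lemma opens_pos: "opens a i j \<Longrightarrow> i \<le> t \<Longrightarrow> t < j \<Longrightarrow> rise a i t > 0"
  by (simp add: opens_def)

lemma opens_left: "opens a i j \<Longrightarrow> a i = L"
  by (cases "a i") (auto simp: opens_def dest: bspec[of _ _ i])

lemma opens_right:
  assumes "opens a i j"
  shows "a j = R"
proof (cases "a j")
  case L
  have "rise a i j = rise a i (j - 1) + rise a j j"
    using rise_split[of i "j - 1" j a] assms by (simp add: opens_def)
  moreover have "rise a i (j - 1) > 0" using assms by (auto simp: opens_def)
  ultimately show ?thesis using L assms by (simp add: opens_def)
qed

lemma opens_unique_right:
  assumes "opens a i j" "opens a i j'"
  shows "j = j'"
proof (rule ccontr)
  assume "j \<noteq> j'"
  then consider "j < j'" | "j' < j" by linarith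
  then show False
  proof cases
    case 1 then show False using assms opens_pos[OF assms(2), of j] by (simp add: opens_def)
  next
    case 2 then show False using assms opens_pos[OF assms(1), of j'] by (simp add: opens_def)
  qed
qed

text \<open>The gains before \<open>j\<close> and from \<open>j\<close> to \<open>k\<close> are both
  positive, so the walk started at \<open>i\<close> cannot be back at \<open>k\<close>.\<close>

lemma opens_noncrossing:
  assumes "opens a i k" "opens a j l" "i < j" "j \<le> k" "k < l"
  shows False
proof -
  have "rise a i k = rise a i (j - 1) + rise a j k"
    using rise_split[of i "j - 1" k a] assms by (simp add: opens_def)
  moreover have "rise a i (j - 1) > 0" "rise a j k > 0" using assms by (auto simp: opens_def)
  ultimately show False using assms by (auto simp: opens_def)
qed

lemma opens_unique_left:
  assumes "opens a i j" "opens a i' j"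
  shows "i = i'"
proof -
  have False if "opens a i j" "opens a i' j" "i < i'" for i i'
  proof -
    have "rise a i j = rise a i (i' - 1) + rise a i' j"
      using rise_split[of i "i' - 1" j a] that by (simp add: opens_def)
    moreover have "rise a i (i' - 1) > 0" using that by (auto simp: opens_def)
    ultimately show False using that by (auto simp: opens_def)
  qed
  then show ?thesis using assms by (metis linorder_neqE)
qed

lemma arc_unique:
  assumes "(i, j) \<in> arc_rel a" "(i, j') \<in> arc_rel a"
  shows "j = j'"
  using assms opens_unique_left opens_unique_right opens_left opens_right
  unfolding arc_rel_def by (smt (verit) mem_Collect_eq case_prod_conv side.distinct(1))

lemma sym_arc: "sym (arc_rel a)"
  by (auto simp: arc_rel_def sym_def)

lemma rise_eq_card:
  "rise a i j = int (card {k \<in> {i..j}. a k = L}) - int (card {k \<in> {i..j}. a k = R})"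
proof -
  have "slope x = of_bool (x = L) - of_bool (x = R)" for x by (cases x) auto
  then have "rise a i j = (\<Sum>k\<in>{i..j}. of_bool (a k = L)) - (\<Sum>k\<in>{i..j}. of_bool (a k = R))"
    by (simp add: rise_def sum_subtractf)
  then show ?thesis by (simp add: Int_def)
qed

text \<open>Inside an arc of a nested pairing every closing point has its opening partner to its left, so
  initial segments contain more opening than closing points.\<close>

lemma opens_if_nested_pairing:
  assumes ij: "(i, j) \<in> S" "i < j" and S: "sym S" "\<And>k l l'. (k, l) \<in> S \<Longrightarrow> (k, l') \<in> S \<Longrightarrow> l = l'"
    and closed: "\<And>k. i < k \<Longrightarrow> k < j \<Longrightarrow> \<exists>l. (k, l) \<in> S \<and> i < l \<and> l < j"
    and letter: "\<And>k l. (k, l) \<in> S \<Longrightarrow> k \<noteq> l \<and> (a k = L \<longleftrightarrow> k < l)"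
  shows "opens a i j"
proof -
  define p where "p k = (THE l. (k, l) \<in> S)" for k
  have p: "p k = l" if "(k, l) \<in> S" for k l unfolding p_def using that S(2) by (intro the_equality) auto
  have pp: "p (p k) = k" if "(k, l) \<in> S" for k l using that p S(1) by (metis symD)
  have s: "(l, k) \<in> S" if "(k, l) \<in> S" for k l using that S(1) by (auto dest: symD)
  have in1: "(k, p k) \<in> S \<and> i < p k \<and> p k < j" if "i < k" "k < j" for k using closed[OF that] p by auto
  have in2: "(k, p k) \<in> S \<and> i \<le> p k \<and> p k \<le> j" if "i \<le> k" "k \<le> j" for k
    using in1[of k] p[OF ij(1)] p[OF s[OF ij(1)]] ij s[OF ij(1)] that by (cases "k = i"; cases "k = j") auto
  have LR: "a k = R \<longleftrightarrow> \<not> a k = L" for k by (cases "a k") auto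
  let ?Ls = "\<lambda>t. {k \<in> {i..t}. a k = L}" and ?Rs = "\<lambda>t. {k \<in> {i..t}. a k = R}"
  have fin: "finite (?Ls t)" "finite (?Rs t)" for t by (rule finite_subset[of _ "{i..t}"], auto)+
  have aiL: "a i = L" using letter[OF ij(1)] ij(2) by auto
  have inj: "inj_on p X" if "X \<subseteq> {i..j}" for X
  proof (rule inj_onI)
    fix x y assume "x \<in> X" "y \<in> X" "p x = p y"
    then show "x = y" using in2[of x] in2[of y] pp[of x] pp[of y] that by fastforce
  qed
  have "rise a i t > 0" if t: "t \<in> {i..<j}" for t
  proof -
    have "p ` ?Rs t \<subseteq> ?Ls t - {i}"
    proof (rule image_subsetI)
      fix k assume "k \<in> ?Rs t"
      then have k: "k \<in> {i..t}" "a k = R" by auto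
      then have "k \<noteq> i" using aiL by auto
      then have pk: "(k, p k) \<in> S" "i < p k" "p k < j" using in1[of k] k t by auto
      then have "p k < k" using letter[OF pk(1)] k(2) by auto
      then show "p k \<in> ?Ls t - {i}" using pk k letter[OF s[OF pk(1)]] by auto
    qed
    moreover have "inj_on p (?Rs t)" using t by (intro inj) auto
    ultimately have "card (?Rs t) \<le> card (?Ls t - {i})"
      using card_inj_on_le[of p "?Rs t" "?Ls t - {i}"] fin(1) by blast
    also have "\<dots> < card (?Ls t)" by (rule psubset_card_mono[OF fin(1)]) (use aiL t in auto)
    finally show ?thesis by (simp add: rise_eq_card)
  qed
  moreover have "rise a i j = 0"
  proof -
    have "p ` ?Rs j \<subseteq> ?Ls j"
    proof (rule image_subsetI)
      fix k assume "k \<in> ?Rs j"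
      then have k: "k \<in> {i..j}" "a k = R" by auto
      then have pk: "(k, p k) \<in> S" "i \<le> p k" "p k \<le> j" using in2[of k] by auto
      then show "p k \<in> ?Ls j" using letter[OF s[OF pk(1)]] letter[OF pk(1)] k by auto
    qed
    then have 1: "card (?Rs j) \<le> card (?Ls j)" by (intro card_inj_on_le[of p] fin) (auto intro: inj)
    have "p ` ?Ls j \<subseteq> ?Rs j"
    proof (rule image_subsetI)
      fix k assume "k \<in> ?Ls j"
      then have k: "k \<in> {i..j}" "a k = L" by auto
      then have pk: "(k, p k) \<in> S" "i \<le> p k" "p k \<le> j" using in2[of k] by auto
      then show "p k \<in> ?Rs j" using letter[OF s[OF pk(1)]] letter[OF pk(1)] k LR by auto
    qed
    then have "card (?Ls j) \<le> card (?Rs j)" by (intro card_inj_on_le[of p] fin) (auto intro: inj)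
    then show ?thesis using 1 by (simp add: rise_eq_card)
  qed
  ultimately show ?thesis using ij(2) by (auto simp: opens_def)
qed

section \<open>The word of a non-crossing partition\<close>

lemma NC_arcs_range:
  assumes "P \<in> NC n" "(p, q) \<in> NC_arcs P"
  shows "p \<in> {1..2 * int n}" "q \<in> {1..2 * int n}"
  using assms(2) by (auto simp: NC_arcs_def dest!: nxt_range[OF assms(1)])

lemma NC_arcs_total:
  assumes "P \<in> NC n" "p \<in> {1..2 * int n}"
  shows "\<exists>q. (p, q) \<in> NC_arcs P"
proof (cases "even p")
  case True
  then obtain m where m: "p = 2 * m" by blast
  have "nat m \<in> {1..n}" "p = 2 * int (nat m)" using m assms(2) by auto
  then show ?thesis using nxt_total(1)[OF assms(1)] NC_arcs_simps by metis
next
  case False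
  then obtain m where m: "p = 2 * m + 1" by (rule oddE)
  have "nat (m + 1) \<in> {1..n}" "p = 2 * int (nat (m + 1)) - 1" using m assms(2) by auto
  then show ?thesis using nxt_total(2)[OF assms(1)] NC_arcs_simps by metis
qed

lemma NC_arcs_nested:
  assumes P: "P \<in> NC n" and pq: "(p, q) \<in> NC_arcs P" "p < q" and k: "p < k" "k < q"
  shows "\<exists>l. (k, l) \<in> NC_arcs P \<and> p < l \<and> l < q"
proof -
  have kr: "k \<in> {1..2 * int n}" using NC_arcs_range[OF P pq(1)] k by auto
  obtain l where l: "(k, l) \<in> NC_arcs P" using NC_arcs_total[OF P kr] by blast
  have ne: "l \<noteq> p" "l \<noteq> q"
    using NC_arcs_single_valued[OF P] l pq k sym_NC_arcs[of P] by (metis symD less_irrefl)+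
  obtain W where W: "W \<in> P" and Wkl: "\<exists>x\<in>W. k = 2 * int x \<or> k = 2 * int x - 1" "\<exists>x\<in>W. l = 2 * int x \<or> l = 2 * int x - 1"
    using l by (auto simp: NC_arcs_def nxt_def cyc_succ_def; blast)
  obtain x y where x: "x \<in> W" "k = 2 * int x \<or> k = 2 * int x - 1" and y: "y \<in> W" "l = 2 * int y \<or> l = 2 * int y - 1"
    using Wkl by blast
  show ?thesis using pq(1)
  proof (cases rule: NC_arcsE)
    case (1 i j)
    then have ij: "i < j" using pq(2) by auto
    have "i < x" "x < j" using x(2) 1 k by auto
    then have "W \<subseteq> {i<..<j}" by (rule nxt_up_block_inside[OF P 1(1) ij _ _ W x(1)])
    then have "i < y" "y < j" using y by auto
    then show ?thesis using l y 1 by auto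
  next
    case (2 i j)
    then have ij: "j \<le> i" using pq(2) by auto
    have "j \<le> x" "x \<le> i" using x(2) 2 k by auto
    then have "W \<subseteq> {j..i}" by (rule nxt_down_block_inside[OF P 2(1) ij _ _ W x(1)])
    then have "j \<le> y" "y \<le> i" using y by auto
    then have "p \<le> l" "l \<le> q" using y 2 by auto
    then show ?thesis using l ne by auto
  qed
qed

definition NC_word :: "nat set set \<Rightarrow> int \<Rightarrow> side" where
  "NC_word P p = (if \<exists>q. (p, q) \<in> NC_arcs P \<and> p < q then L else R)"

lemma NC_arcs_neq: "(p, q) \<in> NC_arcs P \<Longrightarrow> p \<noteq> q"
  by (auto simp: NC_arcs_def; presburger)

lemma opens_NC_word:
  assumes P: "P \<in> NC n" and a: "\<And>k. k \<in> {1..2 * int n} \<Longrightarrow> a k = NC_word P k"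
    and pq: "(p, q) \<in> NC_arcs P" "p < q"
  shows "opens a p q"
proof (rule opens_if_nested_pairing[OF pq sym_NC_arcs])
  show "l = l'" if "(k, l) \<in> NC_arcs P" "(k, l') \<in> NC_arcs P" for k l l'
    using NC_arcs_single_valued[OF P] that by blast
  show "\<exists>l. (k, l) \<in> NC_arcs P \<and> p < l \<and> l < q" if "p < k" "k < q" for k
    using NC_arcs_nested[OF P pq that] .
  show "k \<noteq> l \<and> (a k = L) = (k < l)" if "(k, l) \<in> NC_arcs P" for k l
  proof -
    have "NC_word P k = L \<longleftrightarrow> (\<exists>l. (k, l) \<in> NC_arcs P \<and> k < l)" by (simp add: NC_word_def)
    also have "\<dots> \<longleftrightarrow> k < l" using NC_arcs_single_valued[OF P that] that by blast
    finally show ?thesis using a[OF NC_arcs_range(1)[OF P that]] NC_arcs_neq[OF that] by simp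
  qed
qed

text \<open>An arc depends only on the letters that it spans, so those of \<open>a\<close> outside
  \<open>{1..2 * int n}\<close> are arbitrary. This lets a finite matching be read off a bi-infinite
  random word. Since all points of the range are matched by \<open>NC_arcs P\<close> already,
  uniqueness of partners rules out further arcs.\<close>

lemma arc_NC_word:
  assumes P: "P \<in> NC n" and a: "\<And>k. k \<in> {1..2 * int n} \<Longrightarrow> a k = NC_word P k" and p: "p \<in> {1..2 * int n}"
  shows "(p, q) \<in> arc_rel a \<longleftrightarrow> (p, q) \<in> NC_arcs P"
proof -
  have sub: "(p, q) \<in> arc_rel a" if "(p, q) \<in> NC_arcs P" for p q
  proof (cases "p < q")
    case True then show ?thesis using opens_NC_word[OF P a that] by (auto simp: arc_rel_def)
  next
    case False
    then have "q < p" using NC_arcs_neq[OF that] by simp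
    moreover have "(q, p) \<in> NC_arcs P" using that sym_NC_arcs[of P] by (auto dest: symD)
    ultimately have "opens a q p" using opens_NC_word[OF P a] by blast
    then show ?thesis by (auto simp: arc_rel_def)
  qed
  obtain q' where "(p, q') \<in> NC_arcs P" using NC_arcs_total[OF P p] by blast
  then show ?thesis using sub arc_unique by metis
qed

lemma NC_word_inj:
  assumes P: "P \<in> NC n" and Q: "Q \<in> NC n" and eq: "\<And>k. k \<in> {1..2 * int n} \<Longrightarrow> NC_word P k = NC_word Q k"
  shows "P = Q"
proof (rule NC_eqI[OF P Q], rule subrelI)
  fix i j assume ij: "(i, j) \<in> nxt P"
  then have "2 * int i \<in> {1..2 * int n}" using nxt_range[OF P ij] by auto
  then have "(2 * int i, 2 * int j - 1) \<in> NC_arcs Q"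
    using arc_NC_word[OF P, of "NC_word Q" "2 * int i" "2 * int j - 1"]
      arc_NC_word[OF Q, of "NC_word Q" "2 * int i" "2 * int j - 1"] eq ij by (simp add: NC_arcs_simps)
  then show "(i, j) \<in> nxt Q" by (simp add: NC_arcs_simps)
qed

section \<open>The graph truncated at arc length \<open>K\<close>\<close>

definition edges :: "nat \<Rightarrow> (int \<Rightarrow> side) \<Rightarrow> (int \<Rightarrow> side) \<Rightarrow> (int \<times> int) set" where
  "edges K a b = {(i, j). \<bar>i - j\<bar> \<le> int K \<and> (i, j) \<in> arc_rel a \<union> arc_rel b}"

text \<open>The local substitute for the inverse size of the component of \<open>i\<close>. One
  parameter serves as cutoff and as radius, so that the letters within distance \<open>K * K\<close>
  of \<open>i\<close> determine the value.\<close>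

definition ball_weight :: "nat \<Rightarrow> (int \<Rightarrow> side) \<Rightarrow> (int \<Rightarrow> side) \<Rightarrow> int \<Rightarrow> real" where
  "ball_weight K a b i = 1 / real (card (steps_ball (edges K a b) K i))"

definition long_arc :: "nat \<Rightarrow> (int \<Rightarrow> side) \<Rightarrow> int \<Rightarrow> bool" where
  "long_arc K a i \<longleftrightarrow> \<not> (\<exists>j. (i, j) \<in> arc_rel a \<and> \<bar>i - j\<bar> \<le> int K)"

lemma finite_steps_ball:
  assumes "\<And>i. finite (E `` {i})"
  shows "finite (steps_ball E m i)"
proof (induction m)
  case (Suc m)
  have "E `` steps_ball E m i = (\<Union>j\<in>steps_ball E m i. E `` {j})" by auto
  then show ?case using Suc assms by (simp add: steps_ball_Suc)
qed (simp add: steps_ball_0)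

lemma finite_edges_image: "finite (edges K a b `` {i})"
  by (rule finite_subset[of _ "{i - int K..i + int K}"]) (auto simp: edges_def)

lemma steps_ball_cong:
  assumes "\<And>p q. p \<in> V \<Longrightarrow> (p, q) \<in> E \<longleftrightarrow> (p, q) \<in> F" "F `` V \<subseteq> V" "i \<in> V"
  shows "steps_ball E m i = steps_ball F m i \<and> steps_ball F m i \<subseteq> V"
proof (induction m)
  case (Suc m)
  then have "E `` steps_ball F m i = F `` steps_ball F m i" "F `` steps_ball F m i \<subseteq> V"
    using assms by blast+
  then show ?case using Suc by (simp add: steps_ball_Suc)
qed (use assms in \<open>simp add: steps_ball_0\<close>)

text \<open>Deleting the arcs longer than \<open>K\<close> changes the number of components by at most the number of deleted
  arcs; after that, components with more than \<open>K\<close> points are few, and all others are balls of radius \<open>K\<close>.\<close>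

lemma ncc_ball_weight:
  assumes P: "P \<in> NC n" and Q: "Q \<in> NC n"
    and a: "\<And>k. k \<in> {1..2 * int n} \<Longrightarrow> a k = NC_word P k"
    and b: "\<And>k. k \<in> {1..2 * int n} \<Longrightarrow> b k = NC_word Q k"
  defines "V \<equiv> {1..2 * int n}"
  shows "\<bar>real (ncc n P Q) - (\<Sum>i\<in>V. ball_weight K a b i)\<bar> \<le>
    2 * real n / real (Suc K) + (\<Sum>i\<in>V. of_bool (long_arc K a i) + of_bool (long_arc K b i))"
proof -
  define N where "N = NC_arcs P \<union> NC_arcs Q"
  define E where "E = {(i, j) \<in> N. \<bar>i - j\<bar> \<le> int K}"
  define D where "D = {(i, j) \<in> N. \<bar>i - j\<bar> > int K}"
  have fV: "finite V" by (simp add: V_def)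
  have cV: "real (card V) = 2 * real n" by (simp add: V_def)
  have symN: "sym N" unfolding N_def by (rule sym_two_arcs)
  have symE: "sym E" using symN by (auto simp: E_def sym_def abs_minus_commute)
  have NV: "N \<subseteq> V \<times> V" using NC_arcs_range[OF P] NC_arcs_range[OF Q] by (auto simp: N_def V_def)
  then have EV: "E `` V \<subseteq> V" by (auto simp: E_def)
  have arcs: "(p, q) \<in> arc_rel a \<longleftrightarrow> (p, q) \<in> NC_arcs P" "(p, q) \<in> arc_rel b \<longleftrightarrow> (p, q) \<in> NC_arcs Q" if "p \<in> V" for p q
    using arc_NC_word[OF P a] arc_NC_word[OF Q b] that by (auto simp: V_def)
  have edge: "(p, q) \<in> edges K a b \<longleftrightarrow> (p, q) \<in> E" if "p \<in> V" for p q
    using arcs[OF that] by (auto simp: edges_def E_def N_def)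
  have ball: "steps_ball (edges K a b) m i = steps_ball E m i" "steps_ball E m i \<subseteq> V" if "i \<in> V" for i m
    using steps_ball_cong[OF edge EV that] by blast+
  have fin: "finite (steps_ball E m i)" if "i \<in> V" for i m
    using ball(2)[OF that] fV finite_subset by blast
  have compV: "E\<^sup>* `` {i} \<subseteq> V" if "i \<in> V" for i
    using that Image_closed_trancl[OF EV] Image_mono[of "E\<^sup>*" "E\<^sup>*" "{i}" V] by simp
  have diff: "0 \<le> ball_weight K a b i - 1 / real (card (E\<^sup>* `` {i})) \<and>
      ball_weight K a b i - 1 / real (card (E\<^sup>* `` {i})) \<le> 1 / real (Suc K)" if "i \<in> V" for i
  proof -
    let ?B = "steps_ball E K i" and ?C = "E\<^sup>* `` {i}"
    have bw: "ball_weight K a b i = 1 / real (card ?B)" by (simp add: ball_weight_def ball(1)[OF that])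
    have "?B \<noteq> {}" using start_in_steps_ball[of i E K] by auto
    then have pos: "card ?B > 0" using fin[OF that] by (simp add: card_gt_0_iff)
    have "card ?B \<le> card ?C"
      using compV[OF that] fV steps_ball_subset by (metis card_mono finite_subset)
    then have 1: "1 / real (card ?C) \<le> 1 / real (card ?B)" using pos by (simp add: field_simps)
    have "?C = ?B \<or> Suc K \<le> card ?B" by (rule component_eq_steps_ball_or_card) (rule fin[OF that])
    then show ?thesis
    proof
      assume "?C = ?B" then show ?thesis unfolding bw by simp
    next
      assume "Suc K \<le> card ?B"
      then have "1 / real (card ?B) \<le> 1 / real (Suc K)" by (intro divide_left_mono) auto
      moreover have "1 / real (card ?C) \<ge> 0" by simp
      ultimately show ?thesis using 1 unfolding bw by linarith
    qed
  qed
  let ?S = "\<Sum>i\<in>V. ball_weight K a b i"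
  have nE: "real (ncomp V E) = (\<Sum>i\<in>V. 1 / real (card (E\<^sup>* `` {i})))"
    by (rule sum_inverse_card_component[symmetric, OF fV symE EV])
  have "?S - real (ncomp V E) = (\<Sum>i\<in>V. ball_weight K a b i - 1 / real (card (E\<^sup>* `` {i})))"
    unfolding nE by (simp add: sum_subtractf)
  moreover have "\<dots> \<ge> 0" by (rule sum_nonneg) (use diff in auto)
  moreover have "(\<Sum>i\<in>V. ball_weight K a b i - 1 / real (card (E\<^sup>* `` {i}))) \<le> (\<Sum>i\<in>V. 1 / real (Suc K))"
    by (rule sum_mono) (use diff in blast)
  moreover have "(\<Sum>i\<in>V. 1 / real (Suc K)) = 2 * real n / real (Suc K)" using cV by simp
  ultimately have A: "0 \<le> ?S - real (ncomp V E)" "?S - real (ncomp V E) \<le> 2 * real n / real (Suc K)" by linarith+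
  have nccN: "ncc n P Q = ncomp V N" by (simp add: ncc_def N_def V_def)
  have "finite N" using NV fV finite_subset by blast
  then have finD: "finite D" by (rule finite_subset[rotated]) (auto simp: D_def)
  have "E \<union> D \<union> D\<inverse> = N" using symN by (auto simp: E_def D_def sym_def abs_minus_commute)
  then have B1: "ncomp V E \<le> ncomp V N + card D" using ncomp_union_edges[OF fV symE finD] by simp
  have B2: "ncomp V N \<le> ncomp V E" by (rule ncomp_mono[OF fV]) (auto simp: E_def)
  let ?la = "{i \<in> V. long_arc K a i}" and ?lb = "{i \<in> V. long_arc K b i}"
  \<comment> \<open>\<open>D\<close> contains each deleted arc in both orientations, and each
    orientation is charged to its own starting point. The factor two given away is harmless.\<close>
  have "card D \<le> card ?la + card ?lb"
  proof -
    let ?D = "\<lambda>X. {(i, j) \<in> NC_arcs X. \<bar>i - j\<bar> > int K}"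
    have le: "card (?D X) \<le> card {i \<in> V. long_arc K c i}"
      if X: "X \<in> NC n" and c: "\<And>p q. p \<in> V \<Longrightarrow> (p, q) \<in> arc_rel c \<longleftrightarrow> (p, q) \<in> NC_arcs X" for X c
    proof (rule card_inj_on_le[of fst])
      show "inj_on fst (?D X)" using NC_arcs_single_valued[OF X] by (auto simp: inj_on_def)
      show "fst ` ?D X \<subseteq> {i \<in> V. long_arc K c i}"
      proof (rule image_subsetI)
        fix e assume "e \<in> ?D X"
        then obtain i j where ij: "e = (i, j)" "(i, j) \<in> NC_arcs X" "\<bar>i - j\<bar> > int K" by auto
        have "i \<in> V" using ij NC_arcs_range[OF X] by (auto simp: V_def)
        moreover have "long_arc K c i"
          unfolding long_arc_def using c[OF \<open>i \<in> V\<close>] NC_arcs_single_valued[OF X ij(2)] ij(3) by force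
        ultimately show "fst e \<in> {i \<in> V. long_arc K c i}" by (simp add: ij(1))
      qed
    qed (use fV in auto)
    have "D = ?D P \<union> ?D Q" by (auto simp: D_def N_def)
    then have "card D \<le> card (?D P) + card (?D Q)" by (simp add: card_Un_le)
    then show ?thesis using le[OF P arcs(1)] le[OF Q arcs(2)] by linarith
  qed
  then have "real (card D) \<le> real (card ?la) + real (card ?lb)" by simp
  also have "\<dots> = (\<Sum>i\<in>V. of_bool (long_arc K a i) + of_bool (long_arc K b i))"
    using fV by (simp add: sum.distrib Int_def)
  finally have "real (card D) \<le> (\<Sum>i\<in>V. of_bool (long_arc K a i) + of_bool (long_arc K b i))" .
  moreover have "real (ncomp V N) \<le> real (ncomp V E)" "real (ncomp V E) \<le> real (ncomp V N) + real (card D)"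
    using B1 B2 by linarith+
  ultimately show ?thesis using A unfolding nccN by linarith
qed

subsection \<open>A lower bound for the number of non-crossing partitions\<close>

fun walk :: "nat \<Rightarrow> side list \<Rightarrow> nat option" where
  "walk k [] = Some k"
| "walk k (L # xs) = walk (Suc k) xs"
| "walk 0 (R # xs) = None"
| "walk (Suc k) (R # xs) = walk k xs"

lemma finite_side_lists: "finite {xs :: side list. length xs = N \<and> Q xs}"
proof -
  have "(UNIV :: side set) = {L, R}" using side.exhaust by auto
  then have "finite (UNIV :: side set)" by (metis finite.emptyI finite.insertI)
  then have "finite {xs :: side list. set xs \<subseteq> UNIV \<and> length xs = N}" by (rule finite_lists_length_eq)
  then show ?thesis by (rule rev_finite_subset) auto
qed

lemma card_side_lists_Suc:
  "card {xs :: side list. length xs = Suc N \<and> Q xs} =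
    card {xs. length xs = N \<and> Q (L # xs)} + card {xs. length xs = N \<and> Q (R # xs)}"
proof -
  have "{xs :: side list. length xs = Suc N \<and> Q xs} =
    (#) L ` {xs. length xs = N \<and> Q (L # xs)} \<union> (#) R ` {xs. length xs = N \<and> Q (R # xs)}"
  proof (intro set_eqI iffI)
    fix xs :: "side list" assume "xs \<in> {xs. length xs = Suc N \<and> Q xs}"
    then obtain x ys where "xs = x # ys" "length ys = N" "Q (x # ys)" by (cases xs) auto
    then show "xs \<in> (#) L ` {xs. length xs = N \<and> Q (L # xs)} \<union> (#) R ` {xs. length xs = N \<and> Q (R # xs)}"
      by (cases x) auto
  qed auto
  moreover have "(#) L ` {xs. length xs = N \<and> Q (L # xs)} \<inter> (#) R ` {xs. length xs = N \<and> Q (R # xs)} = {}" by auto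
  ultimately show ?thesis by (simp add: card_Un_disjoint finite_side_lists card_image)
qed

definition ballot :: "nat \<Rightarrow> nat \<Rightarrow> nat" where
  "ballot N k = card {xs. length xs = N \<and> walk k xs = Some 0}"

lemma ballot_Suc:
  "ballot (Suc N) k = ballot N (Suc k) + (case k of 0 \<Rightarrow> 0 | Suc k' \<Rightarrow> ballot N k')"
  unfolding ballot_def card_side_lists_Suc by (cases k) simp_all

lemma ballot_0: "ballot 0 k = of_bool (k = 0)"
proof -
  have "{xs. length xs = 0 \<and> walk k xs = Some 0} = (if k = 0 then {[]} else {})" by auto
  then show ?thesis by (simp add: ballot_def)
qed

lemma ballot_eq_0: "N < k \<Longrightarrow> ballot N k = 0"
  by (induction N arbitrary: k) (auto simp: ballot_0 ballot_Suc split: nat.splits)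

text \<open>The ballot formula: among the \<open>k + 2 * m\<close> steps exactly \<open>m\<close> go
  up, and the count is a difference of two neighbouring binomial coefficients. It is written as a
  sum to stay clear of truncated subtraction, and follows from Pascal's rule by splitting off the
  first step.\<close>

lemma ballot_eq: "ballot (k + 2 * m) k + (if m = 0 then 0 else (k + 2 * m) choose (m - 1)) = (k + 2 * m) choose m"
proof (induction "k + 2 * m" arbitrary: k m)
  case 0
  then show ?case by (simp add: ballot_0)
next
  case (Suc N)
  have up: "ballot N (Suc k) + (if m \<le> 1 then 0 else N choose (m - 2)) = (if m = 0 then 0 else N choose (m - 1))"
  proof (cases m)
    case 0
    then show ?thesis using Suc(2) by (simp add: ballot_eq_0)
  next
    case (Suc m')
    then have "N = Suc k + 2 * m'" using Suc.hyps(2) by simp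
    then show ?thesis using Suc.hyps(1)[of "Suc k" m'] Suc by (cases m') auto
  qed
  have down: "(case k of 0 \<Rightarrow> 0 | Suc k' \<Rightarrow> ballot N k') + (if m = 0 then 0 else N choose (m - 1)) = N choose m"
  proof (cases k)
    case 0
    then have "m \<noteq> 0" "N = 2 * m - 1" using Suc(2) by auto
    \<comment> \<open>At height \<open>0\<close> no step down is possible. The missing term is
      indeed zero, because \<open>N = 2 * m - 1\<close> is odd and its two middle binomial
      coefficients agree.\<close>
    then have "N choose (m - 1) = N choose m"
      by (subst binomial_symmetric) (auto intro!: arg_cong2[of _ _ _ _ binomial])
    then show ?thesis using 0 \<open>m \<noteq> 0\<close> by simp
  next
    case (Suc k')
    then show ?thesis using Suc.hyps(1)[of k' m] Suc.hyps(2) by (cases "m = 0") simp_all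
  qed
  show ?case unfolding Suc(2)[symmetric] ballot_Suc
  proof (cases m)
    case 0
    then show "ballot N (Suc k) + (case k of 0 \<Rightarrow> 0 | Suc x \<Rightarrow> ballot N x) + (if m = 0 then 0 else Suc N choose (m - 1)) = Suc N choose m"
      using up down by simp
  next
    case (Suc m')
    then show "ballot N (Suc k) + (case k of 0 \<Rightarrow> 0 | Suc x \<Rightarrow> ballot N x) + (if m = 0 then 0 else Suc N choose (m - 1)) = Suc N choose m"
      using up down by (cases m') auto
  qed
qed

text \<open>\<open>ballot (2 * n) 0\<close> is the Catalan number.\<close>

lemma ballot_central: "Suc n * ballot (2 * n) 0 = (2 * n) choose n"
proof (cases n)
  case 0
  then show ?thesis by (simp add: ballot_0)
next
  case (Suc m)
  have "Suc m * ((2 * n) choose Suc m) = (2 * n - m) * ((2 * n) choose m)"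
    using binomial_absorption[of m "2 * n"] binomial_absorb_comp[of "2 * n" m] by simp
  then have "n * ((2 * n) choose n) = Suc n * ((2 * n) choose (n - 1))" using Suc by simp
  moreover have "ballot (2 * n) 0 + ((2 * n) choose (n - 1)) = (2 * n) choose n"
    using ballot_eq[of 0 n] Suc by simp
  then have "Suc n * ballot (2 * n) 0 + Suc n * ((2 * n) choose (n - 1)) = Suc n * ((2 * n) choose n)"
    by (metis add_mult_distrib2)
  ultimately show ?thesis by simp
qed

lemma ballot_lower_bound:
  assumes "n > 0"
  shows "4 ^ n \<le> 2 * real n * real (Suc n) * real (ballot (2 * n) 0)"
proof -
  have "4 ^ n / (2 * real n) \<le> real (Suc n * ballot (2 * n) 0)"
    using central_binomial_lower_bound[OF assms] by (simp only: ballot_central)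
  then show ?thesis using assms by (simp add: field_simps)
qed

section \<open>From Dyck words to non-crossing partitions\<close>

definition dyck :: "nat \<Rightarrow> (int \<Rightarrow> side) \<Rightarrow> bool" where
  "dyck n a \<longleftrightarrow> (\<forall>t. 0 \<le> t \<and> t \<le> 2 * int n \<longrightarrow> rise a 1 t \<ge> 0) \<and> rise a 1 (2 * int n) = 0"

lemma rise_step: "0 \<le> t \<Longrightarrow> rise a 1 (t + 1) = rise a 1 t + slope (a (t + 1))"
  using rise_split[of 1 t "t + 1" a] by simp

text \<open>Equal heights occur at times of equal parity. Hence a return to the height at an odd
  time \<open>2i - 1\<close> happens at some \<open>2j - 1\<close>, the time that belongs to an
  element \<open>j\<close>.\<close>

lemma rise_parity: "0 \<le> t \<Longrightarrow> even (rise a 1 t + t)"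
proof (induction t rule: int_ge_induct)
  case base
  then show ?case by (simp add: rise_empty)
next
  case (step t)
  then show ?case by (cases "a (t + 1)") (auto simp: rise_step)
qed

text \<open>The height of the path just between the two sides of \<open>i\<close> is taken at time \<open>2i - 1\<close>;
  \<open>i\<close> and \<open>j\<close> lie in the same face if the path does not go below the segment between them.\<close>

definition same_face :: "nat \<Rightarrow> (int \<Rightarrow> side) \<Rightarrow> (nat \<times> nat) set" where
  "same_face n a = {(i, j). i \<in> {1..n} \<and> j \<in> {1..n} \<and> rise a 1 (2 * int i - 1) = rise a 1 (2 * int j - 1) \<and>
     (\<forall>t. min (2 * int i - 1) (2 * int j - 1) \<le> t \<and> t \<le> max (2 * int i - 1) (2 * int j - 1) \<longrightarrow>
        rise a 1 t \<ge> rise a 1 (2 * int i - 1))}"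

lemma equiv_same_face: "equiv {1..n} (same_face n a)"
proof (rule equivI)
  show "same_face n a \<subseteq> {1..n} \<times> {1..n}" by (auto simp: same_face_def)
  show "refl_on {1..n} (same_face n a)"
  proof (rule refl_onI)
    fix i assume "i \<in> {1..n}"
    moreover have "t = 2 * int i - 1" if "2 * int i - 1 \<le> t" "t \<le> 2 * int i - 1" for t using that by simp
    ultimately show "(i, i) \<in> same_face n a" unfolding same_face_def by fastforce
  qed
  show "sym (same_face n a)" by (auto simp: sym_def same_face_def min.commute max.commute)
  show "trans (same_face n a)"
  proof (rule transI)
    fix i j k assume ij: "(i, j) \<in> same_face n a" and jk: "(j, k) \<in> same_face n a"
    have "rise a 1 t \<ge> rise a 1 (2 * int i - 1)"
      if "min (2 * int i - 1) (2 * int k - 1) \<le> t" "t \<le> max (2 * int i - 1) (2 * int k - 1)" for t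
    proof -
      have "(min (2 * int i - 1) (2 * int j - 1) \<le> t \<and> t \<le> max (2 * int i - 1) (2 * int j - 1)) \<or>
         (min (2 * int j - 1) (2 * int k - 1) \<le> t \<and> t \<le> max (2 * int j - 1) (2 * int k - 1))"
        using that by linarith
      then show ?thesis using ij jk by (auto simp: same_face_def)
    qed
    then show "(i, k) \<in> same_face n a" using ij jk by (auto simp: same_face_def)
  qed
qed

definition faces :: "nat \<Rightarrow> (int \<Rightarrow> side) \<Rightarrow> nat set set" where
  "faces n a = {1..n} // same_face n a"

lemma same_face_iff: "(i, j) \<in> same_face n a \<longleftrightarrow> (\<exists>V\<in>faces n a. i \<in> V \<and> j \<in> V)"
proof
  assume ij: "(i, j) \<in> same_face n a"
  then have "i \<in> {1..n}" by (auto simp: same_face_def)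
  then show "\<exists>V\<in>faces n a. i \<in> V \<and> j \<in> V"
    using ij equiv_class_self[OF equiv_same_face] unfolding faces_def quotient_def by blast
next
  assume "\<exists>V\<in>faces n a. i \<in> V \<and> j \<in> V"
  then show "(i, j) \<in> same_face n a"
    using quotient_eq_iff[OF equiv_same_face] unfolding faces_def by blast
qed

text \<open>Two interleaved faces bound each other's heights from below, so they have the same
  height and coincide.\<close>

lemma faces_in_NC: "faces n a \<in> NC n"
  unfolding NC_def mem_Collect_eq
proof
  show "partition_on {1..n} (faces n a)"
    unfolding faces_def by (rule partition_on_quotient[OF equiv_same_face])
  have False if VW: "V \<in> faces n a" "W \<in> faces n a" "V \<noteq> W"
    and o: "i < j" "j < k" "k < l" and m: "i \<in> V" "k \<in> V" "j \<in> W" "l \<in> W" for V W i j k l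
  proof -
    let ?H = "\<lambda>i. rise a 1 (2 * int i - 1)"
    have ik: "(i, k) \<in> same_face n a" and jl: "(j, l) \<in> same_face n a"
      using same_face_iff VW m by blast+
    have "?H i \<le> ?H j" using ik o by (auto simp: same_face_def)
    moreover have "?H j \<le> ?H k" using jl o by (auto simp: same_face_def)
    moreover have "?H i = ?H k" using ik by (auto simp: same_face_def)
    ultimately have "(i, j) \<in> same_face n a" using ik jl o by (auto simp: same_face_def)
    then show False
      using quotient_eqI[OF equiv_same_face VW(1,2)[unfolded faces_def] m(1,3)] VW(3) by blast
  qed
  then show "noncrossing (faces n a)" unfolding noncrossing_def by blast
qed

text \<open>Recovers the letters at odd places from the faces, as its mirror image below does for
  the even places; together they show that a Dyck word is determined by its faces.\<close>

lemma opening_iff_least_in_face: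
  assumes a: "dyck n a" and i: "i \<in> {1..n}"
  shows "a (2 * int i - 1) = L \<longleftrightarrow> (\<forall>j<i. (j, i) \<notin> same_face n a)"
proof -
  let ?h = "rise a 1 (2 * int i - 1)"
  have step: "?h = rise a 1 (2 * int i - 2) + slope (a (2 * int i - 1))"
    using rise_step[of "2 * int i - 2" a] i by simp
  show ?thesis
  proof (cases "a (2 * int i - 1)")
    case L
    have "(j, i) \<notin> same_face n a" if "j < i" for j
    proof
      assume "(j, i) \<in> same_face n a"
      then have "rise a 1 (2 * int i - 2) \<ge> ?h" using that by (auto simp: same_face_def)
      then show False using step L by simp
    qed
    then show ?thesis using L by simp
  next
    case R
    \<comment> \<open>The last earlier time with height at most \<open>?h\<close> is wanted; time
      \<open>0\<close> is a candidate because heights are nonnegative. Steps of size one give it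
      height exactly \<open>?h\<close>, and parity makes it the time of an element
      \<open>j < i\<close> of the same face.\<close>
    let ?T = "{t \<in> {0..2 * int i - 2}. rise a 1 t \<le> ?h}"
    have h0: "?h \<ge> 0" using a i by (auto simp: dyck_def)
    have fin: "finite ?T" by (rule finite_subset[of _ "{0..2 * int i - 2}"]) auto
    have "0 \<in> ?T" using h0 i by (simp add: rise_empty)
    define t where "t = Max ?T"
    have tT: "t \<in> ?T" unfolding t_def by (rule Max_in[OF fin]) (use \<open>0 \<in> ?T\<close> in blast)
    have t: "0 \<le> t" "t \<le> 2 * int i - 2" "rise a 1 t \<le> ?h" using tT by auto
    have above: "rise a 1 u > ?h" if "t < u" "u \<le> 2 * int i - 2" for u
    proof (rule ccontr)
      assume "\<not> ?thesis"
      then have "u \<in> ?T" using that t by auto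
      then have "u \<le> t" unfolding t_def by (rule Max_ge[OF fin])
      then show False using that by simp
    qed
    have "rise a 1 (2 * int i - 2) = ?h + 1" using step R by simp
    then have "t < 2 * int i - 2" using t by (cases "t = 2 * int i - 2") auto
    then have "rise a 1 (t + 1) > ?h" by (intro above) auto
    then have eq: "rise a 1 t = ?h" using t rise_step[of t a] by (cases "a (t + 1)") auto
    have "odd t"
      using rise_parity[of t a] rise_parity[of "2 * int i - 1" a] eq t i by (auto simp: even_add)
    then obtain m where m: "t = 2 * m + 1" by (rule oddE)
    define j where "j = nat (m + 1)"
    have j: "t = 2 * int j - 1" "1 \<le> j" "j < i" using m t by (auto simp: j_def)
    have "rise a 1 u \<ge> ?h" if "t \<le> u" "u \<le> 2 * int i - 1" for u
    proof -
      have "u = t \<or> u = 2 * int i - 1 \<or> (t < u \<and> u \<le> 2 * int i - 2)" using that by linarith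
      then show ?thesis using above[of u] eq by fastforce
    qed
    then have "(j, i) \<in> same_face n a" using j eq i by (auto simp: same_face_def min_def max_def)
    then show ?thesis using R j(3) by auto
  qed
qed

lemma closing_iff_greatest_in_face:
  assumes a: "dyck n a" and i: "i \<in> {1..n}"
  shows "a (2 * int i) = R \<longleftrightarrow> (\<forall>j>i. (i, j) \<notin> same_face n a)"
proof -
  let ?h = "rise a 1 (2 * int i - 1)"
  have step: "rise a 1 (2 * int i) = ?h + slope (a (2 * int i))"
    using rise_step[of "2 * int i - 1" a] i by simp
  show ?thesis
  proof (cases "a (2 * int i)")
    case R
    have "(i, j) \<notin> same_face n a" if "i < j" for j
    proof
      assume "(i, j) \<in> same_face n a"
      then have "rise a 1 (2 * int i) \<ge> ?h" using that by (auto simp: same_face_def)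
      then show False using step R by simp
    qed
    then show ?thesis using R by simp
  next
    case L
    \<comment> \<open>The mirror image: the next time with height at most \<open>?h\<close>, which
      exists because the path ends at height \<open>0\<close>.\<close>
    let ?T = "{t \<in> {2 * int i..2 * int n}. rise a 1 t \<le> ?h}"
    have h0: "?h \<ge> 0" using a i by (auto simp: dyck_def)
    have fin: "finite ?T" by (rule finite_subset[of _ "{2 * int i..2 * int n}"]) auto
    have mem: "2 * int n \<in> ?T" using h0 i a by (auto simp: dyck_def)
    define t where "t = Min ?T"
    have tT: "t \<in> ?T" unfolding t_def by (rule Min_in[OF fin]) (use mem in blast)
    have t: "2 * int i \<le> t" "t \<le> 2 * int n" "rise a 1 t \<le> ?h" using tT by auto
    have above: "rise a 1 u > ?h" if "2 * int i \<le> u" "u < t" for u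
    proof (rule ccontr)
      assume "\<not> ?thesis"
      then have "u \<in> ?T" using that t by auto
      then have "t \<le> u" unfolding t_def by (rule Min_le[OF fin])
      then show False using that by simp
    qed
    have "rise a 1 (2 * int i) = ?h + 1" using step L by simp
    then have "2 * int i < t" using t by (cases "t = 2 * int i") auto
    then have "rise a 1 (t - 1) > ?h" by (intro above) auto
    then have eq: "rise a 1 t = ?h" using t rise_step[of "t - 1" a] i by (cases "a t") auto
    have "odd t"
      using rise_parity[of t a] rise_parity[of "2 * int i - 1" a] eq t i by (auto simp: even_add)
    then obtain m where m: "t = 2 * m + 1" by (rule oddE)
    define j where "j = nat (m + 1)"
    have j: "t = 2 * int j - 1" "j \<le> n" "i < j" using m t i by (auto simp: j_def)
    have "rise a 1 u \<ge> ?h" if "2 * int i - 1 \<le> u" "u \<le> t" for u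
    proof -
      have "u = t \<or> u = 2 * int i - 1 \<or> (2 * int i \<le> u \<and> u < t)" using that by linarith
      then show ?thesis using above[of u] eq by fastforce
    qed
    then have "(i, j) \<in> same_face n a" using j eq i by (auto simp: same_face_def min_def max_def)
    then show ?thesis using L j(3) by auto
  qed
qed

lemma faces_inj:
  assumes "dyck n a" "dyck n b" "faces n a = faces n b" "k \<in> {1..2 * int n}"
  shows "a k = b k"
proof -
  have eq: "same_face n a = same_face n b"
    using same_face_iff[of _ _ n a] same_face_iff[of _ _ n b] assms(3) by (auto simp: set_eq_iff)
  have LR: "x = y" if "x = L \<longleftrightarrow> y = L" for x y using that by (cases x; cases y) auto
  have RR: "x = y" if "x = R \<longleftrightarrow> y = R" for x y using that by (cases x; cases y) auto
  show ?thesis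
  proof (cases "even k")
    case True
    then obtain m where m: "k = 2 * m" by blast
    have i: "nat m \<in> {1..n}" "k = 2 * int (nat m)" using m assms(4) by auto
    show ?thesis
      using closing_iff_greatest_in_face[OF assms(1) i(1)] closing_iff_greatest_in_face[OF assms(2) i(1)] eq
      unfolding i(2)[symmetric] by (intro RR) simp
  next
    case False
    then obtain m where m: "k = 2 * m + 1" by (rule oddE)
    have i: "nat (m + 1) \<in> {1..n}" "k = 2 * int (nat (m + 1)) - 1" using m assms(4) by auto
    show ?thesis
      using opening_iff_least_in_face[OF assms(1) i(1)] opening_iff_least_in_face[OF assms(2) i(1)] eq
      unfolding i(2)[symmetric] by (intro LR) simp
  qed
qed

definition word_of :: "side list \<Rightarrow> int \<Rightarrow> side" where
  "word_of xs k = xs ! nat (k - 1)"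

lemma rise_list: 
  assumes "\<And>k. k < length xs \<Longrightarrow> a (i + int k) = xs ! k" "m \<le> length xs"
  shows "rise a i (i + int m - 1) = (\<Sum>x\<leftarrow>take m xs. slope x)"
  using assms(2)
proof (induction m)
  case 0
  then show ?case by (simp add: rise_empty)
next
  case (Suc m)
  have "rise a i (i + int (Suc m) - 1) = rise a i (i + int m - 1) + slope (a (i + int m))"
    using rise_split[of i "i + int m - 1" "i + int m" a] by (simp add: algebra_simps)
  then show ?case using Suc assms(1)[of m] by (simp add: take_Suc_conv_app_nth)
qed

lemma all_le_Suc_iff: "(\<forall>m\<le>Suc n. P m) \<longleftrightarrow> P 0 \<and> (\<forall>m\<le>n. P (Suc m))"
  by (metis Suc_le_mono not0_implies_Suc zero_le)

lemma walk_neq_None_iff: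
  "walk k xs \<noteq> None \<longleftrightarrow> (\<forall>m\<le>length xs. int k + (\<Sum>x\<leftarrow>take m xs. slope x) \<ge> 0)"
proof (induction k xs rule: walk.induct)
  case (3 xs)
  have "\<not> (\<forall>m\<le>length (R # xs). int 0 + (\<Sum>x\<leftarrow>take m (R # xs). slope x) \<ge> 0)"
    by (auto simp: not_le intro!: exI[of _ 1])
  then show ?case by simp
next
  case (2 k xs)
  then show ?case by (simp add: all_le_Suc_iff algebra_simps)
next
  case (4 k xs)
  then show ?case by (simp add: all_le_Suc_iff algebra_simps)
qed simp

lemma walk_Some: "walk k xs = Some e \<Longrightarrow> int e = int k + (\<Sum>x\<leftarrow>xs. slope x)"
  by (induction k xs rule: walk.induct) auto

lemma dyck_word_of:
  assumes "length xs = 2 * n" "walk 0 xs = Some 0"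
  shows "dyck n (word_of xs)"
proof -
  have r: "rise (word_of xs) 1 (int m) = (\<Sum>x\<leftarrow>take m xs. slope x)" if "m \<le> 2 * n" for m
    using rise_list[of xs "word_of xs" 1 m] that assms(1) by (simp add: word_of_def)
  have "rise (word_of xs) 1 t \<ge> 0" if "0 \<le> t" "t \<le> 2 * int n" for t
    using r[of "nat t"] walk_neq_None_iff[of 0 xs] assms that by simp
  moreover have "rise (word_of xs) 1 (2 * int n) = 0"
    using r[of "2 * n"] walk_Some[OF assms(2)] assms(1) by simp
  ultimately show ?thesis by (simp add: dyck_def)
qed

lemma ballot_le_card_NC: "ballot (2 * n) 0 \<le> card (NC n)"
  unfolding ballot_def
proof (rule card_inj_on_le[of "\<lambda>xs. faces n (word_of xs)"])
  show "inj_on (\<lambda>xs. faces n (word_of xs)) {xs. length xs = 2 * n \<and> walk 0 xs = Some 0}"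
  proof (rule inj_onI)
    fix xs ys :: "side list"
    assume xs: "xs \<in> {xs. length xs = 2 * n \<and> walk 0 xs = Some 0}"
      and ys: "ys \<in> {xs. length xs = 2 * n \<and> walk 0 xs = Some 0}"
      and eq: "faces n (word_of xs) = faces n (word_of ys)"
    show "xs = ys"
    proof (rule nth_equalityI)
      fix k assume "k < length xs"
      then have "word_of xs (int k + 1) = word_of ys (int k + 1)"
        using xs ys by (intro faces_inj[OF dyck_word_of dyck_word_of eq]) auto
      then show "xs ! k = ys ! k" by (simp add: word_of_def)
    qed (use xs ys in simp)
  qed
qed (auto simp: faces_in_NC finite_NC)

lemma card_NC_lower_bound:
  assumes "n > 0"
  shows "4 ^ n \<le> 4 * real n ^ 2 * real (card (NC n))"
proof -
  have "4 ^ n \<le> 2 * real n * real (Suc n) * real (ballot (2 * n) 0)"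
    by (rule ballot_lower_bound[OF assms])
  \<comment> \<open>\<open>Suc n \<le> 2 * n\<close> turns the factor \<open>2 * n * Suc n\<close>
    into \<open>4 * n ^ 2\<close>.\<close>
  also have "\<dots> \<le> 2 * real n * (2 * real n) * real (card (NC n))"
    using ballot_le_card_NC[of n] assms by (intro mult_mono) auto
  finally show ?thesis by (simp add: power2_eq_square algebra_simps)
qed

subsection \<open>Arc systems and the infinite noodle\<close>

definition matched :: "(int \<Rightarrow> side) \<Rightarrow> bool" where
  "matched a \<longleftrightarrow> (\<forall>i. \<exists>j. (i, j) \<in> arc_rel a)"

definition arc_pairs :: "(int \<Rightarrow> side) \<Rightarrow> int set set" where
  "arc_pairs a = {{i, j} |i j. opens a i j}"

lemma arc_iff_arc_pairs: "(i, j) \<in> arc_rel a \<longleftrightarrow> i \<noteq> j \<and> {i, j} \<in> arc_pairs a"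
proof
  show "i \<noteq> j \<and> {i, j} \<in> arc_pairs a" if "(i, j) \<in> arc_rel a"
    using that unfolding arc_rel_def arc_pairs_def by (auto simp: insert_commute dest: opens_less)
  show "(i, j) \<in> arc_rel a" if "i \<noteq> j \<and> {i, j} \<in> arc_pairs a"
    using that unfolding arc_rel_def arc_pairs_def by (auto simp: doubleton_eq_iff)
qed

lemma is_arc_system_arc_pairs:
  assumes "matched a"
  shows "is_arc_system a (arc_pairs a)"
  unfolding is_arc_system_def
proof (intro conjI ballI)
  have pair: "\<exists>y. V = {x, y} \<and> (x, y) \<in> arc_rel a" if "V \<in> arc_pairs a" "x \<in> V" for V x
    using that unfolding arc_pairs_def arc_rel_def by (auto simp: insert_commute)
  have uniq: "V = W" if VW: "V \<in> arc_pairs a" "W \<in> arc_pairs a" "x \<in> V" "x \<in> W" for V W x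
  proof -
    obtain y where y: "V = {x, y}" "(x, y) \<in> arc_rel a" using pair[OF VW(1,3)] by blast
    obtain z where z: "W = {x, z}" "(x, z) \<in> arc_rel a" using pair[OF VW(2,4)] by blast
    show ?thesis using y z arc_unique by metis
  qed
  show "partition_on UNIV (arc_pairs a)"
  proof (rule partition_onI)
    show "\<Union> (arc_pairs a) = UNIV"
    proof (intro set_eqI iffI UNIV_I)
      fix x obtain y where "(x, y) \<in> arc_rel a" using assms by (auto simp: matched_def)
      then show "x \<in> \<Union> (arc_pairs a)" using arc_iff_arc_pairs by blast
    qed
    show "{} \<notin> arc_pairs a" by (auto simp: arc_pairs_def)
    show "disjnt V W" if "V \<in> arc_pairs a" "W \<in> arc_pairs a" "V \<noteq> W" for V W
      using uniq that by (auto simp: disjnt_iff)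
  qed
  show "card V = 2" if "V \<in> arc_pairs a" for V using that by (auto simp: arc_pairs_def dest: opens_less)
  show "i = Min V \<longleftrightarrow> a i = L" if V: "V \<in> arc_pairs a" "i \<in> V" for V i
  proof -
    obtain j k where jk: "V = {j, k}" "opens a j k" using V(1) unfolding arc_pairs_def by blast
    have "j < k" "a j = L" "a k = R" using jk(2) opens_less opens_left opens_right by blast+
    then show ?thesis using V(2) jk(1) by auto
  qed
  have False if "V \<in> arc_pairs a" "W \<in> arc_pairs a" "i < j" "j < k" "k < l" "i \<in> V" "k \<in> V" "j \<in> W" "l \<in> W"
    for V W i j k l
  proof -
    have "(i, k) \<in> arc_rel a" "(j, l) \<in> arc_rel a"
      using that arc_iff_arc_pairs unfolding arc_pairs_def by (auto simp: insert_commute; fastforce)+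
    then have "opens a i k" "opens a j l" using that by (auto simp: arc_rel_def dest: opens_less)
    then show False using opens_noncrossing that by fastforce
  qed
  then show "noncrossing (arc_pairs a)" unfolding noncrossing_def by blast
qed

text \<open>Between the two ends of a pair all points have their partners there as well, since the
  pairs do not cross. The pairing is thus nested and must agree with bracket matching.\<close>

lemma arc_if_arc_system:
  assumes P: "is_arc_system a P" and kl: "{p, q} \<in> P" "p \<noteq> q"
  shows "(p, q) \<in> arc_rel a"
proof -
  have part: "partition_on UNIV P" and two: "\<And>V. V \<in> P \<Longrightarrow> card V = 2" and nc: "noncrossing P"
    and min: "\<And>V i. V \<in> P \<Longrightarrow> i \<in> V \<Longrightarrow> i = Min V \<longleftrightarrow> a i = L"
    using P by (auto simp: is_arc_system_def)
  have uniq: "V = W" if "V \<in> P" "W \<in> P" "x \<in> V" "x \<in> W" for V W x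
    using partition_onD2[OF part] that by (auto simp: disjoint_def)
  have no: "\<not> (V \<in> P \<and> W \<in> P \<and> V \<noteq> W \<and> w < x \<and> x < y \<and> y < z \<and> w \<in> V \<and> y \<in> V \<and> x \<in> W \<and> z \<in> W)"
    for V W w x y z using nc unfolding noncrossing_def by blast
  define S where "S = {(i, j). i \<noteq> j \<and> {i, j} \<in> P}"
  have main: "opens a i j" if ij: "(i, j) \<in> S" "i < j" for i j
  proof (rule opens_if_nested_pairing[OF ij])
    show "sym S" by (auto simp: S_def sym_def insert_commute)
    show "l = l'" if "(k, l) \<in> S" "(k, l') \<in> S" for k l l'
    proof -
      have "{k, l} = {k, l'}" using that uniq[of "{k, l}" "{k, l'}" k] by (auto simp: S_def)
      then show ?thesis by (auto simp: doubleton_eq_iff)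
    qed
    show "k \<noteq> l \<and> (a k = L \<longleftrightarrow> k < l)" if "(k, l) \<in> S" for k l
      using that min[of "{k, l}" k] by (auto simp: S_def min_def split: if_splits)
    show "\<exists>l. (k, l) \<in> S \<and> i < l \<and> l < j" if k: "i < k" "k < j" for k
    proof -
      have V: "{i, j} \<in> P" using ij by (auto simp: S_def)
      obtain W where W: "W \<in> P" "k \<in> W" using partition_onD1[OF part] by blast
      obtain x y where "W = {x, y}" "x \<noteq> y" using two[OF W(1)] by (auto simp: card_2_iff)
      then obtain l where l: "W = {k, l}" "k \<noteq> l" using W(2) by auto
      have ne: "W \<noteq> {i, j}" using W(2) k by auto
      then have "l \<noteq> i" "l \<noteq> j" using uniq[OF W(1) V] l(1) by auto
      moreover have "\<not> l < i" using no[of W "{i, j}" l i k j] W V ne l k by auto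
      moreover have "\<not> j < l" using no[of "{i, j}" W i k j l] W V ne l k by auto
      ultimately show ?thesis using l W(1) by (intro exI[of _ l]) (auto simp: S_def)
    qed
  qed
  show ?thesis
    using main[of p q] main[of q p] kl unfolding arc_rel_def S_def by (cases "p < q") (auto simp: insert_commute)
qed

lemma arc_system_unique:
  assumes "is_arc_system a P"
  shows "P = arc_pairs a \<and> matched a"
proof -
  have part: "partition_on UNIV P" and two: "\<And>V. V \<in> P \<Longrightarrow> card V = 2"
    using assms by (auto simp: is_arc_system_def)
  have block: "\<exists>l. {k, l} \<in> P \<and> k \<noteq> l" for k
  proof -
    obtain W where W: "W \<in> P" "k \<in> W" using partition_onD1[OF part] by blast
    obtain x y where "W = {x, y}" "x \<noteq> y" using two[OF W(1)] by (auto simp: card_2_iff)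
    then show ?thesis using W by (auto simp: insert_commute)
  qed
  have "matched a" unfolding matched_def using block arc_if_arc_system[OF assms] by blast
  moreover have "P \<subseteq> arc_pairs a"
  proof
    fix W assume W: "W \<in> P"
    obtain x y where xy: "W = {x, y}" "x \<noteq> y" using two[OF W] by (auto simp: card_2_iff)
    then show "W \<in> arc_pairs a" using arc_if_arc_system[OF assms, of x y] W arc_iff_arc_pairs by blast
  qed
  moreover have "arc_pairs a \<subseteq> P"
  proof
    fix W assume "W \<in> arc_pairs a"
    then obtain x y where xy: "W = {x, y}" "(x, y) \<in> arc_rel a" by (auto simp: arc_pairs_def arc_rel_def)
    obtain z where "{x, z} \<in> P" "x \<noteq> z" using block by blast
    then show "W \<in> P" using arc_if_arc_system[OF assms, of x z] arc_unique[OF xy(2)] xy(1) by blast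
  qed
  ultimately show ?thesis by blast
qed

text \<open>An arc system exists exactly if every letter has a partner, and is then given by bracket
  matching. Existence thus implies uniqueness, and the case distinction in \<open>arcs\<close>
  becomes the explicit condition \<open>matched\<close>.\<close>

lemma arcs_eq: "arcs a = (if matched a then arc_pairs a else {})"
proof (cases "matched a")
  case True
  note ex = is_arc_system_arc_pairs[OF True]
  have eq: "P = arc_pairs a" if "is_arc_system a P" for P using arc_system_unique[OF that] by simp
  have "\<exists>!P. is_arc_system a P" using ex eq by (rule ex1I)
  moreover have "(THE P. is_arc_system a P) = arc_pairs a" using ex eq by (rule the_equality)
  ultimately show ?thesis using True by (simp add: arcs_def)
next
  case False
  then have "\<not> is_arc_system a P" for P using arc_system_unique[of a P] by auto
  then have "\<not> (\<exists>!P. is_arc_system a P)" by auto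
  then show ?thesis using False by (simp add: arcs_def)
qed

text \<open>The constant word \<open>L\<close> has no arcs; it stands in for the words without an arc system.\<close>

definition matched_part :: "(int \<Rightarrow> side) \<Rightarrow> int \<Rightarrow> side" where
  "matched_part a = (if matched a then a else (\<lambda>_. L))"

lemma arc_constant: "arc_rel (\<lambda>_. L) = {}"
  by (auto simp: arc_rel_def dest: opens_right)

lemma noodle_eq: "noodle a b = arc_rel (matched_part a) \<union> arc_rel (matched_part b)"
proof -
  have "{(i, j). i \<noteq> j \<and> {i, j} \<in> arcs a} = arc_rel (matched_part a)" for a
  proof (cases "matched a")
    case True
    then show ?thesis by (simp add: arcs_eq matched_part_def set_eq_iff arc_iff_arc_pairs)
  next
    case False
    then show ?thesis by (simp add: arcs_eq matched_part_def arc_constant)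
  qed
  then show ?thesis unfolding noodle_def by blast
qed

section \<open>Exhausting a component by truncated balls\<close>

lemma steps_ball_mono:
  assumes "E \<subseteq> F" "m \<le> m'"
  shows "steps_ball E m i \<subseteq> steps_ball F m' i"
proof -
  have "E ^^ t \<subseteq> F ^^ t" for t by (induction t) (use assms(1) in auto)
  then show ?thesis unfolding steps_ball_def using assms(2) by (auto intro: le_trans)
qed

lemma Union_steps_ball_edges: "(\<Union>K. steps_ball (edges K a b) K i) = (arc_rel a \<union> arc_rel b)\<^sup>* `` {i}"
proof
  have "edges K a b \<subseteq> arc_rel a \<union> arc_rel b" for K by (auto simp: edges_def)
  then have "steps_ball (edges K a b) K i \<subseteq> (arc_rel a \<union> arc_rel b)\<^sup>* `` {i}" for K
    by (rule order.trans[OF steps_ball_mono[OF _ order.refl] steps_ball_subset])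
  then show "(\<Union>K. steps_ball (edges K a b) K i) \<subseteq> (arc_rel a \<union> arc_rel b)\<^sup>* `` {i}" by blast
next
  have "\<exists>K. j \<in> steps_ball (edges K a b) K i" if "(i, j) \<in> (arc_rel a \<union> arc_rel b)\<^sup>*" for j using that
  proof (induction rule: rtrancl_induct)
    case base
    show ?case using start_in_steps_ball[of i "edges 0 a b" 0] by blast
  next
    case (step j k)
    then obtain K where K: "j \<in> steps_ball (edges K a b) K i" by blast
    \<comment> \<open>Large enough for the next arc to survive the cutoff, and increased by one so
      that radius \<open>K' - 1\<close> still reaches \<open>j\<close> and a last step remains for
      \<open>k\<close>.\<close>
    define K' where "K' = Suc (max K (nat \<bar>j - k\<bar>))"
    have "edges K a b \<subseteq> edges K' a b" by (auto simp: edges_def K'_def)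
    then have "j \<in> steps_ball (edges K' a b) (K' - 1) i"
      using subsetD[OF steps_ball_mono[of "edges K a b" "edges K' a b" K "K' - 1" i] K] by (simp add: K'_def)
    moreover have "(j, k) \<in> edges K' a b" using step(2) by (auto simp: edges_def K'_def)
    ultimately have "k \<in> steps_ball (edges K' a b) (Suc (K' - 1)) i" unfolding steps_ball_Suc by blast
    then show ?case by (auto simp: K'_def)
  qed
  then show "(arc_rel a \<union> arc_rel b)\<^sup>* `` {i} \<subseteq> (\<Union>K. steps_ball (edges K a b) K i)" by blast
qed

lemma incseq_steps_ball_edges: "incseq (\<lambda>K. steps_ball (edges K a b) K i)"
proof (rule incseq_SucI)
  fix K
  have "edges K a b \<subseteq> edges (Suc K) a b" by (auto simp: edges_def)
  then show "steps_ball (edges K a b) K i \<subseteq> steps_ball (edges (Suc K) a b) (Suc K) i"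
    by (rule steps_ball_mono) simp
qed

lemma finite_subset_incseq_Union:
  assumes "incseq B" "finite F" "F \<subseteq> (\<Union>n. B n)"
  shows "\<exists>N. \<forall>n\<ge>N. F \<subseteq> B n"
  using assms(2,3)
proof (induction F rule: finite_induct)
  case (insert x F)
  then obtain N M where N: "\<forall>n\<ge>N. F \<subseteq> B n" and M: "x \<in> B M" by auto
  have "insert x F \<subseteq> B n" if "n \<ge> max N M" for n using N M that incseqD[OF assms(1), of M n] by auto
  then show ?case by blast
qed simp

text \<open>Every finite subset of the union is eventually contained in \<open>B n\<close>; so an
  infinite union forces the sizes to infinity, and the limit obeys the convention for infinite
  components in \<open>kappa\<close>.\<close>

lemma tendsto_inverse_card_Union:
  fixes B :: "nat \<Rightarrow> 'a set"
  assumes "incseq B" "\<And>n. finite (B n)"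
  shows "(\<lambda>n. 1 / real (card (B n))) \<longlonglongrightarrow> (if finite (\<Union>n. B n) then 1 / real (card (\<Union>n. B n)) else 0)"
proof (cases "finite (\<Union>n. B n)")
  case True
  obtain N where "\<forall>n\<ge>N. (\<Union>n. B n) \<subseteq> B n" using finite_subset_incseq_Union[OF assms(1) True] by blast
  then have "\<forall>n\<ge>N. B n = (\<Union>n. B n)" by blast
  then have "eventually (\<lambda>n. 1 / real (card (B n)) = 1 / real (card (\<Union>n. B n))) sequentially"
    unfolding eventually_sequentially by metis
  then show ?thesis using True by (simp add: tendsto_eventually)
next
  case False
  have "filterlim (\<lambda>n. real (card (B n))) at_top sequentially" unfolding filterlim_at_top
  proof
    fix Z :: real
    obtain F where F: "F \<subseteq> (\<Union>n. B n)" "finite F" "card F = nat \<lceil>Z\<rceil>"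
      using infinite_arbitrarily_large[OF False] by blast
    obtain N where N: "\<forall>n\<ge>N. F \<subseteq> B n" using finite_subset_incseq_Union[OF assms(1) F(2,1)] by blast
    have "Z \<le> real (card (B n))" if "n \<ge> N" for n
    proof -
      have "card F \<le> card (B n)" using N that by (intro card_mono assms(2)) auto
      then show ?thesis using F(3) by linarith
    qed
    then show "eventually (\<lambda>n. Z \<le> real (card (B n))) sequentially"
      unfolding eventually_sequentially by blast
  qed
  then have "(\<lambda>n. inverse (real (card (B n)))) \<longlonglongrightarrow> 0" by (rule tendsto_inverse_0_at_top)
  then show ?thesis using False by (simp add: inverse_eq_divide)
qed

lemma ball_weight_tendsto:
  "(\<lambda>K. ball_weight K a b 0) \<longlonglongrightarrow>
    (if finite ((arc_rel a \<union> arc_rel b)\<^sup>* `` {0}) then 1 / real (card ((arc_rel a \<union> arc_rel b)\<^sup>* `` {0})) else 0)"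
  using tendsto_inverse_card_Union[OF incseq_steps_ball_edges finite_steps_ball[OF finite_edges_image], of a b 0]
  unfolding ball_weight_def Union_steps_ball_edges .

section \<open>Shift covariance and locality\<close>

lemma rise_shift: "rise (\<lambda>k. a (k + c)) i j = rise a (i + c) (j + c)"
  unfolding rise_def by (rule sum.reindex_bij_witness[of _ "\<lambda>k. k - c" "\<lambda>k. k + c"]) auto

lemma opens_shift: "opens (\<lambda>k. a (k + c)) i j \<longleftrightarrow> opens a (i + c) (j + c)"
proof -
  have *: "(\<forall>t\<in>{i..<j}. P (t + c)) \<longleftrightarrow> (\<forall>t\<in>{i + c..<j + c}. P t)" for P :: "int \<Rightarrow> bool"
  proof safe
    fix t assume *: "\<forall>t\<in>{i..<j}. P (t + c)" "t \<in> {i + c..<j + c}"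
    then have "P (t - c + c)" by (intro bspec[OF *(1)]) auto
    then show "P t" by simp
  qed auto
  show ?thesis using *[of "\<lambda>t. rise a (i + c) t > 0"] by (simp add: opens_def rise_shift)
qed

lemma arc_shift: "(i, j) \<in> arc_rel (\<lambda>k. a (k + c)) \<longleftrightarrow> (i + c, j + c) \<in> arc_rel a"
  by (simp add: arc_rel_def opens_shift)

lemma steps_ball_shift:
  "j \<in> steps_ball (edges K (\<lambda>k. a (k + c)) (\<lambda>k. b (k + c))) m i \<longleftrightarrow> j + c \<in> steps_ball (edges K a b) m (i + c)"
proof (induction m arbitrary: j)
  case 0
  then show ?case by (simp add: steps_ball_0)
next
  case (Suc m)
  let ?E = "edges K a b" and ?F = "edges K (\<lambda>k. a (k + c)) (\<lambda>k. b (k + c))"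
  have e: "(p, q) \<in> ?F \<longleftrightarrow> (p + c, q + c) \<in> ?E" for p q by (simp add: edges_def arc_shift)
  have "(\<exists>p. p \<in> steps_ball ?F m i \<and> (p, j) \<in> ?F) \<longleftrightarrow> (\<exists>p. p + c \<in> steps_ball ?E m (i + c) \<and> (p + c, j + c) \<in> ?E)"
    by (simp add: Suc e)
  also have "\<dots> \<longleftrightarrow> (\<exists>p. p \<in> steps_ball ?E m (i + c) \<and> (p, j + c) \<in> ?E)" by (metis diff_add_cancel)
  finally show ?case using Suc by (auto simp: steps_ball_Suc Image_iff Bex_def)
qed

lemma ball_weight_shift: "ball_weight K (\<lambda>k. a (k + c)) (\<lambda>k. b (k + c)) 0 = ball_weight K a b c"
proof -
  have "steps_ball (edges K a b) K c = (\<lambda>j. j + c) ` steps_ball (edges K (\<lambda>k. a (k + c)) (\<lambda>k. b (k + c))) K 0"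
    using steps_ball_shift[of _ K a c b K 0] by (auto simp: image_iff) (metis diff_add_cancel)
  then show ?thesis by (simp add: ball_weight_def card_image)
qed

lemma long_arc_shift: "long_arc K (\<lambda>k. a (k + c)) 0 = long_arc K a c"
proof -
  have "(\<exists>j. (c, j + c) \<in> arc_rel a \<and> \<bar>j\<bar> \<le> int K) \<longleftrightarrow> (\<exists>j. (c, j) \<in> arc_rel a \<and> \<bar>c - j\<bar> \<le> int K)" (is "?l = ?r")
  proof
    assume ?l then show ?r by force
  next
    assume ?r
    then obtain j where "(c, j) \<in> arc_rel a" "\<bar>c - j\<bar> \<le> int K" by blast
    then show ?l by (intro exI[of _ "j - c"]) auto
  qed
  then show ?thesis by (simp add: long_arc_def arc_shift)
qed

lemma edges_cong:
  assumes "\<And>k. \<bar>k - p\<bar> \<le> int K \<Longrightarrow> a k = a' k \<and> b k = b' k"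
  shows "(p, q) \<in> edges K a b \<longleftrightarrow> (p, q) \<in> edges K a' b'"
proof (cases "\<bar>p - q\<bar> \<le> int K")
  case True
  then have "opens a p q = opens a' p q" "opens a q p = opens a' q p"
    "opens b p q = opens b' p q" "opens b q p = opens b' q p" using assms by (intro opens_cong; force)+
  then show ?thesis by (simp add: edges_def arc_rel_def)
qed (simp add: edges_def)

text \<open>A point reached in \<open>m\<close> steps is at most \<open>K * m\<close> away, and its
  edges are decided by the letters within a further \<open>K\<close>. The distance bound is part of
  the conclusion because the induction relies on it.\<close>

lemma steps_ball_local:
  assumes "\<And>k. \<bar>k - i\<bar> \<le> int (K * M) \<Longrightarrow> a k = a' k \<and> b k = b' k" "m \<le> M"
  shows "steps_ball (edges K a b) m i = steps_ball (edges K a' b') m i \<and>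
    (\<forall>j\<in>steps_ball (edges K a b) m i. \<bar>j - i\<bar> \<le> int (K * m))" using assms(2)
proof (induction m)
  case 0
  then show ?case by (simp add: steps_ball_0)
next
  case (Suc m)
  have KM: "int (K * m) + int K \<le> int (K * M)"
    using Suc.prems mult_le_mono2[of "Suc m" M K] by (simp add: algebra_simps flip: of_nat_add of_nat_mult)
  have IH: "steps_ball (edges K a b) m i = steps_ball (edges K a' b') m i"
      "\<And>j. j \<in> steps_ball (edges K a b) m i \<Longrightarrow> \<bar>j - i\<bar> \<le> int (K * m)" using Suc by auto
  have "(p, q) \<in> edges K a b \<longleftrightarrow> (p, q) \<in> edges K a' b'" if "p \<in> steps_ball (edges K a b) m i" for p q
    by (rule edges_cong) (use IH(2)[OF that] KM assms(1) in auto)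
  then have "edges K a b `` steps_ball (edges K a b) m i = edges K a' b' `` steps_ball (edges K a b) m i"
    by blast
  moreover have "\<bar>q - i\<bar> \<le> int (K * Suc m)" if "p \<in> steps_ball (edges K a b) m i" "(p, q) \<in> edges K a b" for p q
    using IH(2)[OF that(1)] that(2) by (auto simp: edges_def)
  moreover have "int (K * m) \<le> int (K * Suc m)" by simp
  ultimately show ?case using IH unfolding steps_ball_Suc by (smt (verit) ImageE UnE)
qed

lemma ball_weight_local:
  assumes "\<And>k. \<bar>k - i\<bar> \<le> int (K * K) \<Longrightarrow> a k = a' k \<and> b k = b' k"
  shows "ball_weight K a b i = ball_weight K a' b' i"
  using steps_ball_local[where i = i and K = K and M = K and m = K and a = a and a' = a' and b = b and b' = b'] assms
  by (simp add: ball_weight_def)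

lemma long_arc_local:
  assumes "\<And>k. \<bar>k - i\<bar> \<le> int K \<Longrightarrow> a k = a' k"
  shows "long_arc K a i = long_arc K a' i"
proof -
  have "(i, j) \<in> edges K a a \<longleftrightarrow> (i, j) \<in> edges K a' a'" for j by (rule edges_cong) (use assms in auto)
  then show ?thesis by (auto simp: long_arc_def edges_def)
qed

lemma ball_weight_bounds: "0 \<le> ball_weight K a b i" "ball_weight K a b i \<le> 1"
  by (auto simp: ball_weight_def divide_le_eq)

subsection \<open>Concentration of local averages\<close>

abbreviation side_measure :: "side measure" where
  "side_measure \<equiv> measure_pmf (pmf_of_set {L, R})"

abbreviation side_PiM :: "'i set \<Rightarrow> ('i \<Rightarrow> side) measure" where
  "side_PiM I \<equiv> (\<Pi>\<^sub>M i\<in>I. side_measure)"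

text \<open>Both words form a single family of coordinates, so that a window of the pair is a set of
  independent letters and shifting moves both words at once.\<close>

definition coins :: "(bool \<times> int \<Rightarrow> side) measure" where
  "coins = (\<Pi>\<^sub>M i\<in>(UNIV :: (bool \<times> int) set). side_measure)"

definition coin_words :: "(bool \<times> int \<Rightarrow> side) \<Rightarrow> (int \<Rightarrow> side) \<times> (int \<Rightarrow> side)" where
  "coin_words x = ((\<lambda>i. x (False, i)), (\<lambda>i. x (True, i)))"

lemma prob_space_side_PiM: "prob_space (side_PiM I)"
  by (rule prob_space_PiM) (rule prob_space_measure_pmf)

lemma space_side_PiM_UNIV [simp]: "space (side_PiM UNIV) = UNIV"
  by (simp add: space_PiM PiE_UNIV_domain)

lemma space_coins [simp]: "space coins = UNIV"
  by (simp add: coins_def)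

lemma space_side_sequences [simp]: "space side_sequences = UNIV"
  by (simp add: side_sequences_def)

text \<open>Splitting by the value of one letter and fixing it leaves a condition on fewer letters,
  so the event is a finite Boolean combination of coordinate events. Measurability of everything
  local comes from here.\<close>

lemma sets_finite_dependence:
  fixes Q :: "('i \<Rightarrow> side) \<Rightarrow> bool"
  assumes "finite J" "J \<subseteq> K" "\<And>x y. (\<And>j. j \<in> J \<Longrightarrow> x j = y j) \<Longrightarrow> Q x = Q y"
  shows "{x \<in> space (side_PiM K). Q x} \<in> sets (side_PiM K)"
  using assms
proof (induction J arbitrary: Q rule: finite_induct)
  case empty
  then have "Q x = Q y" for x y by blast
  then have "{x \<in> space (side_PiM K). Q x} = {} \<or>
      {x \<in> space (side_PiM K). Q x} = space (side_PiM K)" by blast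
  then show ?case by (elim disjE) (simp_all only: sets.empty_sets sets.top)
next
  case (insert j J)
  let ?M = "\<Pi>\<^sub>M i\<in>K. side_measure"
  have IH: "{x \<in> space ?M. Q (x(j := s))} \<in> sets ?M" for s
  proof (rule insert.IH)
    fix x y :: "'i \<Rightarrow> side" assume "\<And>k. k \<in> J \<Longrightarrow> x k = y k"
    then show "Q (x(j := s)) = Q (y(j := s))" by (intro insert.prems(2)) auto
  qed (use insert.prems in auto)
  have coord: "{x \<in> space ?M. x j = s} \<in> sets ?M" for s
  proof -
    have "(\<lambda>x. x j) \<in> measurable ?M side_measure"
      using insert.prems(1) by (intro measurable_component_singleton) auto
    from measurable_sets[OF this, of "{s}"] show ?thesis by (simp add: vimage_def Int_def conj_commute)
  qed
  have Q: "Q x \<longleftrightarrow> (x j = L \<and> Q (x(j := L))) \<or> (x j = R \<and> Q (x(j := R)))" for x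
    by (cases "x j") (metis fun_upd_triv side.distinct(1))+
  have "{x \<in> space ?M. Q x} =
      ({x \<in> space ?M. x j = L} \<inter> {x \<in> space ?M. Q (x(j := L))}) \<union>
      ({x \<in> space ?M. x j = R} \<inter> {x \<in> space ?M. Q (x(j := R))})" using Q by blast
  then show ?case using IH coord by (simp only: sets.Un sets.Int)
qed

lemma measurable_finite_dependence:
  fixes F :: "('i \<Rightarrow> side) \<Rightarrow> real"
  assumes "finite J" "J \<subseteq> K" "\<And>x y. (\<And>j. j \<in> J \<Longrightarrow> x j = y j) \<Longrightarrow> F x = F y"
  shows "F \<in> borel_measurable (side_PiM K)"
proof (rule measurableI)
  fix A :: "real set" assume "A \<in> sets borel"
  have "{x \<in> space (side_PiM K). F x \<in> A} \<in> sets (side_PiM K)"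
    by (rule sets_finite_dependence[OF assms(1,2)]) (use assms(3) in metis)
  then show "F -` A \<inter> space (side_PiM K) \<in> sets (side_PiM K)"
    by (simp add: vimage_def Int_def conj_commute)
qed simp

lemma measure_cylinder:
  fixes v :: "'i \<Rightarrow> side"
  assumes "finite J"
  shows "measure (side_PiM UNIV) {x. \<forall>j\<in>J. x j = v j} = (1 / 2) ^ card J"
proof -
  interpret product_prob_space "\<lambda>_::'i. side_measure" UNIV by unfold_locales
  have half: "emeasure side_measure {s} = ennreal (1 / 2)" for s
    by (cases s) (simp_all add: emeasure_pmf_single)
  have "emeasure (side_PiM UNIV) {x \<in> space (side_PiM UNIV). \<forall>j\<in>J. x j \<in> {v j}} =
      (\<Prod>j\<in>J. emeasure side_measure {v j})" by (rule emeasure_PiM_Collect) (use assms in auto)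
  then have "emeasure (side_PiM UNIV) {x. \<forall>j\<in>J. x j = v j} = ennreal ((1 / 2) ^ card J)"
    by (simp only: half prod_constant ennreal_power) (simp add: ennreal_power)
  then show ?thesis by (simp add: measure_def)
qed

lemma indep_coordinates:
  "prob_space.indep_vars (side_PiM (UNIV :: 'i set)) (\<lambda>_. side_measure) (\<lambda>i x. x i) UNIV"
proof -
  interpret prob_space "\<Pi>\<^sub>M i\<in>(UNIV :: 'i set). side_measure" by (rule prob_space_side_PiM)
  have "distr (side_PiM (UNIV :: 'i set)) side_measure (\<lambda>x. x i) = side_measure" for i
    by (rule distr_PiM_component) (auto intro: prob_space_measure_pmf)
  then have "distr (side_PiM (UNIV :: 'i set)) (side_PiM (UNIV :: 'i set)) (\<lambda>x. \<lambda>i\<in>UNIV. x i) =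
    (\<Pi>\<^sub>M i\<in>(UNIV :: 'i set). distr (side_PiM (UNIV :: 'i set)) side_measure (\<lambda>x. x i))"
    by (simp add: restrict_UNIV)
  then show ?thesis by (subst indep_vars_iff_distr_eq_PiM') auto
qed

lemma distr_reindex_side_PiM:
  fixes f :: "'i \<Rightarrow> 'j"
  assumes "inj f"
  shows "distr (side_PiM UNIV) (side_PiM UNIV) (\<lambda>x i. x (f i)) = (side_PiM UNIV)"
  using distr_PiM_reindex[of UNIV "\<lambda>_::'j. side_measure" f UNIV] assms
  by (simp add: restrict_UNIV prob_space_measure_pmf)

lemma measurable_reindex_side_PiM:
  fixes f :: "'i \<Rightarrow> 'j"
  assumes "range f \<subseteq> K"
  shows "(\<lambda>x i. x (f i)) \<in> measurable (side_PiM K) (side_PiM UNIV)"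
proof (rule measurable_PiM_single')
  show "(\<lambda>x. x (f i)) \<in> measurable (side_PiM K) side_measure" for i
    using assms by (intro measurable_component_singleton) auto
qed simp

definition coin_shift :: "int \<Rightarrow> (bool \<times> int \<Rightarrow> side) \<Rightarrow> bool \<times> int \<Rightarrow> side" where
  "coin_shift c x = (\<lambda>j. x (fst j, snd j + c))"

lemma measurable_coin_shift: "coin_shift c \<in> measurable coins coins"
  unfolding coins_def coin_shift_def[abs_def] by (rule measurable_reindex_side_PiM) simp

lemma distr_coin_shift: "distr coins coins (coin_shift c) = coins"
  unfolding coins_def coin_shift_def[abs_def] by (rule distr_reindex_side_PiM) (auto simp: inj_def)

lemma measurable_coin_words: "coin_words \<in> measurable coins (side_sequences \<Otimes>\<^sub>M side_sequences)"
  unfolding coin_words_def[abs_def] coins_def side_sequences_def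
  by (intro measurable_Pair measurable_reindex_side_PiM) simp_all

text \<open>The two words are read from disjoint sets of coordinates and hence independent. This
  carries the expectation in \<open>kappa\<close> over to \<open>coins\<close>.\<close>

lemma distr_coin_words: "distr coins (side_sequences \<Otimes>\<^sub>M side_sequences) coin_words = side_sequences \<Otimes>\<^sub>M side_sequences"
proof -
  interpret prob_space coins unfolding coins_def by (rule prob_space_side_PiM)
  let ?A = "range (Pair False) :: (bool \<times> int) set" and ?B = "range (Pair True) :: (bool \<times> int) set"
  have "indep_var (side_PiM ?A) (\<lambda>x. restrict (\<lambda>i. x i) ?A) (side_PiM ?B) (\<lambda>x. restrict (\<lambda>i. x i) ?B)"
    by (rule indep_var_restrict[OF indep_coordinates[where 'i = "bool \<times> int", folded coins_def]]) auto
  then have "indep_var side_sequences ((\<lambda>y i. y (False, i)) \<circ> (\<lambda>x. restrict (\<lambda>i. x i) ?A))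
      side_sequences ((\<lambda>y i. y (True, i)) \<circ> (\<lambda>x. restrict (\<lambda>i. x i) ?B))" unfolding side_sequences_def
    by (rule indep_var_compose) (rule measurable_reindex_side_PiM, simp)+
  then have "indep_var side_sequences (\<lambda>x i. x (False, i)) side_sequences (\<lambda>x i. x (True, i))"
    by (simp add: comp_def)
  moreover have "distr coins side_sequences (\<lambda>x i. x (b, i)) = side_sequences" for b
    unfolding coins_def side_sequences_def by (rule distr_reindex_side_PiM) (auto simp: inj_def)
  ultimately show ?thesis unfolding indep_var_distribution_eq coin_words_def[abs_def] by simp
qed

text \<open>Hoeffding's inequality is applied separately to each residue class modulo \<open>2r + 1\<close>, in which the
  windows of radius \<open>r\<close> are disjoint and the summands hence independent.\<close>

lemma local_average_deviation:
  fixes F :: "(bool \<times> int \<Rightarrow> side) \<Rightarrow> real" and r N :: nat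
  assumes dep: "\<And>x y. (\<And>b i. \<bar>i\<bar> \<le> int r \<Longrightarrow> x (b, i) = y (b, i)) \<Longrightarrow> F x = F y"
    and F01: "\<And>x. 0 \<le> F x" "\<And>x. F x \<le> 1" and "\<delta> > 0" and "N > 0"
  defines "D \<equiv> 2 * real r + 1"
  shows "measure coins {x. \<bar>(\<Sum>i\<in>{1..int N}. F (coin_shift i x)) - real N * (\<integral>x. F x \<partial>coins)\<bar> \<ge> \<delta> * real N}
    \<le> 2 * D * exp (- (2 * \<delta>\<^sup>2 / D\<^sup>2) * real N)"
proof -
  interpret prob_space coins unfolding coins_def by (rule prob_space_side_PiM)
  let ?\<mu> = "\<integral>x. F x \<partial>coins"
  define X where "X i x = F (coin_shift i x)" for i x
  define W where "W i = (UNIV :: bool set) \<times> {i - int r..i + int r}" for i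
  have finW: "finite (W i)" for i by (simp add: W_def)
  have Xdep: "X i x = X i y" if "\<And>j. j \<in> W i \<Longrightarrow> x j = y j" for i x y unfolding X_def
  proof (rule dep)
    fix b k assume "\<bar>k\<bar> \<le> int r"
    then show "coin_shift i x (b, k) = coin_shift i y (b, k)"
      using that[of "(b, k + i)"] by (auto simp: coin_shift_def W_def abs_le_iff)
  qed
  have Fm: "F \<in> borel_measurable coins" unfolding coins_def
    by (rule measurable_finite_dependence[of "UNIV \<times> {- int r..int r}"]) (auto intro!: dep simp: abs_le_iff)
  have Xm: "X i \<in> borel_measurable coins" for i
    unfolding coins_def by (rule measurable_finite_dependence[OF finW subset_UNIV Xdep])
  have EX: "expectation (X i) = ?\<mu>" for i
  proof -
    have "?\<mu> = (\<integral>x. F x \<partial>distr coins coins (coin_shift i))" by (simp only: distr_coin_shift)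
    also have "\<dots> = expectation (X i)"
      unfolding X_def[abs_def] by (rule integral_distr[OF measurable_coin_shift Fm])
    finally show ?thesis by simp
  qed
  define I where "I s = {i \<in> {1..int N}. i mod (2 * int r + 1) = s}" for s
  have finI: "finite (I s)" for s by (rule finite_subset[of _ "{1..int N}"]) (auto simp: I_def)
  have cardI: "card (I s) \<le> N" for s
  proof -
    have "card (I s) \<le> card {1..int N}" by (rule card_mono) (auto simp: I_def)
    then show ?thesis by simp
  qed
  have disj: "disjoint_family_on W (I s)" for s unfolding disjoint_family_on_def
  proof (intro ballI impI)
    fix i j assume ij: "i \<in> I s" "j \<in> I s" "i \<noteq> j"
    then have "i mod (2 * int r + 1) = j mod (2 * int r + 1)" by (simp add: I_def)
    then have "(2 * int r + 1) dvd (i - j)" by (simp add: mod_eq_dvd_iff)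
    then have "2 * int r + 1 \<le> \<bar>i - j\<bar>" using ij(3) dvd_imp_le_int[of "i - j" "2 * int r + 1"] by simp
    then show "W i \<inter> W j = {}" by (auto simp: W_def)
  qed
  have indep: "indep_vars (\<lambda>_. borel) X (I s)" for s
  proof -
    have "indep_vars (\<lambda>i. \<Pi>\<^sub>M j\<in>W i. side_measure) (\<lambda>i x. restrict (\<lambda>j. x j) (W i)) (I s)"
      by (rule indep_vars_restrict[OF indep_coordinates[where 'i = "bool \<times> int", folded coins_def] _ disj]) simp
    then have "indep_vars (\<lambda>_. borel) (\<lambda>i x. X i (restrict (\<lambda>j. x j) (W i))) (I s)"
      by (rule indep_vars_compose2) (rule measurable_finite_dependence[OF finW subset_refl Xdep])
    moreover have "X i (restrict (\<lambda>j. x j) (W i)) = X i x" for i x by (rule Xdep) simp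
    ultimately show ?thesis by simp
  qed
  have D: "D \<ge> 1" by (simp add: D_def)
  \<comment> \<open>There are \<open>D\<close> residue classes, so a total deviation of
    \<open>\<delta> * N\<close> forces one class to deviate by its share
    \<open>\<delta> * N / D\<close>.\<close>
  define B where "B s = {x. \<bar>(\<Sum>i\<in>I s. X i x) - real (card (I s)) * ?\<mu>\<bar> \<ge> \<delta> * real N / D}" for s
  have dN: "\<delta> * real N / D > 0" using assms(4,5) D by simp
  have Bs: "B s \<in> events" for s
  proof -
    have "{x \<in> space coins. \<bar>(\<Sum>i\<in>I s. X i x) - real (card (I s)) * ?\<mu>\<bar> \<ge> \<delta> * real N / D} \<in> events"
      using Xm by measurable
    then show ?thesis by (simp add: B_def)
  qed
  have PB: "prob (B s) \<le> 2 * exp (- (2 * \<delta>\<^sup>2 / D\<^sup>2) * real N)" for s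
  proof (cases "I s = {}")
    case True
    then have "B s = {}" using dN by (auto simp: B_def)
    then show ?thesis by simp
  next
    case False
    interpret Hoeffding_ineq coins "I s" X "\<lambda>_. 0" "\<lambda>_. 1" "\<Sum>i\<in>I s. expectation (X i)"
      by unfold_locales (use finI indep F01 in \<open>auto simp: X_def\<close>)
    have c: "card (I s) > 0" using False finI by (simp add: card_gt_0_iff)
    have "prob (B s) \<le> 2 * exp (- 2 * (\<delta> * real N / D)\<^sup>2 / real (card (I s)))"
      using Hoeffding_ineq_abs_ge[of "\<delta> * real N / D"] dN c by (simp add: EX B_def)
    \<comment> \<open>Bounding the size of a class by \<open>N\<close> weakens the exponent but
      keeps it linear in \<open>N\<close>.\<close>
    also have "\<dots> \<le> 2 * exp (- 2 * (\<delta> * real N / D)\<^sup>2 / real N)"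
      using cardI[of s] c by (simp add: divide_left_mono)
    also have "- 2 * (\<delta> * real N / D)\<^sup>2 / real N = - (2 * \<delta>\<^sup>2 / D\<^sup>2) * real N"
      using assms(5) by (simp add: power2_eq_square field_simps)
    finally show ?thesis .
  qed
  let ?S = "{0..<2 * int r + 1}" and ?E = "{x. \<bar>(\<Sum>i\<in>{1..int N}. X i x) - real N * ?\<mu>\<bar> \<ge> \<delta> * real N}"
  have "?E \<subseteq> (\<Union>s\<in>?S. B s)"
  proof (rule subsetI, rule ccontr)
    fix x assume x: "x \<in> ?E" "x \<notin> (\<Union>s\<in>?S. B s)"
    have map: "(\<lambda>i. i mod (2 * int r + 1)) ` {1..int N} \<subseteq> ?S"
    proof (rule image_subsetI)
      fix i show "i mod (2 * int r + 1) \<in> ?S"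
        using pos_mod_bound[of "2 * int r + 1" i] pos_mod_sign[of "2 * int r + 1" i]
        unfolding atLeastLessThan_iff by linarith
    qed
    have "(\<Sum>i\<in>{1..int N}. X i x) = (\<Sum>s\<in>?S. \<Sum>i\<in>I s. X i x)"
      using sum.group[OF _ _ map, of "\<lambda>i. X i x"] by (simp add: I_def)
    moreover have "(\<Sum>i\<in>{1..int N}. ?\<mu>) = (\<Sum>s\<in>?S. \<Sum>i\<in>I s. ?\<mu>)"
      using sum.group[OF _ _ map, of "\<lambda>i. ?\<mu>"] by (simp add: I_def)
    ultimately have "(\<Sum>i\<in>{1..int N}. X i x) - real N * ?\<mu> = (\<Sum>s\<in>?S. (\<Sum>i\<in>I s. X i x) - real (card (I s)) * ?\<mu>)"
      by (simp add: sum_subtractf)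
    then have "\<bar>(\<Sum>i\<in>{1..int N}. X i x) - real N * ?\<mu>\<bar> \<le> (\<Sum>s\<in>?S. \<bar>(\<Sum>i\<in>I s. X i x) - real (card (I s)) * ?\<mu>\<bar>)"
      by (simp add: sum_abs)
    also have "\<dots> < (\<Sum>s\<in>?S. \<delta> * real N / D)"
      by (rule sum_strict_mono) (use x(2) in \<open>auto simp: B_def not_le\<close>)
    also have "\<dots> = \<delta> * real N" using D by (simp add: D_def)
    finally show False using x(1) by simp
  qed
  then have "prob ?E \<le> prob (\<Union>s\<in>?S. B s)"
    by (rule finite_measure_mono) (use Bs in auto)
  also have "\<dots> \<le> (\<Sum>s\<in>?S. prob (B s))" by (rule finite_measure_subadditive_finite) (use Bs in auto)
  also have "\<dots> \<le> (\<Sum>s\<in>?S. 2 * exp (- (2 * \<delta>\<^sup>2 / D\<^sup>2) * real N))" by (rule sum_mono) (rule PB)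
  also have "\<dots> = 2 * D * exp (- (2 * \<delta>\<^sup>2 / D\<^sup>2) * real N)" by (simp add: D_def)
  finally show ?thesis by (simp add: X_def)
qed

subsection \<open>Recurrence and the constant kappa\<close>

definition survival :: "nat \<Rightarrow> nat \<Rightarrow> real" where
  "survival N k = real (card {xs. length xs = N \<and> walk k xs \<noteq> None}) / 2 ^ N"

lemma survival_0: "survival 0 k = 1"
proof -
  have "{xs. length xs = 0 \<and> walk k xs \<noteq> None} = {[]}" by auto
  then show ?thesis by (simp add: survival_def)
qed

lemma survival_Suc:
  "survival (Suc N) k = (survival N (Suc k) + (case k of 0 \<Rightarrow> 0 | Suc k' \<Rightarrow> survival N k')) / 2"
  unfolding survival_def card_side_lists_Suc by (cases k) (simp_all add: field_simps)

lemma survival_nonneg: "survival N k \<ge> 0"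
  by (simp add: survival_def)

lemma survival_antimono_Suc: "survival (Suc N) k \<le> survival N k"
proof (induction N arbitrary: k)
  case 0
  show ?case by (cases k) (simp_all add: survival_Suc survival_0)
next
  case (Suc N)
  have "survival (Suc N) (Suc k) \<le> survival N (Suc k)" by (rule Suc)
  moreover have "(case k of 0 \<Rightarrow> 0 | Suc k' \<Rightarrow> survival (Suc N) k') \<le> (case k of 0 \<Rightarrow> 0 | Suc k' \<Rightarrow> survival N k')"
    using Suc by (auto split: nat.splits)
  ultimately show ?case unfolding survival_Suc[of "Suc N" k] survival_Suc[of N k] by simp
qed

text \<open>The limit is a bounded function on the half line, harmonic with value \<open>0\<close> at \<open>-1\<close>, hence linear
  and therefore zero.\<close>

lemma survival_tendsto_0: "(\<lambda>N. survival N 0) \<longlonglongrightarrow> 0"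
proof -
  have dec: "decseq (\<lambda>N. survival N k)" for k by (rule decseq_SucI) (rule survival_antimono_Suc)
  have "\<exists>l. (\<lambda>N. survival N k) \<longlonglongrightarrow> l" for k
  proof -
    have "\<forall>N. 0 \<le> survival N k" by (simp add: survival_nonneg)
    from decseq_convergent[OF dec this] show ?thesis by metis
  qed
  then obtain l where l: "\<And>k. (\<lambda>N. survival N k) \<longlonglongrightarrow> l k" by metis
  have le1: "l k \<le> 1" for k
  proof (rule LIMSEQ_le_const2[OF l])
    have "survival N k \<le> survival 0 k" for N using decseqD[OF dec, of 0 N] by simp
    then show "\<exists>N. \<forall>n\<ge>N. survival n k \<le> 1" by (auto simp: survival_0)
  qed
  have ge0: "l k \<ge> 0" for k by (rule LIMSEQ_le_const[OF l]) (use survival_nonneg in blast)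
  have harm: "l k = (l (Suc k) + (case k of 0 \<Rightarrow> 0 | Suc k' \<Rightarrow> l k')) / 2" for k
  proof (rule LIMSEQ_unique)
    show "(\<lambda>N. survival (Suc N) k) \<longlonglongrightarrow> l k" by (rule LIMSEQ_Suc[OF l])
    have "(\<lambda>N. case k of 0 \<Rightarrow> 0 | Suc k' \<Rightarrow> survival N k') \<longlonglongrightarrow> (case k of 0 \<Rightarrow> 0 | Suc k' \<Rightarrow> l k')"
      by (cases k) (simp_all add: l)
    then show "(\<lambda>N. survival (Suc N) k) \<longlonglongrightarrow> (l (Suc k) + (case k of 0 \<Rightarrow> 0 | Suc k' \<Rightarrow> l k')) / 2"
      unfolding survival_Suc by (intro tendsto_intros l) simp_all
  qed
  have lin: "l k = real (Suc k) * l 0 \<and> l (Suc k) = real (Suc (Suc k)) * l 0" for k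
  proof (induction k)
    case 0
    show ?case using harm[of 0] by simp
  next
    case (Suc k)
    have "l (Suc (Suc k)) = 2 * l (Suc k) - l k" using harm[of "Suc k"] by simp
    then show ?case using Suc by (simp add: algebra_simps)
  qed
  have "l 0 = 0"
  proof (rule ccontr)
    assume "l 0 \<noteq> 0"
    then have "l 0 > 0" using ge0[of 0] by simp
    then obtain k :: nat where "1 < real k * l 0" using reals_Archimedean3 by blast
    then have "1 < real (Suc k) * l 0" using \<open>l 0 > 0\<close> by (simp add: algebra_simps)
    then show False using lin[of k] le1[of k] by simp
  qed
  then show ?thesis using l[of 0] by simp
qed

lemma sets_side_sequences_dependence:
  assumes "finite J" "\<And>x y. (\<And>j. j \<in> J \<Longrightarrow> x j = y j) \<Longrightarrow> Q x = Q y"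
  shows "{x. Q x} \<in> sets side_sequences"
  using sets_finite_dependence[OF assms(1) subset_UNIV assms(2)] by (simp add: side_sequences_def)

text \<open>Letters at distinct positions form a uniformly distributed list. The positions are left
  general because walks are read both to the right and to the left of a point.\<close>

lemma measure_side_sequences_list:
  assumes "inj idx"
  shows "measure side_sequences {a. Q (map (\<lambda>k. a (idx k)) [0..<N])} =
    real (card {xs. length xs = N \<and> Q xs}) / 2 ^ N"
proof -
  interpret prob_space side_sequences unfolding side_sequences_def by (rule prob_space_side_PiM)
  let ?X = "{xs :: side list. length xs = N \<and> Q xs}"
  let ?w = "\<lambda>a. map (\<lambda>k. a (idx k)) [0..<N]"
  let ?C = "\<lambda>xs. {a. ?w a = xs}"
  have ev: "?C xs \<in> events" for xs
    by (rule sets_side_sequences_dependence[of "idx ` {..<N}"]) (auto cong: map_cong intro!: arg_cong[of _ _ "\<lambda>y. y = xs"])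
  have pC: "prob (?C xs) = 1 / 2 ^ N" if "length xs = N" for xs
  proof -
    have "?C xs = {a. \<forall>j\<in>idx ` {..<N}. a j = xs ! inv idx j}"
      using that assms by (auto simp: list_eq_iff_nth_eq)
    moreover have "card (idx ` {..<N}) = N"
      using assms by (subst card_image) (auto intro: inj_on_subset)
    ultimately show ?thesis using measure_cylinder[of "idx ` {..<N}" "\<lambda>j. xs ! inv idx j"]
      by (simp add: side_sequences_def power_one_over)
  qed
  have "{a. Q (?w a)} = (\<Union>xs\<in>?X. ?C xs)" by auto
  then have "prob {a. Q (?w a)} = (\<Sum>xs\<in>?X. prob (?C xs))" using ev finite_side_lists
    by (simp only:) (rule finite_measure_finite_Union; auto simp: disjoint_family_on_def)
  also have "\<dots> = (\<Sum>xs\<in>?X. 1 / 2 ^ N)" by (rule sum.cong) (auto simp: pC)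
  finally show ?thesis by simp
qed

fun flip_side :: "side \<Rightarrow> side" where
  "flip_side L = R" | "flip_side R = L"

lemma flip_flip [simp]: "flip_side (flip_side x) = x"
  by (cases x) auto

lemma slope_flip [simp]: "slope (flip_side x) = - slope x"
  by (cases x) auto

lemma card_flip: "card {xs. length xs = N \<and> Q (map flip_side xs)} = card {xs. length xs = N \<and> Q xs}"
proof -
  have "{xs. length xs = N \<and> Q xs} = map flip_side ` {xs. length xs = N \<and> Q (map flip_side xs)}"
  proof (intro set_eqI iffI)
    fix xs assume "xs \<in> {xs. length xs = N \<and> Q xs}"
    then show "xs \<in> map flip_side ` {xs. length xs = N \<and> Q (map flip_side xs)}"
      by (intro image_eqI[of _ _ "map flip_side xs"]) (auto simp: comp_def)
  qed auto
  moreover have "inj (map flip_side)" by (rule inj_mapI) (metis flip_flip injI)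
  then have "card (map flip_side ` {xs. length xs = N \<and> Q (map flip_side xs)}) = card {xs. length xs = N \<and> Q (map flip_side xs)}"
    by (intro card_image) (rule inj_on_subset[OF _ subset_UNIV])
  ultimately show ?thesis by simp
qed

text \<open>Heights change by one, so a walk leaving the positive range does so through
  \<open>0\<close>, and the first visit there would be a partner of \<open>i\<close>.\<close>

lemma rise_positive_if_unmatched:
  assumes "a i = L" "\<And>j. \<not> opens a i j" "i \<le> t"
  shows "rise a i t > 0"
proof -
  have "\<forall>s. i \<le> s \<and> s \<le> t \<longrightarrow> rise a i s > 0" using assms(3)
  proof (induction t rule: int_ge_induct)
    case base
    then show ?case using assms(1) by (auto dest: antisym)
  next
    case (step t)
    have "rise a i (t + 1) = rise a i t + slope (a (t + 1))"
      using rise_split[of i t "t + 1" a] step.hyps by simp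
    moreover have "rise a i t > 0" using step by simp
    ultimately have "rise a i (t + 1) \<ge> 0" by (cases "a (t + 1)") auto
    moreover have "rise a i (t + 1) \<noteq> 0"
    proof
      assume "rise a i (t + 1) = 0"
      then have "opens a i (t + 1)" using step by (auto simp: opens_def)
      then show False using assms(2) by blast
    qed
    ultimately have "rise a i (t + 1) > 0" by simp
    then show ?case using step.IH by (metis zle_add1_eq_le order_le_less)
  qed
  then show ?thesis using assms(3) by simp
qed

lemma rise_negative_if_unmatched:
  assumes "a i = R" "\<And>j. \<not> opens a j i" "t \<le> i"
  shows "rise a t i < 0"
proof -
  have "\<forall>s. t \<le> s \<and> s \<le> i \<longrightarrow> rise a s i < 0" using assms(3)
  proof (induction t rule: int_le_induct)
    case base
    then show ?case using assms(1) by (auto dest: antisym)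
  next
    case (step t)
    have "rise a (t - 1) i = slope (a (t - 1)) + rise a t i"
      using rise_split[of "t - 1" "t - 1" i a] step.hyps by simp
    moreover have "rise a t i < 0" using step by simp
    ultimately have "rise a (t - 1) i \<le> 0" by (cases "a (t - 1)") auto
    moreover have "rise a (t - 1) i \<noteq> 0"
    proof
      assume z: "rise a (t - 1) i = 0"
      have "rise a (t - 1) u > 0" if "t - 1 \<le> u" "u < i" for u
      proof -
        have "rise a (t - 1) i = rise a (t - 1) u + rise a (u + 1) i"
          using rise_split[of "t - 1" u i a] that by simp
        moreover have "rise a (u + 1) i < 0" using step that by simp
        ultimately show ?thesis using z by simp
      qed
      then have "opens a (t - 1) i" using z step.hyps by (auto simp: opens_def)
      then show False using assms(2) by blast
    qed
    ultimately have neg: "rise a (t - 1) i < 0" by simp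
    show ?case
    proof (intro allI impI)
      fix s assume "t - 1 \<le> s \<and> s \<le> i"
      then show "rise a s i < 0" using neg step.IH by (cases "s = t - 1") auto
    qed
  qed
  then show ?thesis using assms(3) by simp
qed

text \<open>To the right of an unmatched \<open>L\<close> the walk never drops below its start. For
  an unmatched \<open>R\<close> the same holds when the word is read leftwards with its letters
  exchanged.\<close>

lemma walk_survives_if_unmatched:
  assumes "\<And>j. (i, j) \<notin> arc_rel a"
  shows "walk 0 (map (\<lambda>k. a (i + 1 + int k)) [0..<N]) \<noteq> None \<or>
    walk 0 (map flip_side (map (\<lambda>k. a (i - 1 - int k)) [0..<N])) \<noteq> None"
proof (cases "a i")
  case L
  let ?xs = "map (\<lambda>k. a (i + 1 + int k)) [0..<N]"
  have "int 0 + (\<Sum>x\<leftarrow>take m ?xs. slope x) \<ge> 0" if "m \<le> N" for m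
  proof -
    have "rise a (i + 1) (i + 1 + int m - 1) = (\<Sum>x\<leftarrow>take m ?xs. slope x)"
      by (rule rise_list) (use that in auto)
    moreover have "rise a i (i + int m) = slope (a i) + rise a (i + 1) (i + int m)"
      using rise_split[of i i "i + int m" a] by simp
    moreover have "rise a i (i + int m) > 0"
      by (rule rise_positive_if_unmatched[where a = a and i = i, OF L]) (use assms in \<open>auto simp: arc_rel_def\<close>)
    ultimately show ?thesis using L by simp
  qed
  then have "walk 0 ?xs \<noteq> None" unfolding walk_neq_None_iff by simp
  then show ?thesis ..
next
  case R
  let ?xs = "map flip_side (map (\<lambda>k. a (i - 1 - int k)) [0..<N])"
  have eq: "(\<Sum>x\<leftarrow>take m ?xs. slope x) = - rise a (i - int m) (i - 1)" if "m \<le> N" for m using that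
  proof (induction m)
    case 0
    then show ?case by (simp add: rise_empty)
  next
    case (Suc m)
    have "rise a (i - int (Suc m)) (i - 1) = slope (a (i - 1 - int m)) + rise a (i - int m) (i - 1)"
      using rise_split[of "i - 1 - int m" "i - 1 - int m" "i - 1" a] by (simp add: algebra_simps)
    then show ?case using Suc by (simp add: take_Suc_conv_app_nth)
  qed
  have "int 0 + (\<Sum>x\<leftarrow>take m ?xs. slope x) \<ge> 0" if "m \<le> N" for m
  proof -
    have "rise a (i - int m) i = rise a (i - int m) (i - 1) + slope (a i)"
      using rise_split[of "i - int m" "i - 1" i a] by simp
    moreover have "rise a (i - int m) i < 0"
      by (rule rise_negative_if_unmatched[where a = a and i = i, OF R]) (use assms in \<open>auto simp: arc_rel_def\<close>)
    ultimately show ?thesis using R eq[OF that] by simp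
  qed
  then have "walk 0 ?xs \<noteq> None" unfolding walk_neq_None_iff by simp
  then show ?thesis ..
qed

lemma sets_opens: "{a. opens a i j} \<in> sets side_sequences"
  by (rule sets_side_sequences_dependence[of "{i..j}"]) (auto intro!: opens_cong)

lemma pred_arc: "Measurable.pred side_sequences (\<lambda>a. (i, j) \<in> arc_rel a)"
proof -
  have "{a \<in> space side_sequences. (i, j) \<in> arc_rel a} = {a. opens a i j} \<union> {a. opens a j i}"
    by (auto simp: arc_rel_def)
  then show ?thesis unfolding pred_def using sets_opens by auto
qed

lemma pred_matched: "Measurable.pred side_sequences matched"
  unfolding matched_def using pred_arc by measurable

text \<open>For every \<open>N\<close>, a point without partner makes one of two fair walks survive
  \<open>N\<close> steps, so its probability is at most twice a null sequence. There are only
  countably many points.\<close>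

lemma AE_matched: "AE a in side_sequences. matched a"
proof -
  interpret prob_space side_sequences unfolding side_sequences_def by (rule prob_space_side_PiM)
  have "AE a in side_sequences. \<exists>j. (i, j) \<in> arc_rel a" for i
  proof -
    let ?U = "{a. \<not> (\<exists>j. (i, j) \<in> arc_rel a)}"
    have U: "?U \<in> events"
    proof -
      have "{a \<in> space side_sequences. \<not> (\<exists>j. (i, j) \<in> arc_rel a)} \<in> events"
        using pred_arc by measurable
      then show ?thesis by simp
    qed
    have le: "prob ?U \<le> 2 * survival N 0" for N
    proof -
      let ?A = "{a. walk 0 (map (\<lambda>k. a (i + 1 + int k)) [0..<N]) \<noteq> None}"
      let ?B = "{a. walk 0 (map flip_side (map (\<lambda>k. a (i - 1 - int k)) [0..<N])) \<noteq> None}"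
      have A: "?A \<in> events" by (rule sets_side_sequences_dependence[of "{i..i + int N}"])
          (auto intro!: arg_cong[of _ _ "\<lambda>y. \<exists>z. walk 0 y = Some z"])
      have B: "?B \<in> events" by (rule sets_side_sequences_dependence[of "{i - int N..i}"])
          (auto intro!: arg_cong[of _ _ "\<lambda>y. \<exists>z. walk 0 y = Some z"])
      have "prob ?A = survival N 0"
        unfolding survival_def by (rule measure_side_sequences_list) (auto simp: inj_def)
      moreover have "prob ?B = survival N 0"
        unfolding survival_def card_flip[of N "\<lambda>xs. walk 0 xs \<noteq> None", symmetric]
        by (rule measure_side_sequences_list) (auto simp: inj_def)
      moreover have "prob ?U \<le> prob (?A \<union> ?B)"
        by (rule finite_measure_mono) (use walk_survives_if_unmatched[of i _ N] A B in blast)+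
      moreover have "prob (?A \<union> ?B) \<le> prob ?A + prob ?B" by (rule measure_Un_le[OF A B])
      ultimately show ?thesis by linarith
    qed
    have "(\<lambda>N. 2 * survival N 0) \<longlonglongrightarrow> 2 * 0" by (intro tendsto_intros survival_tendsto_0)
    then have "prob ?U \<le> 2 * 0" by (rule LIMSEQ_le_const) (use le in blast)
    then have "prob ?U = 0" by (simp add: measure_le_0_iff)
    then have "AE a in side_sequences. a \<notin> ?U"
      using U by (intro AE_not_in) (auto simp: null_sets_def emeasure_eq_measure)
    then show ?thesis by simp
  qed
  then show ?thesis unfolding matched_def by (simp add: AE_all_countable)
qed

lemma measurable_matched_part: "matched_part \<in> measurable side_sequences side_sequences"
proof -
  have "{a \<in> space side_sequences. matched a} \<in> sets side_sequences"
    using pred_matched by (simp add: pred_def)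
  then show ?thesis
    unfolding matched_part_def[abs_def] by (intro measurable_If measurable_ident measurable_const) auto
qed

lemma measurable_ball_weight_coins:
  "(\<lambda>x. ball_weight K (\<lambda>i. x (False, i)) (\<lambda>i. x (True, i)) 0) \<in> borel_measurable coins"
  unfolding coins_def by (rule measurable_finite_dependence[of "UNIV \<times> {- int (K * K)..int (K * K)}"])
    (auto intro!: ball_weight_local simp: abs_le_iff)

lemma measurable_ball_weight:
  "(\<lambda>(a, b). ball_weight K a b 0) \<in> borel_measurable (side_sequences \<Otimes>\<^sub>M side_sequences)"
proof -
  let ?S = "side_sequences \<Otimes>\<^sub>M side_sequences"
  have "(\<lambda>p j. (if fst j then snd p (snd j) else fst p (snd j))) \<in> measurable ?S coins"
    unfolding coins_def
  proof (rule measurable_PiM_single')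
    fix j :: "bool \<times> int"
    have "(\<lambda>a. a (snd j)) \<in> measurable side_sequences side_measure"
      unfolding side_sequences_def by (rule measurable_component_singleton) simp
    then show "(\<lambda>p. if fst j then snd p (snd j) else fst p (snd j)) \<in> measurable ?S side_measure"
      by (cases "fst j") (auto intro: measurable_compose[OF measurable_snd] measurable_compose[OF measurable_fst])
  qed simp
  from measurable_compose[OF this measurable_ball_weight_coins[of K]]
  show ?thesis by (simp add: case_prod_unfold)
qed

lemma measurable_long_arc:
  "(\<lambda>x. of_bool (long_arc K (\<lambda>i. x (b, i)) 0) :: real) \<in> borel_measurable coins" unfolding coins_def
proof (rule measurable_finite_dependence[of "{b} \<times> {- int K..int K}"])
  fix x y :: "bool \<times> int \<Rightarrow> side" assume "\<And>j. j \<in> {b} \<times> {- int K..int K} \<Longrightarrow> x j = y j"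
  then have "long_arc K (\<lambda>i. x (b, i)) 0 = long_arc K (\<lambda>i. y (b, i)) 0"
    by (intro long_arc_local) (auto simp: abs_le_iff)
  then show "(of_bool (long_arc K (\<lambda>i. x (b, i)) 0) :: real) = of_bool (long_arc K (\<lambda>i. y (b, i)) 0)" by simp
qed auto

lemma AE_coins_matched: "AE x in coins. matched (\<lambda>i. x (b, i))"
proof -
  have d: "distr coins side_sequences (\<lambda>x i. x (b, i)) = side_sequences"
    unfolding coins_def side_sequences_def by (rule distr_reindex_side_PiM) (auto simp: inj_def)
  have m: "(\<lambda>x i. x (b, i)) \<in> measurable coins side_sequences"
    unfolding coins_def side_sequences_def by (rule measurable_reindex_side_PiM) simp
  have "AE a in distr coins side_sequences (\<lambda>x i. x (b, i)). matched a" unfolding d by (rule AE_matched)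
  then show ?thesis by (rule AE_distrD[OF m])
qed

lemma expectation_long_arc_tendsto: "(\<lambda>K. \<integral>x. of_bool (long_arc K (\<lambda>i. x (b, i)) 0) \<partial>coins) \<longlonglongrightarrow> (0::real)"
proof -
  let ?w = "\<lambda>K x. of_bool (long_arc K (\<lambda>i. x (b, i)) 0)"
  interpret prob_space coins unfolding coins_def by (rule prob_space_side_PiM)
  have "(\<lambda>K. \<integral>x. ?w K x \<partial>coins) \<longlonglongrightarrow> (\<integral>x. (0::real) \<partial>coins)"
  proof (rule integral_dominated_convergence[where w = "\<lambda>_. 1"])
    show "AE x in coins. (\<lambda>K. ?w K x) \<longlonglongrightarrow> (0::real)"
      using AE_coins_matched[of b]
    proof eventually_elim
      case (elim x)
      then obtain j where j: "(0, j) \<in> arc_rel (\<lambda>i. x (b, i))" by (auto simp: matched_def)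
      have "\<not> long_arc K (\<lambda>i. x (b, i)) 0" if "K \<ge> nat \<bar>j\<bar>" for K
        unfolding long_arc_def using j that by auto
      then have "eventually (\<lambda>K. ?w K x = (0::real)) sequentially"
        unfolding eventually_sequentially by auto
      then show ?case by (rule tendsto_eventually)
    qed
  qed (auto simp: measurable_long_arc)
  then show ?thesis by simp
qed

text \<open>After passing to \<open>matched_part\<close> the ball weights converge for every pair of
  words, exceptional ones included, which shows that the integrand of \<open>kappa\<close> is
  measurable. Almost surely \<open>matched_part\<close> changes nothing, and dominated convergence
  applies.\<close>

lemma expectation_ball_weight_tendsto:
  "(\<lambda>K. 2 * (\<integral>x. ball_weight K (\<lambda>i. x (False, i)) (\<lambda>i. x (True, i)) 0 \<partial>coins)) \<longlonglongrightarrow> kappa"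
proof -
  let ?w = "\<lambda>K x. ball_weight K (\<lambda>i. x (False, i)) (\<lambda>i. x (True, i)) 0"
  interpret prob_space coins unfolding coins_def by (rule prob_space_side_PiM)
  let ?S = "side_sequences \<Otimes>\<^sub>M side_sequences"
  define \<phi> where "\<phi> = (\<lambda>(a, b). if finite (noodle_component a b) then 2 / real (card (noodle_component a b)) else 0)"
  have comp: "noodle_component a b = (arc_rel (matched_part a) \<union> arc_rel (matched_part b))\<^sup>* `` {0}" for a b
    by (auto simp: noodle_component_def noodle_eq)
  have lim: "(\<lambda>K. 2 * ball_weight K (matched_part a) (matched_part b) 0) \<longlonglongrightarrow> \<phi> (a, b)" for a b
  proof -
    let ?C = "noodle_component a b"
    have "(\<lambda>K. 2 * ball_weight K (matched_part a) (matched_part b) 0) \<longlonglongrightarrow>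
        2 * (if finite ?C then 1 / real (card ?C) else 0)"
      unfolding comp by (rule tendsto_mult_left[OF ball_weight_tendsto])
    moreover have "2 * (if finite ?C then 1 / real (card ?C) else 0) = \<phi> (a, b)" by (simp add: \<phi>_def)
    ultimately show ?thesis by simp
  qed
  have meas: "\<phi> \<in> borel_measurable ?S"
  proof (rule borel_measurable_LIMSEQ_real)
    show "(\<lambda>K. 2 * ball_weight K (matched_part (fst p)) (matched_part (snd p)) 0) \<longlonglongrightarrow> \<phi> p" for p
      using lim[of "fst p" "snd p"] by simp
    fix K
    have "(\<lambda>p. (matched_part (fst p), matched_part (snd p))) \<in> measurable ?S ?S"
      by (intro measurable_Pair measurable_compose[OF measurable_fst measurable_matched_part]
          measurable_compose[OF measurable_snd measurable_matched_part])
    from measurable_compose[OF this measurable_ball_weight[of K]]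
    show "(\<lambda>p. 2 * ball_weight K (matched_part (fst p)) (matched_part (snd p)) 0) \<in> borel_measurable ?S"
      by simp
  qed
  have "kappa = (\<integral>p. \<phi> p \<partial>distr coins ?S coin_words)" by (simp add: kappa_def \<phi>_def distr_coin_words)
  also have "\<dots> = (\<integral>x. \<phi> (coin_words x) \<partial>coins)" by (rule integral_distr[OF measurable_coin_words meas])
  finally have \<kappa>: "kappa = (\<integral>x. \<phi> (coin_words x) \<partial>coins)" .
  have "(\<lambda>K. \<integral>x. 2 * ?w K x \<partial>coins) \<longlonglongrightarrow> kappa" unfolding \<kappa>
  proof (rule integral_dominated_convergence[where w = "\<lambda>_. 2"])
    show "(\<lambda>x. \<phi> (coin_words x)) \<in> borel_measurable coins"
      using measurable_compose[OF measurable_coin_words meas] .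
    show "AE x in coins. (\<lambda>K. 2 * ?w K x) \<longlonglongrightarrow> \<phi> (coin_words x)"
      using AE_coins_matched[of False] AE_coins_matched[of True]
    proof eventually_elim
      case (elim x)
      then show ?case
        using lim[of "\<lambda>i. x (False, i)" "\<lambda>i. x (True, i)"] by (simp add: coin_words_def matched_part_def)
    qed
    show "AE x in coins. norm (2 * ?w K x) \<le> 2" for K
      by (rule AE_I2) (use ball_weight_bounds in \<open>simp add: abs_le_iff\<close>)
    show "(\<lambda>x. 2 * ?w K x) \<in> borel_measurable coins" for K
      using measurable_ball_weight_coins[of K] by simp
  qed simp
  then show ?thesis by simp
qed

subsection \<open>Transfer to uniform non-crossing partitions\<close>

definition word_cylinder :: "nat \<Rightarrow> nat set set \<Rightarrow> nat set set \<Rightarrow> (bool \<times> int \<Rightarrow> side) set" where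
  "word_cylinder n P Q = {x. \<forall>k\<in>{1..2 * int n}. x (False, k) = NC_word P k \<and> x (True, k) = NC_word Q k}"

lemma word_cylinder_eq:
  "word_cylinder n P Q = {x. \<forall>j\<in>UNIV \<times> {1..2 * int n}. x j = (if fst j then NC_word Q (snd j) else NC_word P (snd j))}"
  by (auto simp: word_cylinder_def)

lemma sets_word_cylinder: "word_cylinder n P Q \<in> sets coins"
proof -
  have "{x \<in> space coins. \<forall>j\<in>UNIV \<times> {1..2 * int n}. x j = (if fst j then NC_word Q (snd j) else NC_word P (snd j))} \<in> sets coins"
    unfolding coins_def by (rule sets_finite_dependence[of "UNIV \<times> {1..2 * int n}"]) auto
  then show ?thesis by (simp add: word_cylinder_eq)
qed

lemma measure_word_cylinder: "measure coins (word_cylinder n P Q) = 1 / 16 ^ n"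
proof -
  have "card ((UNIV :: bool set) \<times> {1..2 * int n}) = 4 * n" by (simp add: card_cartesian_product)
  then have "measure coins (word_cylinder n P Q) = (1 / 2) ^ (4 * n)"
    unfolding word_cylinder_eq coins_def by (subst measure_cylinder) auto
  then show ?thesis by (simp add: power_mult power_one_over)
qed

lemma word_cylinder_inj:
  assumes "P \<in> NC n" "Q \<in> NC n" "P' \<in> NC n" "Q' \<in> NC n" "x \<in> word_cylinder n P Q" "x \<in> word_cylinder n P' Q'"
  shows "P = P' \<and> Q = Q'"
proof -
  have "NC_word P k = NC_word P' k \<and> NC_word Q k = NC_word Q' k" if "k \<in> {1..2 * int n}" for k
    using assms(5,6) that unfolding word_cylinder_def by auto
  then show ?thesis using NC_word_inj[OF assms(1,3)] NC_word_inj[OF assms(2,4)] by blast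
qed

text \<open>The words determine the partitions, so the cylinders of distinct pairs are disjoint;
  each fixes \<open>4 * n\<close> letters and has measure \<open>1 / 16 ^ n\<close>. Counting bad
  pairs thereby becomes estimating a probability for independent letters.\<close>

lemma card_le_measure_coins:
  assumes "Bad \<subseteq> NC n \<times> NC n" "E \<in> sets coins"
    and "\<And>P Q. (P, Q) \<in> Bad \<Longrightarrow> word_cylinder n P Q \<subseteq> E"
  shows "real (card Bad) \<le> 16 ^ n * measure coins E"
proof -
  interpret prob_space coins unfolding coins_def by (rule prob_space_side_PiM)
  let ?C = "\<lambda>e. word_cylinder n (fst e) (snd e)"
  have fin: "finite Bad" using assms(1) finite_NC[of n] finite_subset by blast
  have "disjoint_family_on ?C Bad" unfolding disjoint_family_on_def
  proof (intro ballI impI)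
    fix e e' assume e: "e \<in> Bad" "e' \<in> Bad" "e \<noteq> e'"
    then have "fst e \<in> NC n" "snd e \<in> NC n" "fst e' \<in> NC n" "snd e' \<in> NC n" using assms(1) by auto
    from word_cylinder_inj[OF this] show "?C e \<inter> ?C e' = {}" using e(3) by (auto simp: prod_eq_iff)
  qed
  then have "prob (\<Union>e\<in>Bad. ?C e) = (\<Sum>e\<in>Bad. prob (?C e))"
    by (intro finite_measure_finite_Union fin) (auto simp: sets_word_cylinder)
  also have "\<dots> = real (card Bad) / 16 ^ n" by (simp add: measure_word_cylinder)
  finally have "real (card Bad) / 16 ^ n = prob (\<Union>e\<in>Bad. ?C e)" by simp
  also have "\<dots> \<le> prob E" by (rule finite_measure_mono) (use assms(2,3) in \<open>auto simp: subset_iff\<close>)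
  finally show ?thesis by (simp add: field_simps)
qed

lemma prob_uniform_pair_le:
  assumes "prob_space M" "finite A"
    and ind: "prob_space.indep_var M (count_space A) X (count_space A) Y"
    and X: "distr M (count_space A) X = uniform_count_measure A"
    and Y: "distr M (count_space A) Y = uniform_count_measure A"
    and Bad: "Bad \<subseteq> A \<times> A"
  shows "measure M {\<omega> \<in> space M. (X \<omega>, Y \<omega>) \<in> Bad} \<le> real (card Bad) / real (card A) ^ 2"
proof -
  interpret prob_space M by fact
  have fin: "finite Bad" using Bad assms(2) finite_subset by blast
  have mX: "X \<in> measurable M (count_space A)" and mY: "Y \<in> measurable M (count_space A)"
    using indep_var_rv1[OF ind] indep_var_rv2[OF ind] by auto
  have single: "prob (Z -` {z} \<inter> space M) = 1 / real (card A)"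
    if "Z \<in> measurable M (count_space A)" "distr M (count_space A) Z = uniform_count_measure A" "z \<in> A" for Z z
  proof -
    have "prob (Z -` {z} \<inter> space M) = measure (distr M (count_space A) Z) {z}"
      using that by (subst measure_distr) auto
    also have "\<dots> = 1 / real (card A)"
      unfolding that(2) using that(3) assms(2) by (subst measure_uniform_count_measure) auto
    finally show ?thesis .
  qed
  let ?E = "\<lambda>e. {\<omega> \<in> space M. X \<omega> = fst e \<and> Y \<omega> = snd e}"
  have E: "prob (?E e) = 1 / real (card A) ^ 2 \<and> ?E e \<in> events" if "e \<in> Bad" for e
  proof -
    have eA: "fst e \<in> A" "snd e \<in> A" using that Bad by auto
    have eq: "?E e = (\<lambda>\<omega>. (X \<omega>, Y \<omega>)) -` ({fst e} \<times> {snd e}) \<inter> space M" by auto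
    have "prob (?E e) = prob (X -` {fst e} \<inter> space M) * prob (Y -` {snd e} \<inter> space M)"
      unfolding eq by (rule indep_varD[OF ind]) (use eA in auto)
    also have "\<dots> = 1 / real (card A) ^ 2"
      by (simp add: single[OF mX X eA(1)] single[OF mY Y eA(2)] power2_eq_square)
    finally have "prob (?E e) = 1 / real (card A) ^ 2" .
    moreover have "?E e = (X -` {fst e} \<inter> space M) \<inter> (Y -` {snd e} \<inter> space M)" by auto
    then have "?E e \<in> events"
      using measurable_sets[OF mX, of "{fst e}"] measurable_sets[OF mY, of "{snd e}"] eA by auto
    ultimately show ?thesis by blast
  qed
  have "{\<omega> \<in> space M. (X \<omega>, Y \<omega>) \<in> Bad} = (\<Union>e\<in>Bad. ?E e)" by auto
  then have "prob {\<omega> \<in> space M. (X \<omega>, Y \<omega>) \<in> Bad} \<le> (\<Sum>e\<in>Bad. prob (?E e))"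
    by (simp only:) (rule finite_measure_subadditive_finite[OF fin], use E in blast)
  also have "\<dots> = real (card Bad) / real (card A) ^ 2" using E by simp
  finally show ?thesis .
qed

theorem proposition2:
  fixes M :: "nat \<Rightarrow> 'a measure"
    and \<rho> \<pi> :: "nat \<Rightarrow> 'a \<Rightarrow> nat set set"
  assumes "\<And>n. n \<ge> 1 \<Longrightarrow> prob_space (M n)"
    and "\<And>n. n \<ge> 1 \<Longrightarrow>
           prob_space.indep_var (M n) (count_space (NC n)) (\<rho> n) (count_space (NC n)) (\<pi> n)"
    and "\<And>n. n \<ge> 1 \<Longrightarrow> distr (M n) (count_space (NC n)) (\<rho> n) = uniform_count_measure (NC n)"
    and "\<And>n. n \<ge> 1 \<Longrightarrow> distr (M n) (count_space (NC n)) (\<pi> n) = uniform_count_measure (NC n)"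
  shows "\<forall>\<epsilon>>0. (\<lambda>n. measure (M n)
           {\<omega> \<in> space (M n).
              \<bar>real (graph_dist (hasse n) (\<rho> n \<omega>) (\<pi> n \<omega>)) / real n - (1 - kappa)\<bar> > \<epsilon>})
           \<longlonglongrightarrow> 0"
proof (intro allI impI)
  fix \<epsilon> :: real assume "\<epsilon> > 0"
  interpret prob_space coins unfolding coins_def by (rule prob_space_side_PiM)
  define F where "F K x = ball_weight K (\<lambda>i. x (False, i)) (\<lambda>i. x (True, i)) 0" for K and x :: "bool \<times> int \<Rightarrow> side"
  \<comment> \<open>Halved to take values between \<open>0\<close> and \<open>1\<close>, as
    \<open>local_average_deviation\<close> requires.\<close>
  define G where "G K x = (of_bool (long_arc K (\<lambda>i. x (False, i)) 0) + of_bool (long_arc K (\<lambda>i. x (True, i)) 0)) / (2::real)"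
    for K and x :: "bool \<times> int \<Rightarrow> side"
  have Gm: "G K \<in> borel_measurable coins" for K
    unfolding G_def[abs_def] using measurable_long_arc[of K False] measurable_long_arc[of K True] by simp
  have Fm: "F K \<in> borel_measurable coins" for K
    unfolding F_def[abs_def] by (rule measurable_ball_weight_coins)
  have limF: "(\<lambda>K. 2 * expectation (F K)) \<longlonglongrightarrow> kappa"
    unfolding F_def[abs_def] by (rule expectation_ball_weight_tendsto)
  have intL: "integrable coins (\<lambda>x. of_bool (long_arc K (\<lambda>i. x (b, i)) 0) :: real)" for K b
    by (rule integrable_const_bound[of _ 1]) (auto simp: measurable_long_arc)
  have eqG: "expectation (G K) = (expectation (\<lambda>x. of_bool (long_arc K (\<lambda>i. x (False, i)) 0)) +
      expectation (\<lambda>x. of_bool (long_arc K (\<lambda>i. x (True, i)) 0))) / 2" for K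
    unfolding G_def[abs_def] using intL by simp
  have "(\<lambda>K. (expectation (\<lambda>x. of_bool (long_arc K (\<lambda>i. x (False, i)) 0)) +
      expectation (\<lambda>x. of_bool (long_arc K (\<lambda>i. x (True, i)) 0))) / 2) \<longlonglongrightarrow> (0 + 0) / (2::real)"
    by (intro tendsto_intros expectation_long_arc_tendsto) simp
  then have limG: "(\<lambda>K. expectation (G K)) \<longlonglongrightarrow> 0" unfolding eqG[symmetric] by simp
  have "eventually (\<lambda>K. \<bar>2 * expectation (F K) - kappa\<bar> < \<epsilon> / 4) sequentially"
    using tendstoD[OF limF, of "\<epsilon> / 4"] \<open>\<epsilon> > 0\<close> by (simp add: dist_real_def)
  moreover have "eventually (\<lambda>K. \<bar>expectation (G K)\<bar> < \<epsilon> / 16) sequentially"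
    using tendstoD[OF limG, of "\<epsilon> / 16"] \<open>\<epsilon> > 0\<close> by (simp add: dist_real_def)
  moreover have "eventually (\<lambda>K. 2 / real (Suc K) < \<epsilon> / 4) sequentially" using \<open>\<epsilon> > 0\<close> by real_asymp
  ultimately have "eventually (\<lambda>K. \<bar>2 * expectation (F K) - kappa\<bar> < \<epsilon> / 4 \<and>
      \<bar>expectation (G K)\<bar> < \<epsilon> / 16 \<and> 2 / real (Suc K) < \<epsilon> / 4) sequentially" by eventually_elim simp
  then obtain K where K: "\<bar>2 * expectation (F K) - kappa\<bar> < \<epsilon> / 4" "\<bar>expectation (G K)\<bar> < \<epsilon> / 16"
      "2 / real (Suc K) < \<epsilon> / 4" unfolding eventually_sequentially by blast
  \<comment> \<open>The error budget, in multiples of \<open>n * \<epsilon>\<close>: one quarter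
    each for large components, for the mean of \<open>F K\<close> and for the mean number of long
    arcs; the fluctuation of \<open>F K\<close> over \<open>2 * n\<close> points takes
    \<open>1 / 12\<close>, that of \<open>G K\<close> twice as much, since \<open>G K\<close> is
    halved. The sum is \<open>1\<close>.\<close>
  define \<delta> where "\<delta> = \<epsilon> / 24"
  have "\<delta> > 0" using \<open>\<epsilon> > 0\<close> by (simp add: \<delta>_def)
  define DF where "DF = 2 * real (K * K) + 1"
  define DG where "DG = 2 * real K + 1"
  define cF where "cF = 2 * \<delta>\<^sup>2 / DF\<^sup>2"
  define cG where "cG = 2 * \<delta>\<^sup>2 / DG\<^sup>2"
  have pos: "DF > 0" "DG > 0" by (simp_all add: DF_def DG_def add_nonneg_pos)
  then have c: "cF > 0" "cG > 0" using \<open>\<delta> > 0\<close> by (simp_all add: cF_def cG_def)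
  define dev where "dev H n = {x. \<bar>(\<Sum>i\<in>{1..int (2 * n)}. H (coin_shift i x)) - real (2 * n) * expectation H\<bar> \<ge> \<delta> * real (2 * n)}"
    for H :: "(bool \<times> int \<Rightarrow> side) \<Rightarrow> real" and n
  let ?D = "\<lambda>n. dev (F K) n \<union> dev (G K) n" and ?eF = "\<lambda>n. 2 * DF * exp (- cF * real (2 * n))" and ?eG = "\<lambda>n. 2 * DG * exp (- cG * real (2 * n))"
  have devF: "prob (dev (F K) n) \<le> ?eF n" if "n \<ge> 1" for n
    unfolding dev_def DF_def cF_def
  proof (rule local_average_deviation)
    fix x y :: "bool \<times> int \<Rightarrow> side" assume "\<And>b i. \<bar>i\<bar> \<le> int (K * K) \<Longrightarrow> x (b, i) = y (b, i)"
    then show "F K x = F K y" unfolding F_def by (intro ball_weight_local) auto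
  qed (use ball_weight_bounds \<open>\<delta> > 0\<close> that in \<open>auto simp: F_def\<close>)
  have devG: "prob (dev (G K) n) \<le> ?eG n" if "n \<ge> 1" for n
    unfolding dev_def DG_def cG_def
  proof (rule local_average_deviation)
    fix x y :: "bool \<times> int \<Rightarrow> side" assume "\<And>b i. \<bar>i\<bar> \<le> int K \<Longrightarrow> x (b, i) = y (b, i)"
    then have "long_arc K (\<lambda>i. x (b, i)) 0 = long_arc K (\<lambda>i. y (b, i)) 0" for b
      by (intro long_arc_local) auto
    then show "G K x = G K y" unfolding G_def by simp
  qed (use \<open>\<delta> > 0\<close> that in \<open>auto simp: G_def\<close>)
  have sets_dev: "dev H n \<in> events" if [measurable]: "H \<in> borel_measurable coins" for H n
  proof -
    have [measurable]: "(\<lambda>x. H (coin_shift i x)) \<in> borel_measurable coins" for i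
      by (rule measurable_compose[OF measurable_coin_shift that])
    have "{x \<in> space coins. \<bar>(\<Sum>i\<in>{1..int (2 * n)}. H (coin_shift i x)) - real (2 * n) * expectation H\<bar> \<ge> \<delta> * real (2 * n)} \<in> events"
      by measurable
    then show ?thesis by (simp add: dev_def)
  qed
  define ev where "ev n = {\<omega> \<in> space (M n).
      \<bar>real (graph_dist (hasse n) (\<rho> n \<omega>) (\<pi> n \<omega>)) / real n - (1 - kappa)\<bar> > \<epsilon>}" for n
  define Bad where "Bad n = {(P, Q) \<in> NC n \<times> NC n. \<bar>real (graph_dist (hasse n) P Q) / real n - (1 - kappa)\<bar> > \<epsilon>}" for n
  \<comment> \<open>The deterministic core: once neither average deviates, the estimate of
    \<open>ncc\<close> by ball weights leaves no room for a bad pair.\<close>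
  have cyl: "word_cylinder n P Q \<subseteq> ?D n" if n: "n \<ge> 1" and PQ: "(P, Q) \<in> Bad n" for n P Q
  proof (rule subsetI, rule ccontr)
    fix x assume x: "x \<in> word_cylinder n P Q" and no: "x \<notin> ?D n"
    let ?a = "\<lambda>i. x (False, i)" and ?b = "\<lambda>i. x (True, i)"
    have NC: "P \<in> NC n" "Q \<in> NC n" and far: "\<bar>real (graph_dist (hasse n) P Q) / real n - (1 - kappa)\<bar> > \<epsilon>"
      using PQ by (auto simp: Bad_def)
    have Fs: "F K (coin_shift i x) = ball_weight K ?a ?b i" for i
      by (simp add: F_def coin_shift_def ball_weight_shift[of K "?a" i "?b"])
    have Gs: "G K (coin_shift i x) = (of_bool (long_arc K ?a i) + of_bool (long_arc K ?b i)) / 2" for i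
      by (simp add: G_def coin_shift_def long_arc_shift[of K "?a" i] long_arc_shift[of K "?b" i])
    define N where "N = real n"
    have N: "N > 0" using n by (simp add: N_def)
    define SF where "SF = (\<Sum>i\<in>{1..2 * int n}. ball_weight K ?a ?b i)"
    define SG where "SG = (\<Sum>i\<in>{1..2 * int n}. of_bool (long_arc K ?a i) + of_bool (long_arc K ?b i) :: real)"
    have "\<bar>real (ncc n P Q) - SF\<bar> \<le> 2 * N / real (Suc K) + SG" unfolding SF_def SG_def N_def
      by (rule ncc_ball_weight[OF NC]) (use x in \<open>auto simp: word_cylinder_def\<close>)
    moreover have "2 * N / real (Suc K) \<le> N * (\<epsilon> / 4)"
      using mult_left_mono[OF less_imp_le[OF K(3)], of N] N by simp
    moreover have "\<bar>SF - 2 * N * expectation (F K)\<bar> < \<delta> * (2 * N)"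
      using no by (simp add: dev_def Fs SF_def N_def not_le)
    moreover have "\<bar>SG / 2 - 2 * N * expectation (G K)\<bar> < \<delta> * (2 * N)"
      using no by (simp add: dev_def Gs SG_def N_def not_le sum_divide_distrib)
    moreover have "\<bar>2 * N * expectation (F K) - N * kappa\<bar> \<le> N * (\<epsilon> / 4)"
    proof -
      have "2 * N * expectation (F K) - N * kappa = N * (2 * expectation (F K) - kappa)"
        by (simp add: right_diff_distrib)
      then have "\<bar>2 * N * expectation (F K) - N * kappa\<bar> = N * \<bar>2 * expectation (F K) - kappa\<bar>"
        using N by (simp only: abs_mult abs_of_pos)
      also have "\<dots> \<le> N * (\<epsilon> / 4)" using K(1) N by (intro mult_left_mono) auto
      finally show ?thesis .
    qed
    moreover have "2 * N * expectation (G K) \<le> 2 * N * (\<epsilon> / 16)"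
      using K(2) N by (intro mult_left_mono) auto
    moreover have "\<delta> * (2 * N) = N * (\<epsilon> / 12)" by (simp add: \<delta>_def)
    ultimately have near: "\<bar>real (ncc n P Q) - N * kappa\<bar> \<le> N * \<epsilon>" by linarith
    have "ncc n P Q \<le> n" by (rule ncc_le[OF NC(1)])
    then have "real (graph_dist (hasse n) P Q) = N - real (ncc n P Q)"
      by (simp add: graph_dist_hasse[OF NC] N_def of_nat_diff)
    then have "real (graph_dist (hasse n) P Q) / N - (1 - kappa) = (N * kappa - real (ncc n P Q)) / N"
      using N by (simp add: field_simps)
    then have "\<bar>real (graph_dist (hasse n) P Q) / N - (1 - kappa)\<bar> = \<bar>real (ncc n P Q) - N * kappa\<bar> / N"
      using N by (simp add: abs_minus_commute)
    also have "\<dots> \<le> \<epsilon>" using near N by (simp add: divide_le_eq mult.commute)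
    finally show False using far by (simp add: N_def)
  qed
  \<comment> \<open>\<open>16 * n ^ 4\<close> is the square of the factor \<open>4 * n ^ 2\<close>
    in \<open>card_NC_lower_bound\<close>, because two partitions are drawn: it bounds
    \<open>16 ^ n / card (NC n) ^ 2\<close>.\<close>
  define u where "u n = 16 * real n ^ 4 * (?eF n + ?eG n)" for n
  have bound: "measure (M n) (ev n) \<le> u n" if n: "n \<ge> 1" for n
  proof -
    interpret Mn: prob_space "M n" by (rule assms(1)[OF n])
    have rv: "\<rho> n \<in> measurable (M n) (count_space (NC n))" "\<pi> n \<in> measurable (M n) (count_space (NC n))"
      using Mn.indep_var_rv1[OF assms(2)[OF n]] Mn.indep_var_rv2[OF assms(2)[OF n]] by auto
    have "ev n = {\<omega> \<in> space (M n). (\<rho> n \<omega>, \<pi> n \<omega>) \<in> Bad n}"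
      using measurable_space[OF rv(1)] measurable_space[OF rv(2)] by (auto simp: Bad_def ev_def)
    then have "measure (M n) (ev n)
        \<le> real (card (Bad n)) / real (card (NC n)) ^ 2"
      using prob_uniform_pair_le[OF assms(1)[OF n] finite_NC assms(2)[OF n] assms(3)[OF n] assms(4)[OF n], of "Bad n"]
      by (auto simp: Bad_def)
    also have "\<dots> \<le> 16 ^ n * prob (?D n) / real (card (NC n)) ^ 2"
      using card_le_measure_coins[of "Bad n" n "?D n"] sets_dev Fm Gm cyl[OF n]
      by (intro divide_right_mono) (auto simp: Bad_def)
    also have "\<dots> \<le> 16 * real n ^ 4 * prob (?D n)"
    proof -
      let ?c = "real (card (NC n))"
      have c4: "4 ^ n \<le> 4 * real n ^ 2 * ?c" using card_NC_lower_bound[of n] n by simp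
      then have "(4 ^ n)\<^sup>2 \<le> (4 * real n ^ 2 * ?c)\<^sup>2" by (intro power_mono) auto
      moreover have "((4::real) ^ n)\<^sup>2 = 16 ^ n" by (simp add: power2_eq_square flip: power_mult_distrib)
      ultimately have "16 ^ n \<le> 16 * real n ^ 4 * ?c\<^sup>2" by (simp add: power_mult_distrib)
      moreover have "?c > 0"
      proof (rule ccontr)
        assume "\<not> ?c > 0"
        then have "(4::real) ^ n \<le> 0" using c4 by simp
        moreover have "(4::real) ^ n > 0" by simp
        ultimately show False by linarith
      qed
      ultimately have "16 ^ n / ?c\<^sup>2 \<le> 16 * real n ^ 4" by (simp add: divide_le_eq)
      then have "16 ^ n / ?c\<^sup>2 * prob (?D n) \<le> 16 * real n ^ 4 * prob (?D n)"
        by (intro mult_right_mono) auto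
      then show ?thesis by simp
    qed
    also have "\<dots> \<le> u n"
    proof -
      have "prob (?D n) \<le> prob (dev (F K) n) + prob (dev (G K) n)"
        by (rule measure_Un_le) (use sets_dev Fm Gm in auto)
      also have "\<dots> \<le> ?eF n + ?eG n"
        by (intro add_mono devF devG n)
      finally show ?thesis unfolding u_def by (intro mult_left_mono) auto
    qed
    finally show ?thesis .
  qed
  have decay: "(\<lambda>n. real n ^ 4 * exp (- c * real (2 * n))) \<longlonglongrightarrow> 0" if "c > 0" for c :: real
    using that by real_asymp
  have "(\<lambda>n. 32 * DF * (real n ^ 4 * exp (- cF * real (2 * n))) + 32 * DG * (real n ^ 4 * exp (- cG * real (2 * n))))
      \<longlonglongrightarrow> 32 * DF * 0 + 32 * DG * 0" by (intro tendsto_intros decay c)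
  then have lim: "u \<longlonglongrightarrow> 0" unfolding u_def[abs_def] by (simp add: algebra_simps)
  show "(\<lambda>n. measure (M n) {\<omega> \<in> space (M n).
      \<bar>real (graph_dist (hasse n) (\<rho> n \<omega>) (\<pi> n \<omega>)) / real n - (1 - kappa)\<bar> > \<epsilon>}) \<longlonglongrightarrow> 0"
    unfolding ev_def[symmetric]
  proof (rule tendsto_sandwich[OF _ _ tendsto_const lim])
    show "eventually (\<lambda>n. measure (M n) (ev n) \<le> u n) sequentially"
      using bound unfolding eventually_sequentially by blast
  qed simp
qed

end
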